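(* Let $s\neq 1$ be a positive real number, let $a$ be a complex number with $\Re(a)>0$, and let $n\ge 0$ and $p\ge 1$ be integers. Then the sequence (indexed by $m$) $$RPA(n,m+p,m):=\sum_{k=0}^{n-1}\frac{1}{(k+a)^s}+(n+a)^{1-s}\,[m+p/m]_{\Psi(s,t)}\Big|_{t=1/(n+a)}$$ converges to $\zeta(s,a)$ as $m\to\infty$.
   Context: $\zeta(s,a)$ is the Hurwitz zeta function, $\zeta(s,a)=\sum_{k=0}^\infty (k+a)^{-s}$ for $\Re(s)>1$, $\Re(a)>0$, extended by analytic continuation in $s$ to $\mathbb{C}\setminus\{1\}$. Complex powers of numbers with positive real part use the principal branch; an empty sum is $0$. $B_k$ denotes the $k$th Bernoulli number, defined by $\frac{x}{e^x-1}=\sum_{k\ge0}B_k\frac{x^k}{k!}$ (so $B_1=-1/2$). The Pochhammer symbol is $(s)_k=s(s+1)\cdots(s+k-1)$ for $k\ge1$, $(s)_0=1$, and $(s)_{-1}=\frac{1}{s-1}$. For fixed $s$, $\Psi(s,t)$ is identified, for the purpose of forming Padé approximants, with the formal power series in $t$ $$\Psi(s,t)=\sum_{k=0}^\infty \frac{B_k}{k!}(s)_{k-1}(-1)^k t^k .$$ For a formal power series $f(t)=\sum_{i\ge0}c_it^i$ and integers $m_1,m_2\ge 0$, the Padé approximant $[m_1/m_2]_f$ is the rational function $\widetilde Q/\widetilde P$, where $\widetilde Q,\widetilde P$ are polynomials in $t$ with $\deg\widetilde Q\le m_1$, $\deg \widetilde P\le m_2$, $\widetilde P\not\equiv0$,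 and $\widetilde P(t)f(t)-\widetilde Q(t)=O(t^{m_1+m_2+1})$ as $t\to0$ (in the sense of formal power series). Such a pair exists and the rational function is unique. $[m_1/m_2]_{\Psi(s,t)}$ is the Padé approximant in the variable $t$, with $s$ fixed. *)

theory Defs
  imports
    "HOL-Complex_Analysis.Complex_Analysis"
    "HOL-Computational_Algebra.Computational_Algebra"
    "HOL-Computational_Algebra.Field_as_Ring"
begin

text \<open>
  The value at \<open>s \<noteq> 1\<close> of the analytic continuation of the Hurwitz series in \<open>s\<close>.
  By the identity theorem any two continuations agree on the connected set \<open>-{1}\<close>,
  so the described value is unique there; nothing is specified at the pole \<open>s = 1\<close>.
\<close>

definition hurwitz_zeta :: "complex \<Rightarrow> complex \<Rightarrow> complex" where
  "hurwitz_zeta s a =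
     (THE z. \<exists>f. f holomorphic_on (- {1}) \<and>
                 (\<forall>w. Re w > 1 \<longrightarrow> (\<lambda>k. (of_nat k + a) powr (- w)) sums f w) \<and>
                 z = f s)"

text \<open>
  Division here is that of \<^typ>\<open>complex fps\<close>: both series have subdegree 1, so the
  quotient is the genuine power series of \<open>x / (exp x - 1)\<close>.
\<close>

definition bernoulli_number :: "nat \<Rightarrow> complex" where
  "bernoulli_number k = fact k * fps_nth (fps_X / (fps_exp 1 - 1)) k"

definition pochhammer_ext :: "complex \<Rightarrow> int \<Rightarrow> complex" where
  "pochhammer_ext s j = (if j = - 1 then 1 / (s - 1) else pochhammer s (nat j))"

definition Psi_fps :: "complex \<Rightarrow> complex fps" where
  "Psi_fps s =
     Abs_fps (\<lambda>k. bernoulli_number k / fact k * pochhammer_ext s (int k - 1) * (- 1) ^ k)"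

definition is_pade_pair :: "complex fps \<Rightarrow> nat \<Rightarrow> nat \<Rightarrow> complex poly \<Rightarrow> complex poly \<Rightarrow> bool" where
  "is_pade_pair f m1 m2 Q P \<longleftrightarrow>
     degree Q \<le> m1 \<and> degree P \<le> m2 \<and> P \<noteq> 0 \<and>
     (\<forall>i<m1 + m2 + 1. fps_nth (fps_of_poly P * f - fps_of_poly Q) i = 0)"

definition pade_approximant :: "complex fps \<Rightarrow> nat \<Rightarrow> nat \<Rightarrow> complex poly fract" where
  "pade_approximant f m1 m2 = (THE r. \<exists>Q P. is_pade_pair f m1 m2 Q P \<and> r = Fract Q P)"

text \<open>
  Rational functions are evaluated in lowest terms, since a Pade pair may have common
  factors. At a pole, \<open>ratfun_eval\<close> takes the junk value 0.
\<close>

definition ratfun_pole :: "complex poly fract \<Rightarrow> complex \<Rightarrow> bool" where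
  "ratfun_pole r t \<longleftrightarrow> poly (snd (quot_of_fract r)) t = 0"

definition ratfun_eval :: "complex poly fract \<Rightarrow> complex \<Rightarrow> complex" where
  "ratfun_eval r t = poly (fst (quot_of_fract r)) t / poly (snd (quot_of_fract r)) t"

definition RPA :: "complex \<Rightarrow> complex \<Rightarrow> nat \<Rightarrow> nat \<Rightarrow> nat \<Rightarrow> complex" where
  "RPA s a n m1 m2 =
     (\<Sum>k<n. 1 / (of_nat k + a) powr s) +
     (of_nat n + a) powr (1 - s) *
       ratfun_eval (pade_approximant (Psi_fps s) m1 m2) (1 / (of_nat n + a))"

end

theory Submission
  imports Defs "HOL-Probability.Probability"
begin

text \<open>
  Write \<open>t = 1/z\<close> with \<open>Re z > 0\<close>.  Up to its first two terms, \<open>\<Psi>(s,t)\<close> is a Stieltjes series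
  in \<open>t\<^sup>2\<close>.  The reason is the partial fraction expansion
  \[ \frac{1}{e^x-1} = \frac1x - \frac12 + \sum_{j\ge1} \frac{2x}{x^2+(2\pi j)^2}. \]
  Expanded in powers of \<open>x\<close> it shows that the coefficient of \<open>t\<^bsup>2k+2\<^esup>\<close> in \<open>\<Psi>(s,t)\<close> is
  \<open>(-1)\<^sup>k\<close> times the moment \<open>\<integral> y\<^bsup>2k\<^esup> d\<nu>(y)\<close> of a positive measure \<open>\<nu>\<close> on \<open>[0,\<infinity>)\<close>
  (\<open>Psi_fps_coeffs\<close>, \<open>stieltjes_moment\<close>).  Inserted into the Mellin integral of
  \<open>\<Gamma>(s) \<zeta>(s,z)\<close>, it gives the sum of that series,
  \[ z^{s-1}\zeta(s,z) = \frac1{s-1} + \frac t2 + t^2\int\frac{d\nu(y)}{1+t^2y^2} \]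
  (\<open>hurwitz_zeta_shifted\<close>, \<open>hurwitz_branch_stieltjes\<close>), where the value of \<open>\<zeta>\<close> for \<open>0 < s < 1\<close>
  comes from continuing the Mellin integral by subtracting Bernoulli terms.

  Pade approximants of a Stieltjes series are Gauss quadrature sums.  Keeping the terms of
  \<open>\<Psi>\<close> below \<open>t\<^bsup>2J+2\<^esup>\<close> and replacing the integral that represents the rest, which belongs
  to the measure \<open>y\<^bsup>2J\<^esup> d\<nu>\<close>, by its Gauss quadrature with \<open>l\<close> nodes \<open>v = y\<^sup>2\<close> yields a rational
  function; for suitable \<open>J\<close> and \<open>l\<close>, depending on the parities of \<open>m\<close> and \<open>p\<close>, it is
  \<open>[m+p/m]\<close> (\<open>gauss_quadrature\<close>, \<open>pade_approximant_quadrature\<close>).  Its denominator is a product of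
  factors \<open>1 + v t\<^sup>2\<close> with \<open>v \<ge> 0\<close>, so it has no pole at \<open>t = 1/z\<close>.

  It remains to let \<open>l\<close> tend to infinity (\<open>stieltjes_quadrature_convergence\<close>).  Since
  \[ \frac{1}{1+y^2/z^2} = z\int_0^\infty e^{-zu}\cos(uy)\,du , \]
  dominated convergence reduces the claim to the convergence of the quadrature sums of
  \<open>cos(uy)\<close> for each fixed \<open>u \<ge> 0\<close>.  At \<open>u = 0\<close> all derivatives in \<open>u\<close> are moments, which the
  quadrature reproduces.  The moments grow no faster than \<open>(2k)!\<close>, so the Taylor expansion at any
  point has a remainder that vanishes uniformly on a step of fixed length, and convergence of all
  derivatives spreads from \<open>0\<close> to every \<open>u\<close> in finitely many steps.  This elementary
  continuation replaces a theorem on determinate moment problems.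
\<close>

section \<open>Pade pairs and evaluation of rational functions\<close>

lemma poly_eq_0_if_low_coeffs_vanish:
  assumes "degree p < N" and "\<And>i. i < N \<Longrightarrow> coeff p i = 0"
  shows "p = 0"
proof (rule poly_eqI)
  fix i show "coeff p i = coeff 0 i"
  proof (cases "i < N")
    case False
    thus ?thesis using assms(1) by (simp add: coeff_eq_0)
  qed (simp add: assms(2))
qed

lemma fps_nth_mult_eq_0:
  fixes f g :: "'a::comm_ring_1 fps"
  assumes "\<And>i. i < N \<Longrightarrow> fps_nth g i = 0" and "i < N"
  shows "fps_nth (f * g) i = 0"
  unfolding fps_mult_nth using assms by (intro sum.neutral) auto

text \<open>
  The difference of the two cross products is a polynomial of degree at most \<open>m1 + m2\<close>, but as a
  power series it vanishes to order \<open>m1 + m2 + 1\<close>.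
\<close>

lemma pade_pair_unique:
  assumes "is_pade_pair f m1 m2 Q P" and "is_pade_pair f m1 m2 Q' P'"
  shows "Q * P' = Q' * P"
proof -
  let ?N = "m1 + m2 + 1"
  define d where "d = Q * P' - Q' * P"
  define e where "e = fps_of_poly P * f - fps_of_poly Q"
  define e' where "e' = fps_of_poly P' * f - fps_of_poly Q'"
  have e: "fps_nth e i = 0" "fps_nth e' i = 0" if "i < ?N" for i
    using assms that by (simp_all add: is_pade_pair_def e_def e'_def)
  have "fps_of_poly d = fps_of_poly P * e' - fps_of_poly P' * e"
    by (simp add: d_def e_def e'_def fps_of_poly_diff fps_of_poly_mult algebra_simps)
  hence "coeff d i = fps_nth (fps_of_poly P * e' - fps_of_poly P' * e) i" for i
    by (metis fps_of_poly_nth)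
  hence "coeff d i = 0" if "i < ?N" for i
    using that fps_nth_mult_eq_0[of ?N e' i] fps_nth_mult_eq_0[of ?N e i] e by simp
  moreover have "degree d < ?N"
  proof -
    have deg: "degree Q \<le> m1" "degree P \<le> m2" "degree Q' \<le> m1" "degree P' \<le> m2"
      using assms by (simp_all add: is_pade_pair_def)
    have "degree (Q * P') \<le> m1 + m2" "degree (Q' * P) \<le> m1 + m2"
      using degree_mult_le[of Q P'] degree_mult_le[of Q' P] deg by linarith+
    thus ?thesis unfolding d_def
      using degree_diff_le[of "Q * P'" "m1 + m2" "Q' * P"] by simp
  qed
  ultimately have "d = 0"
    by (intro poly_eq_0_if_low_coeffs_vanish[of d ?N]) simp_all
  thus ?thesis by (simp add: d_def)
qed

lemma pade_approximant_eqI: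
  assumes "is_pade_pair f m1 m2 Q P"
  shows "pade_approximant f m1 m2 = Fract Q P"
  unfolding pade_approximant_def
proof (rule the_equality)
  show "\<exists>Q' P'. is_pade_pair f m1 m2 Q' P' \<and> Fract Q P = Fract Q' P'"
    using assms by blast
next
  fix r assume "\<exists>Q' P'. is_pade_pair f m1 m2 Q' P' \<and> r = Fract Q' P'"
  then obtain Q' P' where *: "is_pade_pair f m1 m2 Q' P'" "r = Fract Q' P'" by blast
  show "r = Fract Q P"
    using pade_pair_unique[OF *(1) assms] *(1) assms
    by (simp add: *(2) eq_fract is_pade_pair_def)
qed

text \<open>
  The reduced denominator divides \<open>P\<close>, so a representation whose denominator does not vanish at
  \<open>t\<close>, reduced or not, can be evaluated directly.
\<close>

lemma ratfun_Fract:
  assumes "poly P t \<noteq> 0"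
  shows "\<not> ratfun_pole (Fract Q P) t" and "ratfun_eval (Fract Q P) t = poly Q t / poly P t"
proof -
  have P0: "P \<noteq> 0" using assms by auto
  define q where "q = quot_of_fract (Fract Q P)"
  have q0: "snd q \<noteq> 0" and eq: "Fract (fst q) (snd q) = Fract Q P"
    and cop: "coprime (fst q) (snd q)"
    unfolding q_def by (rule snd_quot_of_fract_nonzero Fract_quot_of_fract coprime_quot_of_fract)+
  have *: "fst q * P = Q * snd q"
    using eq unfolding eq_fract(1)[OF q0 P0] .
  have "snd q dvd fst q * P" unfolding * by (rule dvd_triv_right)
  hence "snd q dvd P" using cop
    by (simp only: coprime_dvd_mult_right_iff coprime_commute[of "snd q"])
  then obtain k where "P = snd q * k" by (rule dvdE)
  hence nz: "poly (snd q) t \<noteq> 0" using assms by auto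
  thus "\<not> ratfun_pole (Fract Q P) t" unfolding ratfun_pole_def q_def .
  have "poly (fst q) t * poly P t = poly Q t * poly (snd q) t"
    using arg_cong[OF *, of "\<lambda>p. poly p t"] by (simp only: poly_mult)
  hence "poly (fst q) t / poly (snd q) t = poly Q t / poly P t"
    by (subst frac_eq_eq[OF nz assms])
  thus "ratfun_eval (Fract Q P) t = poly Q t / poly P t"
    unfolding ratfun_eval_def q_def .
qed

section \<open>Gauss quadrature on the half line\<close>

text \<open>
  The set \<open>A\<close> consists of the nonnegative roots of odd multiplicity, the places where \<open>p\<close> may change
  sign; one linear factor at each of them makes the sign constant.  The induction strips one root
  at a time and toggles its membership in \<open>A\<close>.
\<close>

lemma poly_sign_split:
  fixes p :: "real poly"
  assumes "p \<noteq> 0"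
  shows "\<exists>A \<sigma>. finite A \<and> (\<forall>v\<in>A. v \<ge> 0 \<and> poly p v = 0) \<and> \<sigma> \<in> {1, -1::real} \<and>
            (\<forall>v\<ge>0. \<sigma> * poly p v * (\<Prod>u\<in>A. v - u) \<ge> 0)"
  using assms
proof (induction "degree p" arbitrary: p rule: less_induct)
  case less
  show ?case
  proof (cases "\<exists>v\<ge>0. poly p v = 0")
    case False
    \<comment> \<open>without a root, the intermediate value theorem excludes a change of sign\<close>
    hence "(\<forall>v\<ge>0. poly p v \<ge> 0) \<or> (\<forall>v\<ge>0. poly p v \<le> 0)"
      by (metis (no_types, opaque_lifting) linorder_le_cases nle_le order_trans poly_IVT_neg poly_IVT_pos linorder_not_le)
    thus ?thesis
    proof
      assume "\<forall>v\<ge>0. poly p v \<ge> 0"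
      thus ?thesis by (intro exI[of _ "{}"] exI[of _ 1]) auto
    next
      assume "\<forall>v\<ge>0. poly p v \<le> 0"
      thus ?thesis by (intro exI[of _ "{}"] exI[of _ "-1"]) auto
    qed
  next
    case True
    then obtain c where c: "c \<ge> 0" "poly p c = 0" by blast
    then obtain q where q: "p = [:-c, 1:] * q" by (auto simp: poly_eq_0_iff_dvd elim: dvdE)
    have poly_p: "poly p v = (v - c) * poly q v" for v by (simp add: q algebra_simps)
    have "q \<noteq> 0" using q less.prems by auto
    moreover from this have "degree q < degree p" unfolding q by (subst degree_mult_eq) auto
    ultimately have "\<exists>A \<sigma>. finite A \<and> (\<forall>v\<in>A. v \<ge> 0 \<and> poly q v = 0) \<and> \<sigma> \<in> {1, -1::real} \<and>
            (\<forall>v\<ge>0. \<sigma> * poly q v * (\<Prod>u\<in>A. v - u) \<ge> 0)"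
      by (intro less.hyps)
    then obtain A \<sigma> where A: "finite A" "\<forall>v\<in>A. v \<ge> 0 \<and> poly q v = 0" "\<sigma> \<in> {1, -1::real}"
      "\<forall>v\<ge>0. \<sigma> * poly q v * (\<Prod>u\<in>A. v - u) \<ge> 0"
      by (elim exE conjE) (rule that)
    show ?thesis
    proof (cases "c \<in> A")
      case True
      have "\<sigma> * poly p v * (\<Prod>u\<in>A - {c}. v - u) = \<sigma> * poly q v * (\<Prod>u\<in>A. v - u)" for v
        by (simp add: prod.remove[OF A(1) True] poly_p mult_ac)
      hence "\<forall>v\<ge>0. \<sigma> * poly p v * (\<Prod>u\<in>A - {c}. v - u) \<ge> 0"
        using A(4) by metis
      moreover have "\<forall>v\<in>A - {c}. v \<ge> 0 \<and> poly p v = 0"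
        using A(2) by (simp add: poly_p)
      moreover have "finite (A - {c})" using A(1) by simp
      ultimately show ?thesis using A(3)
        by (intro exI[of _ "A - {c}"] exI[of _ \<sigma>] conjI)
    next
      case False
      have "\<sigma> * poly p v * (\<Prod>u\<in>insert c A. v - u) = (v - c) * (v - c) * (\<sigma> * poly q v * (\<Prod>u\<in>A. v - u))" for v
        by (simp add: prod.insert[OF A(1) False] poly_p mult_ac)
      hence "\<forall>v\<ge>0. \<sigma> * poly p v * (\<Prod>u\<in>insert c A. v - u) \<ge> 0"
        using A(4) by (metis mult_nonneg_nonneg zero_le_square)
      moreover have "\<forall>v\<in>insert c A. v \<ge> 0 \<and> poly p v = 0"
        using A(2) c by (simp add: poly_p)
      moreover have "finite (insert c A)" using A(1) by simp
      ultimately show ?thesis using A(3)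
        by (intro exI[of _ "insert c A"] exI[of _ \<sigma>] conjI)
    qed
  qed
qed

text \<open>
  Integration of polynomials against a measure on \<open>[0,\<infinity>)\<close> with infinite support, abstractly:
  strict positivity is what makes the support infinite.
\<close>

locale positive_functional =
  fixes L :: "real poly \<Rightarrow> real"
  assumes add: "L (p + q) = L p + L q"
    and smult: "L (smult c p) = c * L p"
    and pos: "p \<noteq> 0 \<Longrightarrow> (\<And>v. v \<ge> 0 \<Longrightarrow> poly p v \<ge> 0) \<Longrightarrow> L p > 0"
begin

lemma diff: "L (p - q) = L p - L q"
  using add[of p "smult (-1) q"] smult[of "-1" q] by simp

lemma zero [simp]: "L 0 = 0"
  using smult[of 0 0] by simp

lemma sum: "L (\<Sum>i\<in>I. f i) = (\<Sum>i\<in>I. L (f i))"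
  by (induction I rule: infinite_finite_induct) (auto simp: add)

text \<open>
  The Gram--Schmidt construction: \<open>x\<^sup>n\<close> is corrected by its projections onto the earlier
  orthogonal polynomials, which span all polynomials of degree below \<open>n\<close>.
\<close>

lemma orthogonal_poly_exists:
  "\<exists>p. lead_coeff p = 1 \<and> degree p = n \<and> (\<forall>q. q = 0 \<or> degree q < n \<longrightarrow> L (p * q) = 0)"
proof (induction n rule: less_induct)
  case (less n)
  then obtain \<pi> where \<pi>: "\<And>i. i < n \<Longrightarrow> lead_coeff (\<pi> i) = 1 \<and> degree (\<pi> i) = i \<and>
      (\<forall>q. q = 0 \<or> degree q < i \<longrightarrow> L (\<pi> i * q) = 0)"
    by metis
  have pos_sq: "L (\<pi> i * \<pi> i) > 0" if "i < n" for i
    using \<pi>[OF that] by (intro pos) auto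
  have orth: "L (\<pi> i * \<pi> j) = 0" if "i < n" "j < n" "i \<noteq> j" for i j
    using \<pi>[OF that(1)] \<pi>[OF that(2)] that(3) by (metis mult.commute nat_neq_iff)
  define c where "c i = L (monom 1 n * \<pi> i) / L (\<pi> i * \<pi> i)" for i
  define r where "r = (\<Sum>i<n. smult (c i) (\<pi> i))"
  define p where "p = monom 1 n - r"
  have deg_r: "coeff r k = 0" if "k \<ge> n" for k
    unfolding r_def using \<pi> that by (auto simp: coeff_sum intro!: sum.neutral coeff_eq_0)
  have lc: "coeff p n = 1" by (simp add: p_def deg_r)
  moreover have "degree p \<le> n"
    by (intro degree_le) (auto simp: p_def deg_r)
  ultimately have deg: "degree p = n" by (simp add: le_degree order_antisym)
  have orth_p: "L (p * \<pi> i) = 0" if "i < n" for i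
  proof -
    have "L (r * \<pi> i) = (\<Sum>j<n. c j * L (\<pi> j * \<pi> i))"
      by (simp add: r_def sum_distrib_right sum smult)
    also have "\<dots> = (\<Sum>j<n. if j = i then c i * L (\<pi> i * \<pi> i) else 0)"
      by (intro sum.cong) (auto simp: orth that)
    also have "\<dots> = L (monom 1 n * \<pi> i)"
      using that pos_sq[OF that] by (simp add: c_def)
    finally show ?thesis by (simp add: p_def left_diff_distrib diff)
  qed
  have "L (p * q) = 0" if "q = 0 \<or> degree q < n" for q
    using that
  proof (induction "degree q" arbitrary: q rule: less_induct)
    case (less q)
    show ?case
    proof (cases "q = 0")
      case False
      define k where "k = degree q"
      have k: "k < n" using less.prems False by (simp add: k_def)
      define q' where "q' = q - smult (lead_coeff q) (\<pi> k)"
      have "q' = 0 \<or> degree q' < k"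
      proof (cases "k = 0")
        case True
        then show ?thesis using \<pi>[OF k]
          by (metis (no_types, lifting) degree_0_id diff_self k_def mult.right_neutral q'_def smult_1_left
              coeff_pCons_0 degree_0_id smult_pCons smult_0_right one_pCons)
      next
        case k0: False
        have "coeff q' k = 0" using \<pi>[OF k] by (metis coeff_diff coeff_smult diff_self k_def mult.right_neutral q'_def)
        moreover have "degree q' \<le> k"
          unfolding q'_def using \<pi>[OF k] by (intro degree_diff_le) (auto simp: k_def)
        ultimately show ?thesis using k0
          by (metis le_neq_implies_less leading_coeff_0_iff)
      qed
      hence "L (p * q') = 0"
        using less.hyps[of q'] k by (metis k_def less_trans mult_zero_right zero)
      moreover have "L (p * q') = L (p * q)"
        by (simp add: q'_def right_diff_distrib diff smult orth_p k)
      ultimately show ?thesis by simp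
    qed auto
  qed
  thus ?case using lc deg by blast
qed

text \<open>
  The nodes are the roots of the orthogonal polynomial \<open>p\<close> of degree \<open>n\<close>.  If fewer than \<open>n\<close>
  points of \<open>[0,\<infinity>)\<close> were sign changes of \<open>p\<close>, multiplying \<open>p\<close> by the linear factors at these
  points would give a polynomial of one sign on which the functional vanishes; hence \<open>p\<close> has \<open>n\<close>
  distinct nonnegative roots.  The weights are the values of the functional on the Lagrange basis.
  Division by \<open>p\<close> extends exactness from degree below \<open>n\<close> to degree below \<open>2n\<close>, and exactness for
  the squares of the Lagrange basis shows that the weights are nonnegative.
\<close>

theorem gauss_quadrature:
  "\<exists>A w. finite A \<and> card A = n \<and> (\<forall>v\<in>A. v \<ge> 0 \<and> w v \<ge> 0) \<and>
         (\<forall>q. degree q < 2 * n \<longrightarrow> L q = (\<Sum>v\<in>A. w v * poly q v))"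
proof (cases "n = 0")
  case True
  thus ?thesis by (intro exI[of _ "{}"]) auto
next
  case n: False
  obtain p where p: "lead_coeff p = 1" "degree p = n" "\<And>q. q = 0 \<or> degree q < n \<Longrightarrow> L (p * q) = 0"
    using orthogonal_poly_exists by blast
  have "p \<noteq> 0" using p by auto
  then obtain A \<sigma> where A: "finite A" "\<forall>v\<in>A. v \<ge> 0 \<and> poly p v = 0" "\<sigma> \<in> {1, -1::real}"
      "\<forall>v\<ge>0. \<sigma> * poly p v * (\<Prod>u\<in>A. v - u) \<ge> 0"
    using poly_sign_split[OF \<open>p \<noteq> 0\<close>] by blast
  define r where "r = smult \<sigma> (\<Prod>u\<in>A. [:-u, 1:])"
  have r0: "r \<noteq> 0" using A by (auto simp: r_def)
  have deg_r: "degree r = card A"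
    using A by (auto simp: r_def degree_prod_eq_sum_degree)
  have card_ge: "card A \<ge> n"
  proof (rule ccontr)
    assume "\<not> card A \<ge> n"
    hence "L (p * r) = 0" by (intro p) (simp add: deg_r)
    moreover have "L (p * r) > 0"
      using A(4) r0 \<open>p \<noteq> 0\<close> by (intro pos) (auto simp: r_def poly_prod mult_ac)
    ultimately show False by simp
  qed
  have "card A \<le> card {x. poly p x = 0}"
    using A \<open>p \<noteq> 0\<close> by (intro card_mono poly_roots_finite) auto
  also have "\<dots> \<le> n" using card_poly_roots_bound[OF \<open>p \<noteq> 0\<close>] p(2) by simp
  finally have card: "card A = n" using card_ge by simp
  define lag where "lag v = smult (inverse (\<Prod>u\<in>A-{v}. v - u)) (\<Prod>u\<in>A-{v}. [:-u, 1:])" for v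
  have poly_l: "poly (lag v) u = (if u = v then 1 else 0)" if "v \<in> A" "u \<in> A" for u v
  proof (cases "u = v")
    case True
    have "(\<Prod>u\<in>A-{v}. v - u) \<noteq> 0" using A(1) by auto
    thus ?thesis using True by (simp add: lag_def poly_prod)
  next
    case False
    hence "(\<Prod>x\<in>A-{v}. u - x) = 0" using A(1) that by auto
    thus ?thesis using False by (simp add: lag_def poly_prod)
  qed
  have deg_l: "degree (lag v) \<le> n - 1" if "v \<in> A" for v
  proof -
    have "degree (lag v) \<le> card (A - {v})"
      unfolding lag_def by (rule order_trans[OF degree_smult_le]) (auto simp: degree_prod_eq_sum_degree)
    thus ?thesis using that A(1) card by simp
  qed
  define w where "w v = L (lag v)" for v
  have low: "L q = (\<Sum>v\<in>A. w v * poly q v)" if "degree q < n" for q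
  proof -
    have "q = (\<Sum>v\<in>A. smult (poly q v) (lag v))"
    proof (rule poly_eqI_degree[of A])
      fix x assume "x \<in> A"
      have "poly (\<Sum>v\<in>A. smult (poly q v) (lag v)) x = (\<Sum>v\<in>A. if v = x then poly q v else 0)"
        unfolding poly_sum using poly_l \<open>x \<in> A\<close> by (intro sum.cong) auto
      thus "poly q x = poly (\<Sum>v\<in>A. smult (poly q v) (lag v)) x" using \<open>x \<in> A\<close> A(1) by simp
    next
      have "degree (\<Sum>v\<in>A. smult (poly q v) (lag v)) \<le> n - 1"
        using deg_l A(1) by (intro degree_sum_le) (auto intro: order_trans[OF degree_smult_le])
      thus "degree (\<Sum>v\<in>A. smult (poly q v) (lag v)) < card A" using n card by simp
    qed (use card that in auto)
    hence "L q = L (\<Sum>v\<in>A. smult (poly q v) (lag v))" by simp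
    thus ?thesis by (simp add: sum smult w_def mult.commute)
  qed
  have exact: "L q = (\<Sum>v\<in>A. w v * poly q v)" if "degree q < 2 * n" for q
  proof -
    have dm: "q = p * (q div p) + q mod p" by simp
    have "q div p = 0 \<or> degree (q div p) < n"
    proof (rule disjCI)
      assume nz: "\<not> degree (q div p) < n"
      show "q div p = 0"
      proof (rule ccontr)
        assume "q div p \<noteq> 0"
        hence "degree (p * (q div p)) = n + degree (q div p)"
          using \<open>p \<noteq> 0\<close> p(2) by (simp add: degree_mult_eq)
        moreover have "degree (q mod p) < n"
          using degree_mod_less[OF \<open>p \<noteq> 0\<close>, of q] p(2) n by auto
        ultimately have "degree (p * (q div p) + q mod p) = n + degree (q div p)"
          by (metis degree_add_eq_left trans_less_add1)
        thus False using that nz by simp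
      qed
    qed
    hence "L (p * (q div p)) = 0" by (rule p(3))
    hence "L q = L (q mod p)" by (subst dm) (simp only: add)
    also have "\<dots> = (\<Sum>v\<in>A. w v * poly (q mod p) v)"
      using degree_mod_less[OF \<open>p \<noteq> 0\<close>, of q] p(2) n by (intro low) auto
    also have "\<dots> = (\<Sum>v\<in>A. w v * poly q v)"
    proof (intro sum.cong refl)
      fix v assume "v \<in> A"
      have "poly q v = poly p v * poly (q div p) v + poly (q mod p) v"
        by (subst dm) (simp only: poly_add poly_mult)
      thus "w v * poly (q mod p) v = w v * poly q v" using A(2) \<open>v \<in> A\<close> by simp
    qed
    finally show ?thesis .
  qed
  have "w v \<ge> 0" if "v \<in> A" for v
  proof -
    have l0: "lag v \<noteq> 0" using poly_l[OF that that] by auto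
    have "degree (lag v * lag v) < 2 * n"
      using deg_l[OF that] n degree_mult_le[of "lag v" "lag v"] by linarith
    hence "L (lag v * lag v) = (\<Sum>u\<in>A. w u * poly (lag v * lag v) u)" by (rule exact)
    also have "\<dots> = (\<Sum>u\<in>A. if u = v then w v else 0)"
      using poly_l that by (intro sum.cong) auto
    also have "\<dots> = w v" using that A(1) by simp
    finally show ?thesis using pos[of "lag v * lag v"] l0 by simp
  qed
  hence "\<forall>v\<in>A. v \<ge> 0 \<and> w v \<ge> 0" using A(2) by blast
  thus ?thesis using A(1) card exact by (intro exI[of _ A] exI[of _ w]) simp
qed

end

section \<open>Holomorphic parameter integrals and the Gamma integral\<close>

text \<open>
  A locally uniform integrable bound on \<open>F\<close> also bounds its difference quotients, by Cauchy's
  inequality on a smaller disc, so that dominated convergence allows differentiation under the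
  integral sign.
\<close>

lemma holomorphic_on_integral:
  fixes F :: "complex \<Rightarrow> 'a \<Rightarrow> complex"
  assumes S: "open S"
    and hol: "\<And>x. x \<in> space M \<Longrightarrow> (\<lambda>s. F s x) holomorphic_on S"
    and meas: "\<And>s. s \<in> S \<Longrightarrow> F s \<in> borel_measurable M"
    and dom: "\<And>s. s \<in> S \<Longrightarrow> \<exists>r>0. \<exists>B. cball s r \<subseteq> S \<and> integrable M B \<and>
                 (\<forall>w\<in>cball s r. \<forall>x\<in>space M. norm (F w x) \<le> B x)"
  shows "(\<lambda>s. \<integral>x. F s x \<partial>M) holomorphic_on S"
proof -
  have "(\<lambda>s. \<integral>x. F s x \<partial>M) field_differentiable (at s)" if s: "s \<in> S" for s
  proof -
    obtain r B where r: "r > 0" "cball s r \<subseteq> S" and B: "integrable M B"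
      and bound: "\<And>w x. w \<in> cball s r \<Longrightarrow> x \<in> space M \<Longrightarrow> norm (F w x) \<le> B x"
      using dom[OF s] by blast
    have intF: "integrable M (F w)" if "w \<in> cball s r" for w
      using that r(2) by (intro Bochner_Integration.integrable_bound[OF B] meas AE_I2)
        (auto intro: order_trans[OF bound abs_ge_self])
    define D where "D x = deriv (\<lambda>s. F s x) s" for x
    have lip: "norm (F w x - F s x) \<le> 2 * B x / r * norm (w - s)"
      if w: "w \<in> ball s (r / 2)" and x: "x \<in> space M" for w x
    proof (rule field_differentiable_bound[where f' = "deriv (\<lambda>s. F s x)" and S = "ball s (r / 2)"])
      fix u assume u: "u \<in> ball s (r / 2)"
      have sub: "cball u (r / 2) \<subseteq> cball s r"
      proof
        fix y assume "y \<in> cball u (r / 2)"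
        thus "y \<in> cball s r" using u dist_triangle[of s y u] by (simp add: dist_commute)
      qed
      hence sub': "cball u (r / 2) \<subseteq> S" using r by blast
      have h: "(\<lambda>s. F s x) holomorphic_on S" by (rule hol[OF x])
      have "u \<in> S" using sub' r(1) by auto
      thus "((\<lambda>s. F s x) has_field_derivative deriv (\<lambda>s. F s x) u) (at u within ball s (r / 2))"
        using holomorphic_derivI[OF h S] by blast
      have "norm ((deriv ^^ 1) (\<lambda>s. F s x) u) \<le> fact 1 * B x / (r / 2) ^ 1"
      proof (rule Cauchy_inequality)
        show "(\<lambda>s. F s x) holomorphic_on ball u (r / 2)"
          using h sub' ball_subset_cball by (meson holomorphic_on_subset order_trans)
        show "continuous_on (cball u (r / 2)) (\<lambda>s. F s x)"
          using h sub' by (meson holomorphic_on_imp_continuous_on holomorphic_on_subset)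
        show "norm (F v x) \<le> B x" if "norm (u - v) = r / 2" for v
          using that sub by (intro bound x) (auto simp: dist_norm subset_iff)
      qed (use r in auto)
      thus "norm (deriv (\<lambda>s. F s x) u) \<le> 2 * B x / r"
        by (simp add: mult.commute)
    qed (use w r in auto)
    have Dlim: "((\<lambda>w. (F w x - F s x) / (w - s)) \<longlongrightarrow> D x) (at s)" if "x \<in> space M" for x
      using holomorphic_derivI[OF hol[OF that] S s] by (simp add: D_def has_field_derivative_iff)
    have "((\<lambda>w. ((\<integral>x. F w x \<partial>M) - (\<integral>x. F s x \<partial>M)) / (w - s)) \<longlongrightarrow> (\<integral>x. D x \<partial>M)) (at s)"
      unfolding tendsto_at_iff_sequentially o_def
    proof (intro allI impI)
      fix X :: "nat \<Rightarrow> complex" assume X: "\<forall>i. X i \<in> UNIV - {s}" "X \<longlonglongrightarrow> s"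
      \<comment> \<open>The sequence is modified at finitely many places so that the bound holds at every index.\<close>
      define m where "m i = (if X i \<in> ball s (r / 2) then X i else s + of_real (r / 4))" for i
      have m: "m i \<in> ball s (r / 2)" "m i \<noteq> s" for i
        using r(1) X(1) by (auto simp: m_def dist_norm)
      have ev: "\<forall>\<^sub>F i in sequentially. m i = X i"
        using topological_tendstoD[OF X(2), of "ball s (r / 2)"] r(1)
        by (auto elim!: eventually_mono simp: m_def)
      hence mlim: "m \<longlonglongrightarrow> s" using X(2) by (metis (mono_tags, lifting) eventually_mono tendsto_cong)
      have ms: "filterlim m (at s) sequentially"
        using mlim m by (auto simp: filterlim_at)
      have "(\<lambda>i. \<integral>x. (F (m i) x - F s x) / (m i - s) \<partial>M) \<longlonglongrightarrow> (\<integral>x. D x \<partial>M)"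
      proof (rule integral_dominated_convergence[where w = "\<lambda>x. 2 * B x / r"])
        have mS: "m i \<in> cball s r" for i using m(1)[of i] r(1) by auto
        show meas_i: "(\<lambda>x. (F (m i) x - F s x) / (m i - s)) \<in> borel_measurable M" for i
          using meas[OF s] meas[of "m i"] mS[of i] r(2) by (intro borel_measurable_divide borel_measurable_diff) auto
        show "D \<in> borel_measurable M"
          by (rule borel_measurable_LIMSEQ_metric[where f = "\<lambda>i x. (F (m i) x - F s x) / (m i - s)", OF meas_i])
             (rule filterlim_compose[OF Dlim ms])
        show "AE x in M. (\<lambda>i. (F (m i) x - F s x) / (m i - s)) \<longlonglongrightarrow> D x"
          by (intro AE_I2 filterlim_compose[OF Dlim ms])
        show "AE x in M. norm ((F (m i) x - F s x) / (m i - s)) \<le> 2 * B x / r" for i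
          using lip[OF m(1)[of i]] m(2)[of i]
          by (intro AE_I2) (simp add: norm_divide pos_divide_le_eq)
      qed (use B in auto)
      moreover have "(\<integral>x. (F (m i) x - F s x) / (m i - s) \<partial>M)
                     = ((\<integral>x. F (m i) x \<partial>M) - (\<integral>x. F s x \<partial>M)) / (m i - s)" for i
      proof -
        have "m i \<in> cball s r" "s \<in> cball s r" using m(1)[of i] r(1) by auto
        thus ?thesis by (simp add: intF)
      qed
      ultimately have "(\<lambda>i. ((\<integral>x. F (m i) x \<partial>M) - (\<integral>x. F s x \<partial>M)) / (m i - s)) \<longlonglongrightarrow> (\<integral>x. D x \<partial>M)"
        by (simp only:)
      thus "(\<lambda>i. ((\<integral>x. F (X i) x \<partial>M) - (\<integral>x. F s x \<partial>M)) / (X i - s)) \<longlonglongrightarrow> (\<integral>x. D x \<partial>M)"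
        by (rule Lim_transform_eventually) (use ev in \<open>auto elim: eventually_mono\<close>)
    qed
    thus ?thesis unfolding field_differentiable_def has_field_derivative_iff by blast
  qed
  thus ?thesis by (simp add: holomorphic_on_def field_differentiable_at_within)
qed

lemma right_half_plane_identity:
  assumes "f holomorphic_on {z. Re z > 0}" "g holomorphic_on {z. Re z > 0}"
    and "\<And>x. x > 0 \<Longrightarrow> f (of_real x) = g (of_real x)" and "Re z > 0"
  shows "f z = g z"
proof -
  have "f z - g z = 0"
  proof (rule analytic_continuation[of "\<lambda>z. f z - g z" "{z. Re z > 0}" "of_real ` {0<..}" 1])
    show "(\<lambda>z. f z - g z) holomorphic_on {z. Re z > 0}"
      using assms by (intro holomorphic_intros)
    show "connected {z. Re z > 0}"
      by (intro convex_connected convex_halfspace_Re_gt)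
    show "(1::complex) islimpt of_real ` {0<..}"
      unfolding islimpt_approachable
    proof safe
      fix e :: real assume e: "e > 0"
      have "dist (complex_of_real (1 + e / 2)) (of_real 1) = e / 2"
        unfolding dist_of_real using e by (simp add: dist_real_def)
      moreover have "complex_of_real (1 + e / 2) \<noteq> 1"
        unfolding of_real_eq_1_iff using e by simp
      moreover have "complex_of_real (1 + e / 2) \<in> of_real ` {0<..}" using e by (intro imageI) simp
      ultimately show "\<exists>x'\<in>of_real ` {0<..}. x' \<noteq> (1::complex) \<and> dist x' 1 < e"
        using e by (intro bexI[of _ "complex_of_real (1 + e / 2)"]) simp_all
    qed
  qed (use assms in \<open>auto simp: open_halfspace_Re_gt\<close>)
  thus ?thesis by simp
qed

text \<open>
  A measure space of its own, rather than set integrals over \<open>{0<..}\<close>: integrands need to be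
  controlled only for positive arguments, and the measure can be a factor of a product.
\<close>

definition posline :: "real measure" where
  "posline = restrict_space lborel {0<..}"

lemma space_posline [simp]: "space posline = {0<..}"
  by (simp add: posline_def space_restrict_space)

lemma borel_measurable_posline:
  "f \<in> borel_measurable borel \<Longrightarrow> f \<in> borel_measurable posline"
  unfolding posline_def by (simp add: measurable_restrict_space1)

lemma borel_measurable_posline_continuous:
  "continuous_on {0<..} f \<Longrightarrow> f \<in> borel_measurable posline"
  unfolding posline_def
  by (metis borel_measurable_continuous_on_restrict measurable_cong_sets sets_lborel sets_restrict_space_cong)

lemma integral_posline:
  fixes f :: "real \<Rightarrow> 'a::{banach, second_countable_topology}"
  shows "(\<integral>x. f x \<partial>posline) = (\<integral>x. indicator {0<..} x *\<^sub>R f x \<partial>lborel)"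
  unfolding posline_def by (subst integral_restrict_space) auto

lemma integrable_posline:
  fixes f :: "real \<Rightarrow> 'a::{banach, second_countable_topology}"
  shows "integrable posline f \<longleftrightarrow> integrable lborel (\<lambda>x. indicator {0<..} x *\<^sub>R f x)"
  unfolding posline_def by (subst integrable_restrict_space) auto

lemma integral_posline_scale:
  fixes f :: "real \<Rightarrow> 'a::{banach, second_countable_topology}"
  assumes "c > 0"
  shows "(\<integral>x. f x \<partial>posline) = c *\<^sub>R (\<integral>x. f (c * x) \<partial>posline)"
proof -
  have [simp]: "indicator {0<..} (c * x) = (indicator {0<..} x :: real)" for x
    using assms by (simp add: indicator_def zero_less_mult_iff)
  show ?thesis
    using lborel_integral_real_affine[of c "\<lambda>x. indicator {0<..} x *\<^sub>R f x" 0] assms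
    by (simp add: integral_posline)
qed

lemma sigma_finite_posline: "sigma_finite_measure posline"
proof
  let ?A = "range (\<lambda>n::nat. {0<..real n})"
  have "x \<in> \<Union>?A" if "x > 0" for x using that real_arch_simple[of x] by auto
  moreover have "{0<..real n} \<in> sets posline" for n
    by (auto simp: posline_def sets_restrict_space_iff)
  moreover have "emeasure posline {0<..real n} \<noteq> \<infinity>" for n
    unfolding posline_def by (subst emeasure_restrict_space) auto
  ultimately show "\<exists>A. countable A \<and> A \<subseteq> sets posline \<and> \<Union>A = space posline \<and> (\<forall>a\<in>A. emeasure posline a \<noteq> \<infinity>)"
    by (intro exI[of _ ?A]) auto
qed

lemma borel_measurable_powr_exp [measurable]:
  fixes w z :: complex
  shows "(\<lambda>x. of_real x powr w * exp (- (z * of_real x))) \<in> borel_measurable posline"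
  by (rule borel_measurable_posline_continuous) (auto intro!: continuous_intros)

lemma gamma_integrable_real:
  assumes "c > 0" "a > (0::real)"
  shows "integrable posline (\<lambda>x. x powr (c - 1) * exp (- (a * x)))"
proof -
  have "(\<lambda>t. complex_of_real t powr (of_real c - 1) / of_real (exp (a * t))) absolutely_integrable_on {0<..}"
    using absolutely_integrable_Gamma_integral[of "of_real c" a] assms by simp
  hence "integrable lebesgue (\<lambda>x. indicator {0<..} x *\<^sub>R norm (complex_of_real x powr (of_real c - 1) / of_real (exp (a * x))))"
    unfolding set_integrable_def by (drule_tac integrable_norm) (simp add: indicator_scaleR_eq_if if_distrib cong: if_cong)
  also have "(\<lambda>x. indicator {0<..} x *\<^sub>R norm (complex_of_real x powr (of_real c - 1) / of_real (exp (a * x))))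
      = (\<lambda>x. indicator {0<..} x *\<^sub>R (x powr (c - 1) * exp (- (a * x))))"
    by (rule ext) (auto simp: indicator_def norm_divide norm_powr_real_powr exp_minus field_simps norm_exp_eq_Re)
  finally have "integrable lebesgue (\<lambda>x. indicator {0<..} x *\<^sub>R (x powr (c - 1) * exp (- (a * x))))" .
  thus ?thesis unfolding integrable_posline by (subst (asm) integrable_completion) auto
qed

lemma norm_powr_exp:
  "x > 0 \<Longrightarrow> norm (complex_of_real x powr w * exp (- (z * of_real x))) = x powr Re w * exp (- (Re z * x))"
  by (simp add: norm_mult norm_powr_real_powr)

lemma gamma_laplace_integrable:
  assumes "Re w > 0" "Re z > 0"
  shows "integrable posline (\<lambda>x. of_real x powr (w - 1) * exp (- (z * of_real x)))"
  by (rule Bochner_Integration.integrable_bound[OF gamma_integrable_real[OF assms]])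
     (auto simp: norm_powr_exp)

text \<open>
  For real \<open>z\<close> this is a substitution in Euler's integral.  The general case follows by analytic
  continuation in \<open>z\<close>, which avoids rotating the path of integration.
\<close>

lemma gamma_laplace_integral:
  assumes w: "Re w > 0" and z: "Re z > 0"
  shows "(\<integral>x. of_real x powr (w - 1) * exp (- (z * of_real x)) \<partial>posline) = Gamma w * z powr (- w)"
proof (rule right_half_plane_identity[OF _ _ _ z])
  show "(\<lambda>z. \<integral>x. of_real x powr (w - 1) * exp (- (z * of_real x)) \<partial>posline) holomorphic_on {z. Re z > 0}"
  proof (rule holomorphic_on_integral)
    fix z :: complex assume z: "z \<in> {z. Re z > 0}"
    define r where "r = Re z / 2"
    have r: "r > 0" using z by (simp add: r_def)
    have Re: "Re u \<ge> r" if "u \<in> cball z r" for u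
      using that abs_Re_le_cmod[of "z - u"] by (simp add: dist_norm r_def)
    show "\<exists>r>0. \<exists>B. cball z r \<subseteq> {z. Re z > 0} \<and> integrable posline B \<and>
       (\<forall>u\<in>cball z r. \<forall>x\<in>space posline. norm (of_real x powr (w - 1) * exp (- (u * of_real x))) \<le> B x)"
    proof (intro exI[of _ r] exI[of _ "\<lambda>x. x powr (Re w - 1) * exp (- (r * x))"] conjI ballI)
      show "cball z r \<subseteq> {z. Re z > 0}" using less_le_trans[OF r Re] by blast
      show "integrable posline (\<lambda>x. x powr (Re w - 1) * exp (- (r * x)))"
        using w r by (rule gamma_integrable_real)
      fix u x assume "u \<in> cball z r" "x \<in> space posline"
      hence x: "x > 0" and "r * x \<le> Re u * x" using Re[of u] by (auto intro: mult_right_mono)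
      thus "norm (of_real x powr (w - 1) * exp (- (u * of_real x))) \<le> x powr (Re w - 1) * exp (- (r * x))"
        unfolding norm_powr_exp[OF x] minus_complex.sel one_complex.sel by (intro mult_left_mono) auto
    qed (use r in auto)
  next
    fix x assume "x \<in> space posline"
    show "(\<lambda>z. of_real x powr (w - 1) * exp (- (z * of_real x))) holomorphic_on {z. Re z > 0}"
      by (intro holomorphic_intros)
  qed (rule open_halfspace_Re_gt borel_measurable_powr_exp)+
  show "(\<lambda>z. Gamma w * z powr (- w)) holomorphic_on {z. Re z > 0}"
    by (intro holomorphic_intros) (auto elim!: nonpos_Reals_cases)
next
  fix a :: real assume a: "a > 0"
  have 1: "(\<integral>x. of_real x powr (w - 1) * exp (- of_real x) \<partial>posline) = Gamma w"
  proof -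
    have int: "integrable lborel (\<lambda>x. indicator {0<..} x *\<^sub>R (of_real x powr (w - 1) * exp (- complex_of_real x)))"
      using gamma_laplace_integrable[OF w, of 1] by (simp add: integrable_posline)
    have "((\<lambda>x. of_real x powr (w - 1) * exp (- complex_of_real x)) has_integral
            (\<integral>x. of_real x powr (w - 1) * exp (- of_real x) \<partial>posline)) {0<..}"
      using has_integral_set_lebesgue[of "{0<..}" "\<lambda>x. of_real x powr (w - 1) * exp (- complex_of_real x)"] int
      unfolding set_integrable_def set_lebesgue_integral_def integral_posline
      by (simp add: integrable_completion integral_completion borel_measurable_integrable)
    moreover have "((\<lambda>x. of_real x powr (w - 1) * exp (- complex_of_real x)) has_integral Gamma w) {0<..}"
      using Gamma_integral_complex'[OF w] by (simp add: exp_minus field_simps exp_of_real)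
    ultimately show ?thesis by (rule has_integral_unique)
  qed
  have "Gamma w = of_real a * (\<integral>x. of_real (a * x) powr (w - 1) * exp (- of_real (a * x)) \<partial>posline)"
    unfolding 1[symmetric] by (subst integral_posline_scale[OF a]) (simp add: scaleR_conv_of_real)
  also have "(\<integral>x. of_real (a * x) powr (w - 1) * exp (- complex_of_real (a * x)) \<partial>posline)
     = (\<integral>x. of_real a powr (w - 1) * (of_real x powr (w - 1) * exp (- (of_real a * of_real x))) \<partial>posline)"
    using a by (intro Bochner_Integration.integral_cong) (auto simp: powr_times_real)
  also have "of_real a * \<dots> = of_real a powr w * (\<integral>x. of_real x powr (w - 1) * exp (- (of_real a * of_real x)) \<partial>posline)"
    using a by (subst integral_mult_right_zero) (simp add: powr_diff)
  finally show "(\<integral>x. of_real x powr (w - 1) * exp (- (of_real a * of_real x)) \<partial>posline) = Gamma w * of_real a powr (- w)"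
    using a by (simp add: powr_minus field_simps)
qed

section \<open>Convergence of cosine transforms from convergence of moments\<close>

text \<open>
  The \<open>j\<close>-th derivative of \<open>u \<mapsto> cos (u y)\<close>, in a form that treats even and odd \<open>j\<close> alike.
\<close>

definition cos_deriv :: "nat \<Rightarrow> real \<Rightarrow> real \<Rightarrow> real" where
  "cos_deriv j u y = Re ((\<i> * of_real y) ^ j * iexp (u * y))"

lemma cos_deriv_0 [simp]: "cos_deriv 0 u y = cos (u * y)"
  by (simp add: cos_deriv_def Re_exp)

lemma cos_deriv_at_0: "cos_deriv j 0 y = Re (\<i> ^ j) * y ^ j"
  by (simp add: cos_deriv_def power_mult_distrib flip: of_real_power)

lemma abs_cos_deriv_le: "\<bar>cos_deriv j u y\<bar> \<le> \<bar>y\<bar> ^ j"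
proof -
  have "\<bar>cos_deriv j u y\<bar> \<le> norm ((\<i> * of_real y) ^ j * iexp (u * y))"
    unfolding cos_deriv_def by (rule abs_Re_le_cmod)
  thus ?thesis by (simp add: norm_mult norm_power)
qed

text \<open>
  Taking real parts after multiplying the exponential remainder estimate for \<open>exp (\<i> h y)\<close> by
  \<open>(\<i> y)\<^sup>j exp (\<i> u y)\<close> is harmless because the Taylor weights \<open>h\<^sup>i / i!\<close> are real.
\<close>

lemma cos_deriv_taylor:
  "\<bar>cos_deriv j (u + h) y - (\<Sum>i\<le>n. h ^ i / fact i * cos_deriv (j + i) u y)\<bar>
     \<le> \<bar>h\<bar> ^ Suc n / fact (Suc n) * \<bar>y\<bar> ^ (j + Suc n)"
proof -
  define c where "c = (\<i> * complex_of_real y) ^ j * iexp (u * y)"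
  have 1: "cos_deriv j (u + h) y = Re (c * iexp (h * y))"
    by (simp add: cos_deriv_def c_def distrib_right distrib_left exp_add mult_ac)
  have 2: "h ^ i / fact i * cos_deriv (j + i) u y = Re (c * ((\<i> * of_real (h * y)) ^ i / fact i))" for i
  proof -
    have "c * ((\<i> * of_real (h * y)) ^ i / fact i)
        = of_real (h ^ i / fact i) * ((\<i> * of_real y) ^ (j + i) * iexp (u * y))"
      by (simp add: c_def power_mult_distrib power_add mult_ac)
    moreover have "Re (of_real r * X) = r * Re X" for r X by simp
    ultimately show ?thesis unfolding cos_deriv_def by metis
  qed
  have "cos_deriv j (u + h) y - (\<Sum>i\<le>n. h ^ i / fact i * cos_deriv (j + i) u y)
      = Re (c * (iexp (h * y) - (\<Sum>i\<le>n. (\<i> * of_real (h * y)) ^ i / fact i)))"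
    unfolding 1 2 by (simp only: right_diff_distrib sum_distrib_left minus_complex.sel Re_sum)
  also have "\<bar>\<dots>\<bar> \<le> norm c * norm (iexp (h * y) - (\<Sum>i\<le>n. (\<i> * of_real (h * y)) ^ i / fact i))"
    by (metis abs_Re_le_cmod norm_mult)
  also have "\<dots> \<le> norm c * (\<bar>h * y\<bar> ^ Suc n / fact (Suc n))"
    by (intro mult_left_mono iexp_approx1) auto
  also have "norm c = \<bar>y\<bar> ^ j" by (simp add: c_def norm_mult norm_power)
  finally show ?thesis by (simp add: abs_mult power_mult_distrib power_add mult_ac)
qed

lemma cos_deriv_measurable [measurable]:
  assumes [measurable]: "Y \<in> borel_measurable M"
  shows "(\<lambda>x. cos_deriv j u (Y x)) \<in> borel_measurable M"
  unfolding cos_deriv_def by measurable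

lemma norm_integral_le:
  fixes f :: "'a \<Rightarrow> 'b::{banach, second_countable_topology}" and g :: "'a \<Rightarrow> real"
  assumes "integrable M f" "integrable M g" "\<And>x. x \<in> space M \<Longrightarrow> norm (f x) \<le> g x"
  shows "norm (integral\<^sup>L M f) \<le> integral\<^sup>L M g"
proof -
  have "norm (integral\<^sup>L M f) \<le> (\<integral>x. norm (f x) \<partial>M)"
    by (rule Bochner_Integration.integral_norm_bound)
  also have "\<dots> \<le> integral\<^sup>L M g"
    using assms by (intro integral_mono_AE AE_I2 integrable_norm)
  finally show ?thesis .
qed

locale all_moments =
  fixes M :: "'a measure" and Y :: "'a \<Rightarrow> real"
  assumes Y_measurable [measurable]: "Y \<in> borel_measurable M"
    and integrable_moment: "integrable M (\<lambda>x. \<bar>Y x\<bar> ^ k)"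
begin

lemma integrable_cos_deriv: "integrable M (\<lambda>x. cos_deriv j u (Y x))"
  by (rule Bochner_Integration.integrable_bound[OF integrable_moment[of j]])
     (auto simp: abs_cos_deriv_le)

lemma integral_cos_deriv_taylor:
  "\<bar>(\<integral>x. cos_deriv j (u + h) (Y x) \<partial>M) - (\<Sum>i\<le>n. h ^ i / fact i * (\<integral>x. cos_deriv (j + i) u (Y x) \<partial>M))\<bar>
     \<le> \<bar>h\<bar> ^ Suc n / fact (Suc n) * (\<integral>x. \<bar>Y x\<bar> ^ (j + Suc n) \<partial>M)"
proof -
  have "(\<integral>x. cos_deriv j (u + h) (Y x) \<partial>M) - (\<Sum>i\<le>n. h ^ i / fact i * (\<integral>x. cos_deriv (j + i) u (Y x) \<partial>M))
     = (\<integral>x. cos_deriv j (u + h) (Y x) - (\<Sum>i\<le>n. h ^ i / fact i * cos_deriv (j + i) u (Y x)) \<partial>M)"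
    by (subst Bochner_Integration.integral_diff)
       (auto intro!: integrable_cos_deriv Bochner_Integration.integrable_sum integrable_mult_right
             simp: Bochner_Integration.integral_sum integrable_cos_deriv)
  also have "norm \<dots> \<le> (\<integral>x. \<bar>h\<bar> ^ Suc n / fact (Suc n) * \<bar>Y x\<bar> ^ (j + Suc n) \<partial>M)"
  proof (rule norm_integral_le)
    show "integrable M (\<lambda>x. cos_deriv j (u + h) (Y x) - (\<Sum>i\<le>n. h ^ i / fact i * cos_deriv (j + i) u (Y x)))"
      by (intro Bochner_Integration.integrable_diff integrable_cos_deriv
            Bochner_Integration.integrable_sum integrable_mult_right)
    show "integrable M (\<lambda>x. \<bar>h\<bar> ^ Suc n / fact (Suc n) * \<bar>Y x\<bar> ^ (j + Suc n))"
      by (intro integrable_mult_right integrable_moment)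
  qed (simp only: real_norm_def cos_deriv_taylor)
  also have "\<dots> = \<bar>h\<bar> ^ Suc n / fact (Suc n) * (\<integral>x. \<bar>Y x\<bar> ^ (j + Suc n) \<partial>M)"
    by (rule integral_mult_right_zero)
  finally show ?thesis unfolding real_norm_def .
qed

end

lemma power_le_fact_exp:
  assumes "y \<ge> 0"
  shows "y ^ k \<le> fact k * exp (y::real)"
proof -
  have "(\<Sum>n\<in>{k}. inverse (fact n) * y ^ n) \<le> (\<Sum>n. inverse (fact n) * y ^ n)"
    using assms by (intro sum_le_suminf summable_exp) auto
  hence "inverse (fact k) * y ^ k \<le> exp y" by (simp add: exp_def)
  hence "y ^ k / fact k \<le> exp y" by (simp only: divide_inverse mult.commute)
  thus ?thesis by (simp only: pos_divide_le_eq[OF fact_gt_zero] mult.commute)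
qed

lemma all_moments_exp:
  assumes [measurable]: "Y \<in> borel_measurable M" and "\<And>x. x \<in> space M \<Longrightarrow> Y x \<ge> 0"
    and "integrable M (\<lambda>x. exp (Y x))"
  shows "all_moments M Y"
proof
  fix k show "integrable M (\<lambda>x. \<bar>Y x\<bar> ^ k)"
  proof (rule Bochner_Integration.integrable_bound)
    show "integrable M (\<lambda>x. fact k * exp (Y x))" by (rule integrable_mult_right[OF assms(3)])
    show "AE x in M. norm (\<bar>Y x\<bar> ^ k) \<le> norm (fact k * exp (Y x))"
    proof (rule AE_I2)
      fix x assume x: "x \<in> space M"
      show "norm (\<bar>Y x\<bar> ^ k) \<le> norm (fact k * exp (Y x))"
        unfolding real_norm_def abs_mult power_abs abs_abs
        using power_le_fact_exp[OF assms(2)[OF x], of k] assms(2)[OF x] by simp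
    qed
  qed (intro borel_measurable_power borel_measurable_abs assms(1))
qed (rule assms(1))

text \<open>
  Keeps the Taylor remainder of the \<open>j\<close>-th derivative geometric: the quotient of factorials costs
  only a factor \<open>2\<close> per order of the expansion.
\<close>

lemma fact_quotient_bound: "fact (a + b) / fact b \<le> (2 ^ (a + b) * fact a :: real)"
proof -
  have "fact (a + b) / fact b = real ((a + b) choose a) * fact a"
    by (subst binomial_fact[where ?'a = real]) simp_all
  also have "\<dots> \<le> 2 ^ (a + b) * fact a"
    using binomial_le_pow2[of "a + b" a] of_nat_le_iff[of "(a + b) choose a" "2 ^ (a + b)", where ?'a = real]
    by (intro mult_right_mono) simp_all
  finally show ?thesis .
qed

text \<open>
  Discrete measures \<open>\<Sum>\<^sub>v w\<^sub>l(v) \<delta>\<^sub>v\<close>, each of whose moments is eventually the moment of \<open>Y\<^sup>2\<close> under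
  \<open>M\<close>.  The exponential moment of \<open>Y\<close> is the growth condition under which
  moments determine the limit.
\<close>

locale moment_convergence =
  fixes M :: "'a measure" and Y :: "'a \<Rightarrow> real"
    and A :: "nat \<Rightarrow> real set" and w :: "nat \<Rightarrow> real \<Rightarrow> real"
  assumes Y[measurable]: "Y \<in> borel_measurable M" and Y0: "\<And>x. x \<in> space M \<Longrightarrow> Y x \<ge> 0"
    and expY: "integrable M (\<lambda>x. exp (Y x))"
    and fin: "\<And>l. finite (A l)" and nonneg: "\<And>l v. v \<in> A l \<Longrightarrow> v \<ge> 0 \<and> w l v \<ge> 0"
    and mom: "\<And>k. \<forall>\<^sub>F l in sequentially. (\<Sum>v\<in>A l. w l v * v ^ k) = (\<integral>x. Y x ^ (2 * k) \<partial>M)"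
begin

sublocale M: all_moments M Y
  using Y Y0 expY by (rule all_moments_exp)

text \<open>
  A quadrature sum is the integral against a point measure, so the estimate for general measures
  applies to it.
\<close>

lemma quadrature_cos_deriv_taylor:
  "\<bar>(\<Sum>v\<in>A l. w l v * cos_deriv j (u + h) (sqrt v))
     - (\<Sum>i\<le>n. h ^ i / fact i * (\<Sum>v\<in>A l. w l v * cos_deriv (j + i) u (sqrt v)))\<bar>
   \<le> \<bar>h\<bar> ^ Suc n / fact (Suc n) * (\<Sum>v\<in>A l. w l v * sqrt v ^ (j + Suc n))"
proof -
  have eq: "(\<integral>v. f v \<partial>point_measure (A l) (\<lambda>v. ennreal (w l v))) = (\<Sum>v\<in>A l. w l v * f v)"
    for f :: "real \<Rightarrow> real"
    using lebesgue_integral_point_measure_finite[OF fin, of l "w l" f] nonneg by auto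
  interpret N: all_moments "point_measure (A l) (\<lambda>v. ennreal (w l v))" sqrt
    using nonneg by unfold_locales (auto intro!: integrable_point_measure_finite fin)
  have abs_eq: "(\<Sum>v\<in>A l. w l v * \<bar>sqrt v\<bar> ^ k) = (\<Sum>v\<in>A l. w l v * sqrt v ^ k)" for k
    using nonneg by (intro sum.cong) auto
  show ?thesis using N.integral_cos_deriv_taylor[of j u h n] unfolding eq abs_eq .
qed

lemma moment_bound: "(\<integral>x. Y x ^ k \<partial>M) \<le> fact k * (\<integral>x. exp (Y x) \<partial>M)"
proof -
  have "integrable M (\<lambda>x. Y x ^ k)"
    using M.integrable_moment[of k] by (rule Bochner_Integration.integrable_bound) (auto simp: power_abs)
  hence "(\<integral>x. Y x ^ k \<partial>M) \<le> (\<integral>x. fact k * exp (Y x) \<partial>M)"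
    by (intro integral_mono_AE AE_I2 integrable_mult_right expY power_le_fact_exp Y0)
  thus ?thesis by simp
qed

text \<open>
  The \<open>(j+m)\<close>-th moment is at most a multiple of \<open>(j+m)!\<close>, so the remainder of order \<open>m\<close> is at most a
  multiple of \<open>(2\<bar>h\<bar>)\<^sup>m\<close>.  The admissible step \<open>1/4\<close> does not depend on the point of expansion, which
  is what allows arbitrarily many steps.
\<close>

lemma taylor_remainder_limit:
  assumes "\<bar>h\<bar> \<le> 1 / 4"
  shows "(\<lambda>n. \<bar>h\<bar> ^ Suc n / fact (Suc n) * (\<integral>x. Y x ^ (j + Suc n) \<partial>M)) \<longlonglongrightarrow> 0"
proof (rule tendsto_sandwich[where f = "\<lambda>_. 0"])
  define E where "E = (\<integral>x. exp (Y x) \<partial>M)"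
  have E: "E \<ge> 0" unfolding E_def by (intro integral_nonneg_AE) auto
  have bound: "\<bar>h\<bar> ^ m / fact m * (\<integral>x. Y x ^ (j + m) \<partial>M) \<le> 2 ^ j * fact j * E * (1/2) ^ m" for m
  proof -
    have "\<bar>h\<bar> ^ m / fact m * (\<integral>x. Y x ^ (j + m) \<partial>M) \<le> (1/4) ^ m / fact m * (fact (j + m) * E)"
      using assms moment_bound[of "j + m"] Y0
      by (intro mult_mono divide_right_mono power_mono) (auto simp: E_def intro!: integral_nonneg_AE)
    also have "\<dots> = (1/4) ^ m * E * (fact (j + m) / fact m)" by simp
    also have "\<dots> \<le> (1/4) ^ m * E * (2 ^ (j + m) * fact j)"
      using E by (intro mult_left_mono fact_quotient_bound) auto
    also have "\<dots> = 2 ^ j * fact j * E * ((1/4) ^ m * 2 ^ m)" by (simp add: power_add mult_ac)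
    also have "(1/4) ^ m * 2 ^ m = (1/2 :: real) ^ m" by (simp flip: power_mult_distrib)
    finally show ?thesis .
  qed
  show "\<forall>\<^sub>F n in sequentially. \<bar>h\<bar> ^ Suc n / fact (Suc n) * (\<integral>x. Y x ^ (j + Suc n) \<partial>M)
          \<le> 2 ^ j * fact j * E * (1/2) ^ Suc n"
    by (intro always_eventually allI bound)
  have "(\<lambda>n. 2 ^ j * fact j * E * (1/2) ^ Suc n) \<longlonglongrightarrow> 2 ^ j * fact j * E * 0"
    by (intro tendsto_mult tendsto_const LIMSEQ_power_zero[THEN LIMSEQ_Suc]) auto
  thus "(\<lambda>n. 2 ^ j * fact j * E * (1/2) ^ Suc n) \<longlonglongrightarrow> 0" by simp
  show "\<forall>\<^sub>F n in sequentially. 0 \<le> \<bar>h\<bar> ^ Suc n / fact (Suc n) * (\<integral>x. Y x ^ (j + Suc n) \<partial>M)"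
    by (intro always_eventually allI mult_nonneg_nonneg integral_nonneg_AE AE_I2 zero_le_power Y0
          divide_nonneg_nonneg fact_ge_zero abs_ge_zero)
qed auto

text \<open>
  Both sides are compared with their Taylor polynomials at \<open>u\<close>, which converge by assumption.  The
  remainders of both are bounded by the same moment of \<open>M\<close>, because the order of
  the expansion can be chosen so that an even power of \<open>Y\<close> occurs, and the quadrature eventually reproduces
  even moments.
\<close>

lemma cos_deriv_convergence_step:
  assumes conv: "\<And>j. (\<lambda>l. \<Sum>v\<in>A l. w l v * cos_deriv j u (sqrt v)) \<longlonglongrightarrow> (\<integral>x. cos_deriv j u (Y x) \<partial>M)"
    and h: "\<bar>h\<bar> \<le> 1 / 4"
  shows "(\<lambda>l. \<Sum>v\<in>A l. w l v * cos_deriv j (u + h) (sqrt v)) \<longlonglongrightarrow> (\<integral>x. cos_deriv j (u + h) (Y x) \<partial>M)"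
proof (rule tendstoI)
  fix e :: real assume e: "e > 0"
  have "\<forall>\<^sub>F n in sequentially. \<bar>h\<bar> ^ Suc n / fact (Suc n) * (\<integral>x. Y x ^ (j + Suc n) \<partial>M) < e / 3"
    using e by (intro order_tendstoD(2)[OF taylor_remainder_limit[OF h]]) auto
  then obtain n0 where n0: "\<And>n. n \<ge> n0 \<Longrightarrow> \<bar>h\<bar> ^ Suc n / fact (Suc n) * (\<integral>x. Y x ^ (j + Suc n) \<partial>M) < e / 3"
    by (auto simp: eventually_sequentially)
  \<comment> \<open>This order of expansion is at least \<open>n0\<close> and makes \<open>j + Suc n\<close> even.\<close>
  define n where "n = j + 2 * n0 + 1"
  define q where "q = j + n0 + 1"
  have q: "j + Suc n = 2 * q" by (simp add: n_def q_def)
  define B where "B = \<bar>h\<bar> ^ Suc n / fact (Suc n) * (\<integral>x. Y x ^ (2 * q) \<partial>M)"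
  have B: "B < e / 3" using n0[of n] unfolding q B_def by (simp add: n_def)
  have abs_Y: "(\<integral>x. \<bar>Y x\<bar> ^ (2 * q) \<partial>M) = (\<integral>x. Y x ^ (2 * q) \<partial>M)"
    by (simp add: power_mult)
  have Mb: "\<bar>(\<integral>x. cos_deriv j (u + h) (Y x) \<partial>M) - (\<Sum>i\<le>n. h ^ i / fact i * (\<integral>x. cos_deriv (j + i) u (Y x) \<partial>M))\<bar> \<le> B"
    using M.integral_cos_deriv_taylor[of j u h n] unfolding q abs_Y B_def .
  have "(\<lambda>l. \<Sum>i\<le>n. h ^ i / fact i * (\<Sum>v\<in>A l. w l v * cos_deriv (j + i) u (sqrt v)))
         \<longlonglongrightarrow> (\<Sum>i\<le>n. h ^ i / fact i * (\<integral>x. cos_deriv (j + i) u (Y x) \<partial>M))"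
    by (intro tendsto_sum tendsto_mult tendsto_const conv)
  from tendstoD[OF this, of "e / 3"] e
  have "\<forall>\<^sub>F l in sequentially. dist (\<Sum>i\<le>n. h ^ i / fact i * (\<Sum>v\<in>A l. w l v * cos_deriv (j + i) u (sqrt v)))
         (\<Sum>i\<le>n. h ^ i / fact i * (\<integral>x. cos_deriv (j + i) u (Y x) \<partial>M)) < e / 3" by simp
  with mom[of q] show "\<forall>\<^sub>F l in sequentially. dist (\<Sum>v\<in>A l. w l v * cos_deriv j (u + h) (sqrt v))
      (\<integral>x. cos_deriv j (u + h) (Y x) \<partial>M) < e"
  proof eventually_elim
    case (elim l)
    have "(\<Sum>v\<in>A l. w l v * sqrt v ^ (2 * q)) = (\<Sum>v\<in>A l. w l v * v ^ q)"
      using nonneg by (intro sum.cong) (auto simp: power_mult)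
    hence "\<bar>(\<Sum>v\<in>A l. w l v * cos_deriv j (u + h) (sqrt v))
     - (\<Sum>i\<le>n. h ^ i / fact i * (\<Sum>v\<in>A l. w l v * cos_deriv (j + i) u (sqrt v)))\<bar> \<le> B"
      using quadrature_cos_deriv_taylor[where l = l and j = j and u = u and h = h and n = n] elim(1)
      unfolding q B_def by simp
    thus ?case using elim(2) Mb B unfolding dist_real_def by linarith
  qed
qed

lemma cos_deriv_convergence_0:
  "(\<lambda>l. \<Sum>v\<in>A l. w l v * cos_deriv j 0 (sqrt v)) \<longlonglongrightarrow> (\<integral>x. cos_deriv j 0 (Y x) \<partial>M)"
proof (cases "even j")
  case False
  then obtain k where "j = 2 * k + 1" by (rule oddE)
  hence "Re (\<i> ^ j) = 0" by (simp add: power_mult)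
  thus ?thesis by (simp add: cos_deriv_at_0)
next
  case True
  then obtain k where k: "j = 2 * k" by (rule evenE)
  have "\<forall>\<^sub>F l in sequentially. (\<integral>x. cos_deriv j 0 (Y x) \<partial>M) = (\<Sum>v\<in>A l. w l v * cos_deriv j 0 (sqrt v))"
    using mom[of k]
  proof eventually_elim
    case (elim l)
    have "(\<Sum>v\<in>A l. w l v * cos_deriv j 0 (sqrt v)) = (\<Sum>v\<in>A l. Re (\<i> ^ j) * (w l v * v ^ k))"
      using nonneg by (intro sum.cong) (auto simp: cos_deriv_at_0 k power_mult)
    thus ?case using elim by (simp add: cos_deriv_at_0 k flip: sum_distrib_left)
  qed
  thus ?thesis by (rule Lim_transform_eventually[OF tendsto_const])
qed

lemma cos_transform_convergence:
  assumes "u \<ge> 0"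
  shows "(\<lambda>l. \<Sum>v\<in>A l. w l v * cos (u * sqrt v)) \<longlonglongrightarrow> (\<integral>x. cos (u * Y x) \<partial>M)"
proof -
  obtain N :: nat where N: "real N \<ge> 4 * u + 1" using real_arch_simple by blast
  define h where "h = u / N"
  have "\<bar>h\<bar> \<le> 1 / 4" using N assms by (simp add: h_def field_simps)
  hence "(\<lambda>l. \<Sum>v\<in>A l. w l v * cos_deriv j (real n * h) (sqrt v)) \<longlonglongrightarrow> (\<integral>x. cos_deriv j (real n * h) (Y x) \<partial>M)" for n j
  proof (induction n arbitrary: j)
    case 0 show ?case using cos_deriv_convergence_0 by simp
  next
    case (Suc n)
    show ?case using cos_deriv_convergence_step[OF Suc.IH[OF Suc.prems] Suc.prems]
      by (simp add: algebra_simps)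
  qed
  from this[of 0 N] show ?thesis using N assms by (simp add: h_def)
qed

end

section \<open>Convergence of Stieltjes transforms\<close>

lemma laplace_exp:
  assumes "Re z > 0"
  shows "integrable posline (\<lambda>u. exp (- (z * of_real u)))"
    and "(\<integral>u. exp (- (z * of_real u)) \<partial>posline) = 1 / z"
proof -
  have eq: "of_real u powr (1 - 1) * exp (- (z * of_real u)) = exp (- (z * of_real u))"
    if "u \<in> space posline" for u
    using that by simp
  show "integrable posline (\<lambda>u. exp (- (z * of_real u)))"
    using gamma_laplace_integrable[of 1 z] assms
    by (subst Bochner_Integration.integrable_cong[OF refl eq[symmetric]]) auto
  show "(\<integral>u. exp (- (z * of_real u)) \<partial>posline) = 1 / z"
    using gamma_laplace_integral[of 1 z] assms
    by (subst Bochner_Integration.integral_cong[OF refl eq[symmetric]]) (auto simp: powr_minus field_simps)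
qed

lemma square_plus_square_nonzero:
  assumes "Re z > 0" shows "z\<^sup>2 + (of_real y)\<^sup>2 \<noteq> 0"
proof
  assume "z\<^sup>2 + (of_real y)\<^sup>2 = 0"
  moreover have "z\<^sup>2 + (of_real y)\<^sup>2 = (z - \<i> * of_real y) * (z + \<i> * of_real y)"
    by (simp add: power2_eq_square algebra_simps)
  ultimately have "z = \<i> * of_real y \<or> z = - (\<i> * of_real y)"
    by (auto simp: eq_neg_iff_add_eq_0)
  thus False using assms by auto
qed

lemma laplace_cos:
  assumes z: "Re z > 0"
  shows "integrable posline (\<lambda>u. exp (- (z * of_real u)) * of_real (cos (u * y)))"
    and "z * (\<integral>u. exp (- (z * of_real u)) * of_real (cos (u * y)) \<partial>posline) = 1 / (1 + of_real (y\<^sup>2) / z\<^sup>2)"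
proof -
  let ?a = "z - \<i> * of_real y" and ?b = "z + \<i> * of_real y"
  have Re: "Re ?a > 0" "Re ?b > 0" using z by auto
  have eq: "exp (- (z * of_real u)) * of_real (cos (u * y))
      = (exp (- (?a * of_real u)) + exp (- (?b * of_real u))) / 2" for u
    unfolding cos_of_real[symmetric] cos_exp_eq
    by (simp add: algebra_simps add_divide_distrib flip: exp_add)
  show "integrable posline (\<lambda>u. exp (- (z * of_real u)) * of_real (cos (u * y)))"
    unfolding eq using laplace_exp(1)[OF Re(1)] laplace_exp(1)[OF Re(2)] by simp
  have "(\<integral>u. exp (- (z * of_real u)) * of_real (cos (u * y)) \<partial>posline) = (1 / ?a + 1 / ?b) / 2"
    unfolding eq using laplace_exp[OF Re(1)] laplace_exp[OF Re(2)] by simp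
  also have "\<dots> = z / (z\<^sup>2 + (of_real y)\<^sup>2)"
  proof -
    have "?a \<noteq> 0" "?b \<noteq> 0" using Re by (metis less_irrefl zero_complex.sel(1))+
    moreover have "?a * ?b = z\<^sup>2 + (of_real y)\<^sup>2" by (simp add: power2_eq_square algebra_simps)
    ultimately have "1 / ?a + 1 / ?b = 2 * z / (z\<^sup>2 + (of_real y)\<^sup>2)"
      by (simp add: add_frac_eq)
    moreover have "(2 * z / S) / 2 = z / S" for S by simp
    ultimately show ?thesis by metis
  qed
  finally have *: "(\<integral>u. exp (- (z * of_real u)) * of_real (cos (u * y)) \<partial>posline) = z / (z\<^sup>2 + (of_real y)\<^sup>2)" .
  have "z \<noteq> 0" using z by auto
  thus "z * (\<integral>u. exp (- (z * of_real u)) * of_real (cos (u * y)) \<partial>posline) = 1 / (1 + of_real (y\<^sup>2) / z\<^sup>2)"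
    unfolding * using square_plus_square_nonzero[OF z, of y]
    by (simp add: field_simps power2_eq_square)
qed

context moment_convergence
begin

lemma finite_measure_M: "finite_measure M"
proof
  have "integrable M (\<lambda>x. 1 :: real)"
    by (rule Bochner_Integration.integrable_bound[OF expY]) (use Y0 in auto)
  hence "integrable M (indicator (space M) :: 'a \<Rightarrow> real)"
    by (subst Bochner_Integration.integrable_cong[OF refl, of _ _ "\<lambda>_. 1"]) auto
  thus "emeasure M (space M) \<noteq> \<infinity>" by (simp add: integrable_indicator_iff)
qed

text \<open>
  The Stieltjes kernel is the Laplace transform of the cosine, so the Stieltjes transform of a
  measure is the Laplace transform of its cosine transform.
\<close>

lemma stieltjes_laplace:
  assumes z: "Re z > 0"
  shows "z * (\<integral>u. exp (- (z * of_real u)) * of_real (\<integral>x. cos (u * Y x) \<partial>M) \<partial>posline)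
           = (\<integral>x. 1 / (1 + of_real ((Y x)\<^sup>2) / z\<^sup>2) \<partial>M)"
proof -
  interpret M: finite_measure M by (rule finite_measure_M)
  interpret L: sigma_finite_measure posline by (rule sigma_finite_posline)
  interpret P: pair_sigma_finite M posline by unfold_locales
  have ident [measurable]: "(\<lambda>u. u) \<in> borel_measurable posline"
    by (intro borel_measurable_posline) simp
  have [measurable]: "snd \<in> borel_measurable (M \<Otimes>\<^sub>M posline)"
    using measurable_compose[OF measurable_snd ident] by simp
  let ?f = "\<lambda>(x, u). exp (- (z * of_real u)) * complex_of_real (cos (u * Y x))"
  have int: "integrable (M \<Otimes>\<^sub>M posline) ?f"
  proof (rule Bochner_Integration.integrable_bound)
    have e: "integrable posline (\<lambda>u. exp (- (Re z * u)))"
      using integrable_norm[OF laplace_exp(1)[OF z]] by (simp add: mult.commute)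
    show "integrable (M \<Otimes>\<^sub>M posline) (\<lambda>p. exp (- (Re z * snd p)))"
      by (rule P.Fubini_integrable) (use e in auto)
    show "?f \<in> borel_measurable (M \<Otimes>\<^sub>M posline)" by (simp add: case_prod_unfold)
    show "AE p in M \<Otimes>\<^sub>M posline. norm (?f p) \<le> norm (exp (- (Re z * snd p)))"
      by (intro AE_I2) (auto simp: norm_mult intro!: mult_left_le)
  qed
  have "(\<integral>u. exp (- (z * of_real u)) * of_real (\<integral>x. cos (u * Y x) \<partial>M) \<partial>posline)
      = (\<integral>u. (\<integral>x. exp (- (z * of_real u)) * complex_of_real (cos (u * Y x)) \<partial>M) \<partial>posline)"
    by simp
  also have "\<dots> = (\<integral>x. (\<integral>u. exp (- (z * of_real u)) * complex_of_real (cos (u * Y x)) \<partial>posline) \<partial>M)"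
    by (rule P.Fubini_integral[OF int])
  finally have "z * (\<integral>u. exp (- (z * of_real u)) * of_real (\<integral>x. cos (u * Y x) \<partial>M) \<partial>posline)
     = (\<integral>x. z * (\<integral>u. exp (- (z * of_real u)) * complex_of_real (cos (u * Y x)) \<partial>posline) \<partial>M)"
    by (simp only: integral_mult_right_zero)
  thus ?thesis by (simp only: laplace_cos(2)[OF z])
qed

text \<open>
  The cosine transforms converge pointwise and are bounded by the total mass, and \<open>exp (- z u)\<close> is
  integrable because \<open>Re z > 0\<close>; dominated convergence does the rest.
\<close>

theorem stieltjes_quadrature_convergence:
  assumes z: "Re z > 0"
  shows "(\<lambda>l. \<Sum>v\<in>A l. of_real (w l v) / (1 + of_real v / z\<^sup>2))
           \<longlonglongrightarrow> (\<integral>x. 1 / (1 + of_real ((Y x)\<^sup>2) / z\<^sup>2) \<partial>M)"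
proof -
  define \<Phi> where "\<Phi> l u = (\<Sum>v\<in>A l. w l v * cos (u * sqrt v))" for l u
  define \<phi> where "\<phi> u = (\<integral>x. cos (u * Y x) \<partial>M)" for u
  define m0 where "m0 = (\<integral>x. Y x ^ (2 * 0) \<partial>M)"
  \<comment> \<open>Only from some \<open>l0\<close> on is the total mass of the quadrature that of \<open>M\<close>.\<close>
  obtain l0 where l0: "\<And>l. l \<ge> l0 \<Longrightarrow> (\<Sum>v\<in>A l. w l v) = m0"
    using mom[of 0] by (auto simp: eventually_sequentially m0_def)
  have lim: "(\<lambda>l. \<Phi> l u) \<longlonglongrightarrow> \<phi> u" if "u > 0" for u
    unfolding \<Phi>_def \<phi>_def
    by (rule cos_transform_convergence) (use that in auto)
  have bound: "\<bar>\<Phi> l u\<bar> \<le> m0" if "l \<ge> l0" for l u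
  proof -
    have "\<bar>\<Phi> l u\<bar> \<le> (\<Sum>v\<in>A l. \<bar>w l v * cos (u * sqrt v)\<bar>)" unfolding \<Phi>_def by (rule sum_abs)
    also have "\<dots> \<le> (\<Sum>v\<in>A l. w l v)"
      using nonneg by (intro sum_mono) (auto simp: abs_mult intro!: mult_left_le)
    finally show ?thesis using l0[OF that] by simp
  qed
  have sum_eq: "(\<Sum>v\<in>A l. of_real (w l v) / (1 + of_real v / z\<^sup>2))
      = z * (\<integral>u. exp (- (z * of_real u)) * of_real (\<Phi> l u) \<partial>posline)" for l
  proof -
    have "(\<integral>u. exp (- (z * of_real u)) * of_real (\<Phi> l u) \<partial>posline)
        = (\<integral>u. (\<Sum>v\<in>A l. of_real (w l v) * (exp (- (z * of_real u)) * of_real (cos (u * sqrt v)))) \<partial>posline)"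
      by (simp add: \<Phi>_def sum_distrib_left mult_ac)
    also have "\<dots> = (\<Sum>v\<in>A l. of_real (w l v) * (\<integral>u. exp (- (z * of_real u)) * of_real (cos (u * sqrt v)) \<partial>posline))"
      by (subst Bochner_Integration.integral_sum) (auto intro!: integrable_mult_right laplace_cos(1)[OF z])
    also have "z * \<dots> = (\<Sum>v\<in>A l. of_real (w l v) * (1 / (1 + of_real ((sqrt v)\<^sup>2) / z\<^sup>2)))"
      unfolding sum_distrib_left laplace_cos(2)[OF z, symmetric] by (simp only: mult.left_commute)
    also have "\<dots> = (\<Sum>v\<in>A l. of_real (w l v) / (1 + of_real v / z\<^sup>2))"
      using nonneg by (intro sum.cong) auto
    finally show ?thesis by simp
  qed
  have meas: "(\<lambda>u. exp (- (z * of_real u)) * complex_of_real (\<Phi> l u)) \<in> borel_measurable posline" for l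
    unfolding \<Phi>_def by (rule borel_measurable_posline_continuous) (intro continuous_intros)
  have lim': "(\<lambda>l. exp (- (z * of_real u)) * complex_of_real (\<Phi> (l + l0) u)) \<longlonglongrightarrow>
          exp (- (z * of_real u)) * complex_of_real (\<phi> u)" if "u \<in> space posline" for u
    using that by (intro tendsto_mult tendsto_const tendsto_of_real LIMSEQ_ignore_initial_segment lim) simp
  have "(\<lambda>l. \<integral>u. exp (- (z * of_real u)) * of_real (\<Phi> (l + l0) u) \<partial>posline)
          \<longlonglongrightarrow> (\<integral>u. exp (- (z * of_real u)) * of_real (\<phi> u) \<partial>posline)"
  proof (rule integral_dominated_convergence[where w = "\<lambda>u. m0 * norm (exp (- (z * of_real u)))"])
    show "(\<lambda>u. exp (- (z * of_real u)) * complex_of_real (\<phi> u)) \<in> borel_measurable posline"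
      by (rule borel_measurable_LIMSEQ_metric[OF meas lim'])
    show "integrable posline (\<lambda>u. m0 * norm (exp (- (z * of_real u))))"
      by (intro integrable_mult_right integrable_norm laplace_exp(1)[OF z])
    show "AE u in posline. norm (exp (- (z * of_real u)) * complex_of_real (\<Phi> (l + l0) u))
            \<le> m0 * norm (exp (- (z * of_real u)))" for l
      using bound[of "l + l0"] by (intro AE_I2) (simp add: norm_mult mult.commute mult_left_mono)
  qed (use meas lim' in auto)
  hence "(\<lambda>l. z * (\<integral>u. exp (- (z * of_real u)) * of_real (\<Phi> (l + l0) u) \<partial>posline))
          \<longlonglongrightarrow> z * (\<integral>u. exp (- (z * of_real u)) * of_real (\<phi> u) \<partial>posline)"
    by (rule tendsto_mult_left)
  thus ?thesis
    unfolding \<phi>_def stieltjes_laplace[OF z] sum_eq[symmetric] by (rule LIMSEQ_offset)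
qed

end

section \<open>Partial fractions and Bernoulli numbers\<close>

text \<open>
  The positive multiples of \<open>2\<pi>\<close>: the poles of \<open>1 / (exp x - 1)\<close> are \<open>0\<close> and \<open>\<plusminus>\<i> period j\<close>.
\<close>

definition period :: "nat \<Rightarrow> real" where
  "period j = 2 * pi * real (Suc j)"

lemma period_ge: "period j \<ge> 1" "period j > 0"
proof -
  have "1 * 1 \<le> (2 * pi) * real (Suc j)"
    using pi_gt3 by (intro mult_mono) auto
  thus "period j \<ge> 1" "period j > 0" by (auto simp: period_def)
qed

lemma period_ge_2: "period j \<ge> 2"
proof -
  have "2 * 1 \<le> (2 * pi) * real (Suc j)" using pi_gt3 by (intro mult_mono) auto
  thus ?thesis by (simp add: period_def)
qed

text \<open>
  Logarithmic differentiation of Euler's reflection formula expresses the cotangent by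
  \<open>Digamma (1 - z) - Digamma z\<close>, and the limit formula for the digamma function turns this into
  a series.
\<close>

lemma cot_partial_fractions:
  fixes z :: complex
  assumes "z \<notin> \<int>"
  shows "(\<lambda>n. 2 * z / (z\<^sup>2 - (of_nat (Suc n))\<^sup>2)) sums
           (of_real pi * cos (of_real pi * z) / sin (of_real pi * z) - 1 / z)"
proof -
  have nz: "z \<noteq> 0" "1 - z \<noteq> 0" and nzn: "z + of_nat n \<noteq> 0" "1 - z + of_nat n \<noteq> 0" for n
  proof -
    show "z \<noteq> 0" using assms by auto
    show "1 - z \<noteq> 0" using assms by auto
    show "z + of_nat n \<noteq> 0"
      using assms by (metis Ints_minus Ints_of_nat add_eq_0_iff2)
    show "1 - z + of_nat n \<noteq> 0"
    proof
      assume "1 - z + of_nat n = 0"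
      hence "z = of_nat (Suc n)" by (simp add: algebra_simps)
      thus False using assms by simp
    qed
  qed
  have D1: "((\<lambda>z. rGamma z * rGamma (1 - z)) has_field_derivative
          - rGamma z * Digamma z * rGamma (1 - z) + rGamma z * (rGamma (1 - z) * Digamma (1 - z))) (at z)"
  proof -
    have "z \<notin> \<int>\<^sub>\<le>\<^sub>0" using assms nonpos_Ints_Int by blast
    moreover have "1 - z \<notin> \<int>\<^sub>\<le>\<^sub>0"
    proof
      assume "1 - z \<in> \<int>\<^sub>\<le>\<^sub>0"
      hence "1 - (1 - z) \<in> \<int>" using nonpos_Ints_Int by (intro Ints_diff) auto
      thus False using assms by simp
    qed
    ultimately show ?thesis
      by (auto intro!: derivative_eq_intros simp: algebra_simps)
  qed
  have D2: "((\<lambda>z. rGamma z * rGamma (1 - z)) has_field_derivative cos (of_real pi * z)) (at z)"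
    unfolding rGamma_reflection_complex by (auto intro!: derivative_eq_intros)
  have "(Digamma (1 - z) - Digamma z) * (rGamma z * rGamma (1 - z)) = cos (of_real pi * z)"
    using DERIV_unique[OF D1 D2] by (simp add: algebra_simps)
  moreover have sin: "sin (of_real pi * z) \<noteq> 0"
  proof
    assume "sin (of_real pi * z) = 0"
    then obtain n :: int where "of_real pi * z = of_real (of_int n * pi)"
      unfolding sin_eq_0 by blast
    hence "of_real pi * z = of_real pi * of_int n" by simp
    hence "z = of_int n" by simp
    thus False using assms by simp
  qed
  ultimately have 1: "Digamma (1 - z) - Digamma z = of_real pi * cos (of_real pi * z) / sin (of_real pi * z)"
    unfolding rGamma_reflection_complex
    by (metis divide_divide_eq_right mult.commute nonzero_mult_div_cancel_right of_real_eq_0_iff pi_neq_zero divide_eq_0_iff)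
  \<comment> \<open>The logarithms cancel in the difference.  Shifting the first sum by one index pairs its terms into the partial fractions.\<close>
  have "(\<lambda>m. (of_real (ln (real m)) - (\<Sum>n<m. inverse (1 - z + of_nat n)))
           - (of_real (ln (real m)) - (\<Sum>n<m. inverse (z + of_nat n)))) \<longlonglongrightarrow> Digamma (1 - z) - Digamma z"
    by (intro tendsto_diff Digamma_LIMSEQ nz)
  hence "(\<lambda>m. (\<Sum>n<m. inverse (z + of_nat n)) - (\<Sum>n<m. inverse (1 - z + of_nat n)))
          \<longlonglongrightarrow> Digamma (1 - z) - Digamma z" by simp
  from this have "(\<lambda>m. (\<Sum>n<m. inverse (z + of_nat n)) - (\<Sum>n<m. inverse (1 - z + of_nat n)) + inverse (z + of_nat m) - 1 / z)
          \<longlonglongrightarrow> Digamma (1 - z) - Digamma z + 0 - 1 / z"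
  proof (intro tendsto_diff[OF tendsto_add] tendsto_const)
    show "(\<lambda>m. inverse (z + of_nat m)) \<longlonglongrightarrow> 0"
      by (rule filterlim_compose[OF tendsto_inverse_0 tendsto_add_filterlim_at_infinity[OF tendsto_const tendsto_of_nat]])
  qed
  moreover have "((\<Sum>n<m. inverse (z + of_nat n)) - (\<Sum>n<m. inverse (1 - z + of_nat n)))
            + inverse (z + of_nat m) - 1 / z = (\<Sum>n<m. 2 * z / (z\<^sup>2 - (of_nat (Suc n))\<^sup>2))" for m
  proof (induction m)
    case (Suc m)
    have "inverse (z + of_nat (Suc m)) - inverse (1 - z + of_nat m) = 2 * z / (z\<^sup>2 - (of_nat (Suc m))\<^sup>2)"
    proof -
      have "z\<^sup>2 - (of_nat (Suc m))\<^sup>2 = - ((z + of_nat (Suc m)) * (1 - z + of_nat m))"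
        by (simp add: power2_eq_square algebra_simps)
      moreover have "inverse a - inverse b = (b - a) / (a * b)" if "a \<noteq> 0" "b \<noteq> 0" for a b :: complex
        using that by (simp add: field_simps)
      from this[OF nzn(1)[of "Suc m"] nzn(2)[of m]]
      have "inverse (z + of_nat (Suc m)) - inverse (1 - z + of_nat m)
              = - (2 * z) / ((z + of_nat (Suc m)) * (1 - z + of_nat m))" by simp
      ultimately show ?thesis by (simp only: minus_divide_left[symmetric] minus_divide_right[symmetric])
    qed
    thus ?case using Suc by (simp add: algebra_simps)
  qed (simp add: inverse_eq_divide)
  ultimately show ?thesis by (simp add: sums_def 1)
qed

lemma exp_partial_fractions:
  fixes x :: complex
  assumes "exp x \<noteq> 1"
  shows "(\<lambda>j. 2 * x\<^sup>2 / (x\<^sup>2 + (of_real (period j))\<^sup>2)) sums (x / (exp x - 1) - 1 + x / 2)"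
proof -
  define z where "z = x / (2 * of_real pi * \<i>)"
  have x: "x = 2 * of_real pi * \<i> * z" by (simp add: z_def)
  have "x \<noteq> 0" using assms by auto
  hence "z \<noteq> 0" by (simp add: z_def)
  have "z \<notin> \<int>"
  proof
    assume "z \<in> \<int>"
    then obtain k where "z = of_int k" by (auto elim: Ints_cases)
    hence "exp x = 1" unfolding x exp_eq_1 by (auto intro!: exI[of _ k] simp: mult_ac)
    thus False using assms by simp
  qed
  from sums_mult[OF cot_partial_fractions[OF this], of z]
  have *: "(\<lambda>n. z * (2 * z / (z\<^sup>2 - (of_nat (Suc n))\<^sup>2))) sums
          (z * (of_real pi * cos (of_real pi * z) / sin (of_real pi * z) - 1 / z))" .
  have cot: "z * (of_real pi * cos (of_real pi * z) / sin (of_real pi * z) - 1 / z) = x / (exp x - 1) - 1 + x / 2"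
  proof -
    define e where "e = exp (x / 2)"
    have ipz: "\<i> * (of_real pi * z) = x / 2" by (simp add: x)
    have e0: "e \<noteq> 0" by (simp add: e_def)
    have ex: "exp x = e * e" by (simp add: e_def flip: exp_add)
    have "e * e \<noteq> 1" using assms ex by simp
    hence ee: "e - inverse e \<noteq> 0" using e0 by (simp add: field_simps)
    have "cos (of_real pi * z) = (e + inverse e) / 2"
      unfolding cos_exp_eq ipz e_def by (simp add: exp_minus)
    moreover have "sin (of_real pi * z) = (e - inverse e) / (2 * \<i>)"
      unfolding sin_exp_eq ipz e_def by (simp add: exp_minus)
    moreover have "p * (a / 2) / (d / (2 * \<i>)) = p * \<i> * (a / d)" for p a d :: complex
      by (cases "d = 0") (simp_all add: field_simps)
    ultimately have "of_real pi * cos (of_real pi * z) / sin (of_real pi * z) = of_real pi * \<i> * ((e + inverse e) / (e - inverse e))"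
      by (simp only:)
    also have "(e + inverse e) / (e - inverse e) = (e * (e + inverse e)) / (e * (e - inverse e))"
      using e0 by simp
    also have "\<dots> = (exp x + 1) / (exp x - 1)"
      using e0 by (simp add: ex distrib_left right_diff_distrib)
    also have "\<dots> = 1 + 2 / (exp x - 1)"
    proof -
      have "exp x + 1 = (exp x - 1) + 2" by simp
      thus ?thesis using assms by (simp only: add_divide_distrib) simp
    qed
    finally have K: "of_real pi * cos (of_real pi * z) / sin (of_real pi * z) = of_real pi * \<i> * (1 + 2 / (exp x - 1))" .
    have "z * (of_real pi * \<i> * K - 1 / z) = x / 2 * K - 1" for K
      using \<open>z \<noteq> 0\<close> unfolding ipz[symmetric] by (simp add: right_diff_distrib mult_ac)
    from this[of "1 + 2 / (exp x - 1)"]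
    have "z * (of_real pi * cos (of_real pi * z) / sin (of_real pi * z) - 1 / z) = x / 2 * (1 + 2 / (exp x - 1)) - 1"
      unfolding K .
    also have "\<dots> = x / (exp x - 1) - 1 + x / 2" by (simp add: distrib_left)
    finally show ?thesis .
  qed
  have terms: "z * (2 * z / (z\<^sup>2 - (of_nat (Suc j))\<^sup>2)) = 2 * x\<^sup>2 / (x\<^sup>2 + (of_real (period j))\<^sup>2)" for j
  proof -
    have c: "2 * x\<^sup>2 = (2 * of_real pi * \<i>)\<^sup>2 * (2 * z\<^sup>2)"
        "x\<^sup>2 + (of_real (period j))\<^sup>2 = (2 * of_real pi * \<i>)\<^sup>2 * (z\<^sup>2 - (of_nat (Suc j))\<^sup>2)"
      by (simp_all add: x period_def power2_eq_square algebra_simps)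
    show ?thesis unfolding c by (subst mult_divide_mult_cancel_left) (auto simp: power2_eq_square)
  qed
  show ?thesis using * unfolding cot terms .
qed

lemma summable_period: "summable (\<lambda>j. 1 / period j ^ (2 * k + 2))"
proof (rule summable_comparison_test')
  show "summable (\<lambda>j. 1 / real (Suc j) ^ 2)"
    using inverse_power_summable[of 2, where 'a = real] by (subst summable_Suc_iff) (simp add: inverse_eq_divide)
  fix j :: nat
  have "real (Suc j) ^ 2 \<le> period j ^ 2"
    using pi_gt3 by (intro power_mono) (auto simp: period_def)
  also have "\<dots> \<le> period j ^ (2 * k + 2)" by (rule power_increasing) (auto simp: period_ge)
  finally show "norm (1 / period j ^ (2 * k + 2)) \<le> 1 / real (Suc j) ^ 2"
    using period_ge(2)[of j] by (simp add: frac_le)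
qed

definition period_sum :: "nat \<Rightarrow> real" where
  "period_sum k = (\<Sum>j. 1 / period j ^ (2 * k + 2))"

lemma geometric_remainder:
  fixes q :: "'a::field"
  assumes "1 + q \<noteq> 0"
  shows "1 / (1 + q) = (\<Sum>k<N. (- q) ^ k) + (- q) ^ N / (1 + q)"
  using assms by (induction N) (simp_all add: field_simps)

text \<open>
  What is left of \<open>x / (exp x - 1)\<close> after the terms of order at most \<open>2N + 1\<close> of its power series:
  each partial fraction is expanded as a geometric series up to order \<open>N\<close>, and the tails are summed.  The
  explicit form is valid for all \<open>x\<close> off the poles, not only inside the disc of convergence.
\<close>

definition bernoulli_remainder :: "nat \<Rightarrow> complex \<Rightarrow> complex" where
  "bernoulli_remainder N x = (\<Sum>j. (-1) ^ N * 2 * x ^ (2 * N + 2) / (of_real (period j) ^ (2 * N) * (x\<^sup>2 + (of_real (period j))\<^sup>2)))"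

lemma bernoulli_remainder_sums:
  fixes x :: complex
  assumes "exp x \<noteq> 1"
  shows "(\<lambda>j. (-1) ^ N * 2 * x ^ (2 * N + 2) / (of_real (period j) ^ (2 * N) * (x\<^sup>2 + (of_real (period j))\<^sup>2)))
      sums (x / (exp x - 1) - 1 + x / 2 - (\<Sum>k<N. 2 * (-1) ^ k * of_real (period_sum k) * x ^ (2 * k + 2)))"
proof -
  have nz: "x\<^sup>2 + (of_real (period j))\<^sup>2 \<noteq> 0" for j
  proof
    assume "x\<^sup>2 + (of_real (period j))\<^sup>2 = 0"
    hence "(x - \<i> * of_real (period j)) * (x + \<i> * of_real (period j)) = 0"
      by (simp add: power2_eq_square algebra_simps)
    hence "x = \<i> * of_real (period j) \<or> x = - (\<i> * of_real (period j))"
      unfolding mult_eq_0_iff by (simp add: eq_neg_iff_add_eq_0)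
    hence "Re x = 0 \<and> (Im x = of_int (2 * int (Suc j)) * pi \<or> Im x = of_int (2 * - int (Suc j)) * pi)"
    proof
      assume "x = \<i> * of_real (period j)"
      hence "Re x = 0 \<and> Im x = period j" by simp
      thus ?thesis by (simp add: period_def)
    next
      assume "x = - (\<i> * of_real (period j))"
      hence "Re x = 0 \<and> Im x = - period j" by simp
      moreover have "- period j = of_int (2 * - int (Suc j)) * pi"
        by (simp add: period_def algebra_simps)
      ultimately show ?thesis by metis
    qed
    hence "exp x = 1" unfolding exp_eq_1 by (elim conjE disjE) (intro conjI exI, assumption+)+
    thus False using assms by simp
  qed
  have "2 * x\<^sup>2 / (x\<^sup>2 + (of_real c)\<^sup>2) - (\<Sum>k<N. 2 * (-1) ^ k * x ^ (2 * k + 2) * (1 / of_real c ^ (2 * k + 2)))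
      = (-1) ^ N * 2 * x ^ (2 * N + 2) / (of_real c ^ (2 * N) * (x\<^sup>2 + (of_real c)\<^sup>2))"
    if "c > 0" "x\<^sup>2 + (of_real c)\<^sup>2 \<noteq> 0" for c
  proof -
    define q where "q = x\<^sup>2 / (of_real c)\<^sup>2"
    have c0: "complex_of_real c \<noteq> 0" using that by simp
    have q1: "(1 + q) * (of_real c)\<^sup>2 = x\<^sup>2 + (of_real c)\<^sup>2" using c0 by (simp add: q_def distrib_right)
    hence q0: "1 + q \<noteq> 0" using that by auto
    have pw: "(- q) ^ k = (-1) ^ k * x ^ (2 * k) / of_real c ^ (2 * k)" for k
      unfolding q_def by (subst power_minus) (simp add: power_divide power_mult)
    have pow: "x ^ (2 * k + 2) = x\<^sup>2 * x ^ (2 * k)" "complex_of_real c ^ (2 * k + 2) = (of_real c)\<^sup>2 * of_real c ^ (2 * k)" for k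
      by (simp_all add: power_add mult_ac power2_eq_square)
    have "2 * x\<^sup>2 / (x\<^sup>2 + (of_real c)\<^sup>2) = 2 * x\<^sup>2 / (of_real c)\<^sup>2 * (1 / (1 + q))"
      unfolding q1[symmetric] by (simp add: mult_ac)
    also have "\<dots> = (\<Sum>k<N. 2 * x\<^sup>2 / (of_real c)\<^sup>2 * (- q) ^ k) + 2 * x\<^sup>2 / (of_real c)\<^sup>2 * ((- q) ^ N / (1 + q))"
      by (subst geometric_remainder[OF q0, of N]) (simp only: distrib_left sum_distrib_left)
    also have "2 * x\<^sup>2 / (of_real c)\<^sup>2 * ((- q) ^ N / (1 + q))
        = (-1) ^ N * 2 * x ^ (2 * N + 2) / (of_real c ^ (2 * N) * (x\<^sup>2 + (of_real c)\<^sup>2))"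
      unfolding pw q1[symmetric] pow by (simp add: mult_ac)
    also have "(\<Sum>k<N. 2 * x\<^sup>2 / (of_real c)\<^sup>2 * (- q) ^ k)
        = (\<Sum>k<N. 2 * (-1) ^ k * x ^ (2 * k + 2) * (1 / of_real c ^ (2 * k + 2)))"
      unfolding pw pow by (simp add: mult_ac)
    finally show ?thesis by simp
  qed
  note terms = this[OF period_ge(2) nz]
  have "(\<lambda>j. 2 * (-1) ^ k * x ^ (2 * k + 2) * (1 / of_real (period j) ^ (2 * k + 2)))
          sums (2 * (-1) ^ k * x ^ (2 * k + 2) * of_real (period_sum k))" for k
    using sums_of_real[OF summable_sums[OF summable_period[of k]], where 'a = complex]
    by (intro sums_mult) (simp add: period_sum_def)
  hence "(\<lambda>j. 2 * x\<^sup>2 / (x\<^sup>2 + (of_real (period j))\<^sup>2)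
          - (\<Sum>k<N. 2 * (-1) ^ k * x ^ (2 * k + 2) * (1 / of_real (period j) ^ (2 * k + 2))))
      sums (x / (exp x - 1) - 1 + x / 2 - (\<Sum>k<N. 2 * (-1) ^ k * x ^ (2 * k + 2) * of_real (period_sum k)))"
    by (intro sums_diff exp_partial_fractions[OF assms] sums_sum)
  thus ?thesis unfolding terms by (simp add: mult_ac)
qed

lemma bernoulli_remainder_eq:
  assumes "exp x \<noteq> 1"
  shows "x / (exp x - 1) = 1 - x / 2 + (\<Sum>k<N. 2 * (-1) ^ k * of_real (period_sum k) * x ^ (2 * k + 2))
            + bernoulli_remainder N x"
  using sums_unique[OF bernoulli_remainder_sums[OF assms, of N]]
  unfolding bernoulli_remainder_def by (simp add: algebra_simps)

lemma exp_neq_1_small: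
  assumes "norm x < 1" "x \<noteq> 0" shows "exp x \<noteq> (1::complex)"
proof
  assume "exp x = 1"
  then obtain n :: int where n: "Re x = 0" "Im x = of_int (2 * n) * pi" unfolding exp_eq_1 by blast
  have "n = 0"
  proof (rule ccontr)
    assume "n \<noteq> 0"
    hence "1 * 1 \<le> \<bar>of_int (2 * n)\<bar> * pi" using pi_gt3 by (intro mult_mono) linarith+
    also have "\<dots> = \<bar>Im x\<bar>" using n by (simp add: abs_mult)
    also have "\<dots> < 1" using abs_Im_le_cmod[of x] assms by simp
    finally show False by simp
  qed
  thus False using n assms by (simp add: complex_eq_iff)
qed

lemma exp_neq_1_real: "x > 0 \<Longrightarrow> exp (complex_of_real x) \<noteq> 1"
  by (metis exp_of_real of_real_eq_1_iff exp_eq_one_iff less_irrefl)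

lemma period_sum_nonneg: "period_sum k \<ge> 0"
  unfolding period_sum_def by (intro suminf_nonneg summable_period) (simp add: period_ge less_imp_le)

text \<open>
  On the unit disc the denominators stay away from zero since \<open>period j \<ge> 2\<close>; the crude constant
  \<open>4\<close> suffices for letting \<open>N\<close> tend to infinity.
\<close>

lemma norm_bernoulli_remainder_small:
  assumes x: "norm x < 1"
  shows "norm (bernoulli_remainder N x) \<le> 4 * norm x ^ (2 * N + 2) * period_sum 0"
proof -
  define t where "t j = (-1) ^ N * 2 * x ^ (2 * N + 2) / (of_real (period j) ^ (2 * N) * (x\<^sup>2 + (of_real (period j))\<^sup>2))" for j
  have bound: "norm (t j) \<le> 4 * norm x ^ (2 * N + 2) * (1 / period j ^ (2 * 0 + 2))" for j
  proof -
    have "2 ^ 2 \<le> period j ^ 2" using period_ge_2[of j] by (intro power_mono) auto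
    moreover have "(norm x)\<^sup>2 \<le> 1" using x by (simp add: power_le_one)
    moreover have "norm ((of_real (period j))\<^sup>2 - (- x\<^sup>2)) \<ge> norm ((complex_of_real (period j))\<^sup>2) - norm (- x\<^sup>2)"
      by (rule norm_triangle_ineq2)
    ultimately have den: "norm (x\<^sup>2 + (of_real (period j))\<^sup>2) \<ge> (period j)\<^sup>2 / 2"
      by (simp add: norm_power add.commute)
    have "norm (t j) = 2 * norm x ^ (2 * N + 2) / (period j ^ (2 * N) * norm (x\<^sup>2 + (of_real (period j))\<^sup>2))"
      using period_ge(2)[of j] by (simp add: t_def norm_mult norm_divide norm_power)
    also have "\<dots> \<le> 2 * norm x ^ (2 * N + 2) / (1 * ((period j)\<^sup>2 / 2))"
      using den period_ge[of j]
      by (intro divide_left_mono mult_mono mult_pos_pos) (auto intro: less_le_trans[OF _ den])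
    finally show ?thesis by (simp add: power2_eq_square)
  qed
  have "norm (bernoulli_remainder N x) \<le> (\<Sum>j. 4 * norm x ^ (2 * N + 2) * (1 / period j ^ (2 * 0 + 2)))"
    unfolding bernoulli_remainder_def t_def[symmetric]
    by (intro norm_suminf_le bound summable_mult summable_period)
  also have "\<dots> = 4 * norm x ^ (2 * N + 2) * period_sum 0"
    unfolding period_sum_def by (rule suminf_mult[OF summable_period])
  finally show ?thesis .
qed

definition bernoulli_coeff :: "nat \<Rightarrow> complex" where
  "bernoulli_coeff n = (if n = 0 then 1 else if n = 1 then - 1 / 2 else if odd n then 0
     else 2 * (-1) ^ (n div 2 - 1) * of_real (period_sum (n div 2 - 1)))"

lemma bernoulli_coeff_simps:
  "bernoulli_coeff 0 = 1" "bernoulli_coeff (Suc 0) = - 1 / 2"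
  "bernoulli_coeff (2 * k + 2) = 2 * (-1) ^ k * of_real (period_sum k)"
  "bernoulli_coeff (2 * k + 3) = 0"
  by (auto simp: bernoulli_coeff_def)

lemma bernoulli_coeff_sums:
  assumes "norm x < 1" "x \<noteq> 0"
  shows "(\<lambda>n. bernoulli_coeff n * x ^ n) sums (x / (exp x - 1))"
proof -
  let ?c = "x / (exp x - 1) - 1 + x / 2"
  have "(\<lambda>N. 4 * norm x ^ (2 * N + 2) * period_sum 0) \<longlonglongrightarrow> 4 * 0 * period_sum 0"
  proof (intro tendsto_mult tendsto_const)
    have "filterlim (\<lambda>N::nat. 2 * N + 2) sequentially sequentially"
      by (rule filterlim_subseq) (auto simp: strict_mono_def)
    thus "(\<lambda>N. norm x ^ (2 * N + 2)) \<longlonglongrightarrow> 0"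
      using assms by (intro filterlim_compose[OF LIMSEQ_power_zero]) auto
  qed
  hence lim: "(\<lambda>N. 4 * norm x ^ (2 * N + 2) * period_sum 0) \<longlonglongrightarrow> 0"
    by (simp only: mult_zero_left mult_zero_right)
  have "(\<lambda>N. bernoulli_remainder N x) \<longlonglongrightarrow> 0"
    by (rule Lim_null_comparison[OF _ lim])
       (intro always_eventually allI norm_bernoulli_remainder_small assms)
  hence "(\<lambda>N. ?c - bernoulli_remainder N x) \<longlonglongrightarrow> ?c - 0"
    by (intro tendsto_diff tendsto_const)
  moreover have "(\<Sum>k<N. 2 * (-1) ^ k * of_real (period_sum k) * x ^ (2 * k + 2)) = ?c - bernoulli_remainder N x" for N
    using bernoulli_remainder_eq[OF exp_neq_1_small[OF assms], of N] by (simp add: algebra_simps)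
  ultimately have "(\<lambda>k. 2 * (-1) ^ k * of_real (period_sum k) * x ^ (2 * k + 2)) sums ?c"
    by (simp add: sums_def)
  moreover define f where "f n = (if n < 2 then 0 else bernoulli_coeff n * x ^ n)" for n
  have "f (2 * k + 2) = 2 * (-1) ^ k * of_real (period_sum k) * x ^ (2 * k + 2)" for k
    unfolding f_def bernoulli_coeff_simps by simp
  ultimately have "(\<lambda>k. f (2 * k + 2)) sums ?c" by simp
  hence "f sums ?c"
  proof (subst (asm) sums_mono_reindex)
    show "strict_mono (\<lambda>k::nat. 2 * k + 2)" by (auto simp: strict_mono_def)
    fix n :: nat assume n: "n \<notin> range (\<lambda>k. 2 * k + 2)"
    show "f n = 0"
    proof (cases "n < 2 \<or> odd n")
      case False
      then obtain m where "n = 2 * m" "m \<ge> 1" by (auto elim!: evenE)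
      hence "n = 2 * (m - 1) + 2" by simp
      thus ?thesis using n by blast
    qed (auto simp: f_def bernoulli_coeff_def)
  qed
  moreover have "(\<lambda>n. if n \<in> {0, 1} then bernoulli_coeff n * x ^ n else 0) sums (\<Sum>n\<in>{0, 1}. bernoulli_coeff n * x ^ n)"
    by (rule sums_If_finite_set) simp
  ultimately have "(\<lambda>n. f n + (if n \<in> {0, 1} then bernoulli_coeff n * x ^ n else 0)) sums
      (?c + (\<Sum>n\<in>{0, 1}. bernoulli_coeff n * x ^ n))"
    by (rule sums_add)
  also have "(\<lambda>n. f n + (if n \<in> {0, 1} then bernoulli_coeff n * x ^ n else 0)) = (\<lambda>n. bernoulli_coeff n * x ^ n)"
    by (auto simp: f_def fun_eq_iff)
  finally show ?thesis by (simp add: bernoulli_coeff_simps)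
qed

text \<open>
  Both sides, multiplied by \<open>exp x - 1\<close>, expand the same function near \<open>0\<close>.  Thus
  \<open>bernoulli_coeff k\<close> is \<open>B\<^sub>k / k!\<close>.
\<close>

lemma bernoulli_fps: "fps_X / (fps_exp 1 - 1) = Abs_fps bernoulli_coeff"
proof -
  define V where "V = Abs_fps bernoulli_coeff"
  have "conv_radius bernoulli_coeff \<ge> norm (1 / 2 :: complex)"
    using bernoulli_coeff_sums[of "1 / 2"] by (intro conv_radius_geI) (auto simp: sums_iff)
  hence "fps_conv_radius V > 0"
    by (simp add: fps_conv_radius_def V_def) (metis ereal_less(2) less_le_trans zero_less_divide_1_iff zero_less_numeral)
  hence "eval_fps V has_fps_expansion V" by (rule eval_fps_has_fps_expansion)
  hence "(\<lambda>x. (exp x - 1) * eval_fps V x) has_fps_expansion (fps_exp 1 - 1) * V"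
    by (intro fps_expansion_intros)
  moreover have "(\<lambda>x. (exp x - 1) * eval_fps V x) has_fps_expansion fps_X"
  proof -
    have "eventually (\<lambda>x. x \<in> ball 0 1) (nhds (0::complex))"
      by (intro eventually_nhds_in_open) auto
    hence "eventually (\<lambda>x. x = (exp x - 1) * eval_fps V x) (nhds (0::complex))"
    proof eventually_elim
      case (elim x)
      show ?case
      proof (cases "x = 0")
        case False
        have "eval_fps V x = x / (exp x - 1)"
          using bernoulli_coeff_sums[of x] elim False by (simp add: eval_fps_def V_def sums_iff)
        moreover have "exp x \<noteq> 1" using elim False by (intro exp_neq_1_small) auto
        ultimately show ?thesis by simp
      qed auto
    qed
    thus ?thesis
      by (rule iffD1[OF has_fps_expansion_cong[OF _ refl] has_fps_expansion_fps_X])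
  qed
  ultimately have "(fps_exp 1 - 1) * V = fps_X" by (rule fps_expansion_unique_complex)
  moreover have "fps_exp 1 - 1 \<noteq> (0 :: complex fps)"
  proof
    assume "fps_exp 1 - 1 = (0 :: complex fps)"
    from arg_cong[OF this, of "\<lambda>f. fps_nth f 1"] show False by simp
  qed
  ultimately show ?thesis unfolding V_def by (metis nonzero_mult_div_cancel_left)
qed

lemma Psi_fps_nth: "fps_nth (Psi_fps s) k = bernoulli_coeff k * pochhammer_ext s (int k - 1) * (-1) ^ k"
  by (simp add: Psi_fps_def bernoulli_number_def bernoulli_fps)

text \<open>
  The alternating sign and the product of positive quantities in the even coefficients are what makes
  \<open>\<Psi>\<close> a Stieltjes series for \<open>s > 0\<close>.
\<close>

lemma Psi_fps_coeffs:
  "fps_nth (Psi_fps s) 0 = 1 / (s - 1)"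
  "fps_nth (Psi_fps s) (Suc 0) = 1 / 2"
  "fps_nth (Psi_fps s) (2 * k + 2) = 2 * (-1) ^ k * of_real (period_sum k) * pochhammer s (2 * k + 1)"
  "fps_nth (Psi_fps s) (2 * k + 3) = 0"
proof -
  show "fps_nth (Psi_fps s) 0 = 1 / (s - 1)" "fps_nth (Psi_fps s) (Suc 0) = 1 / 2"
    by (simp_all add: Psi_fps_nth bernoulli_coeff_simps pochhammer_ext_def)
  have "pochhammer_ext s (int (2 * k + 2) - 1) = pochhammer s (2 * k + 1)"
  proof -
    have "nat (int (2 * k + 2) - 1) = 2 * k + 1" by simp
    thus ?thesis unfolding pochhammer_ext_def by simp
  qed
  thus "fps_nth (Psi_fps s) (2 * k + 2) = 2 * (-1) ^ k * of_real (period_sum k) * pochhammer s (2 * k + 1)"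
    unfolding Psi_fps_nth bernoulli_coeff_simps by simp
  show "fps_nth (Psi_fps s) (2 * k + 3) = 0"
    unfolding Psi_fps_nth bernoulli_coeff_simps by simp
qed

section \<open>Analytic continuation of the Hurwitz zeta function\<close>

lemma norm_bernoulli_remainder_real:
  assumes "x > 0"
  shows "norm (bernoulli_remainder N (of_real x)) \<le> 2 * period_sum N * x ^ (2 * N + 2)"
proof -
  define t where "t j = (-1) ^ N * 2 * complex_of_real x ^ (2 * N + 2) / (of_real (period j) ^ (2 * N) * ((of_real x)\<^sup>2 + (of_real (period j))\<^sup>2))" for j
  have bound: "norm (t j) \<le> 2 * x ^ (2 * N + 2) * (1 / period j ^ (2 * N + 2))" for j
  proof -
    have c: "period j > 0" by (rule period_ge)
    have "(complex_of_real x)\<^sup>2 + (of_real (period j))\<^sup>2 = of_real (x\<^sup>2 + (period j)\<^sup>2)" by simp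
    hence "norm ((complex_of_real x)\<^sup>2 + (of_real (period j))\<^sup>2) = x\<^sup>2 + (period j)\<^sup>2"
      by (simp only: norm_of_real) simp
    hence "norm (t j) = 2 * x ^ (2 * N + 2) / (period j ^ (2 * N) * (x\<^sup>2 + (period j)\<^sup>2))"
      using c assms by (simp add: t_def norm_mult norm_divide norm_power)
    also have "\<dots> \<le> 2 * x ^ (2 * N + 2) / (period j ^ (2 * N) * (period j)\<^sup>2)"
      using c assms by (intro divide_left_mono mult_left_mono mult_pos_pos add_pos_pos) auto
    finally show ?thesis by (simp add: power_add power2_eq_square mult_ac)
  qed
  have "norm (bernoulli_remainder N (of_real x)) \<le> (\<Sum>j. 2 * x ^ (2 * N + 2) * (1 / period j ^ (2 * N + 2)))"
    unfolding bernoulli_remainder_def t_def[symmetric]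
    by (intro norm_suminf_le bound summable_mult summable_period)
  also have "\<dots> = 2 * x ^ (2 * N + 2) * period_sum N"
    unfolding period_sum_def by (rule suminf_mult[OF summable_period])
  finally show ?thesis by (simp add: mult_ac)
qed

lemma continuous_on_bernoulli_remainder:
  "continuous_on {0<..} (\<lambda>x. bernoulli_remainder N (of_real x))"
proof -
  have eq: "of_real x / (exp (of_real x) - 1) - (1 - of_real x / 2 +
       (\<Sum>k<N. 2 * (-1) ^ k * of_real (period_sum k) * of_real x ^ (2 * k + 2)))
      = bernoulli_remainder N (of_real x)" if "x \<in> {0<..}" for x
    using bernoulli_remainder_eq[OF exp_neq_1_real[of x], of N] that by simp
  have "continuous_on {0<..} (\<lambda>x. complex_of_real x / (exp (of_real x) - 1) - (1 - of_real x / 2 +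
       (\<Sum>k<N. 2 * (-1) ^ k * of_real (period_sum k) * of_real x ^ (2 * k + 2))))"
    by (intro continuous_intros) (auto simp: exp_neq_1_real)
  thus ?thesis by (rule continuous_on_eq) (rule eq)
qed

text \<open>
  The remainder has a zero of order \<open>2N + 2\<close> at \<open>x = 0\<close>, so this Mellin integrand is integrable for
  \<open>Re w > - 1 - 2N\<close>.
\<close>

definition remainder_kernel :: "nat \<Rightarrow> complex \<Rightarrow> complex \<Rightarrow> real \<Rightarrow> complex" where
  "remainder_kernel N a w x = of_real x powr (w - 2) * exp (- (a * of_real x)) * bernoulli_remainder N (of_real x)"

lemma remainder_kernel_measurable: "remainder_kernel N a w \<in> borel_measurable posline"
  unfolding remainder_kernel_def
  by (intro borel_measurable_posline_continuous continuous_on_mult continuous_on_bernoulli_remainder)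
     (auto intro!: continuous_intros)

lemma norm_remainder_kernel_le:
  assumes "x > 0"
  shows "norm (remainder_kernel N a w x)
           \<le> 2 * period_sum N * (x powr (Re w + 2 * real N) * exp (- (Re a * x)))"
proof -
  have "norm (remainder_kernel N a w x) = x powr Re (w - 2) * exp (- (Re a * x)) * norm (bernoulli_remainder N (of_real x))"
    unfolding remainder_kernel_def norm_mult[of _ "bernoulli_remainder N (of_real x)"] norm_powr_exp[OF assms] ..
  also have "\<dots> \<le> x powr Re (w - 2) * exp (- (Re a * x)) * (2 * period_sum N * x ^ (2 * N + 2))"
    by (intro mult_left_mono norm_bernoulli_remainder_real assms) auto
  also have "x ^ (2 * N + 2) = x powr (2 * real N + 2)"
    using powr_realpow[OF assms, of "2 * N + 2"] by (simp add: add.commute)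
  also have "x powr Re (w - 2) * exp (- (Re a * x)) * (2 * period_sum N * x powr (2 * real N + 2))
      = 2 * period_sum N * (x powr (Re (w - 2) + (2 * real N + 2)) * exp (- (Re a * x)))"
    by (simp only: powr_add mult_ac)
  finally show ?thesis by (simp add: algebra_simps)
qed

lemma integrable_power_exp:
  assumes "c > -1" "a > (0::real)"
  shows "integrable posline (\<lambda>x. x powr c * exp (- (a * x)))"
  using gamma_integrable_real[of "c + 1" a] assms by simp

lemma integrable_remainder_kernel:
  assumes "Re a > 0" "Re w > - 1 - 2 * real N"
  shows "integrable posline (remainder_kernel N a w)"
proof (rule Bochner_Integration.integrable_bound)
  show "integrable posline (\<lambda>x. 2 * period_sum N * (x powr (Re w + 2 * real N) * exp (- (Re a * x))))"
    using assms by (intro integrable_mult_right integrable_power_exp) auto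
  show "AE x in posline. norm (remainder_kernel N a w x) \<le>
          norm (2 * period_sum N * (x powr (Re w + 2 * real N) * exp (- (Re a * x))))"
    using norm_remainder_kernel_le by (intro AE_I2) (auto intro: order_trans[OF _ abs_ge_self])
qed (rule remainder_kernel_measurable)

lemma holomorphic_remainder_integral:
  assumes a: "Re a > 0"
  shows "(\<lambda>w. \<integral>x. remainder_kernel N a w x \<partial>posline) holomorphic_on {w. Re w > - 1 - 2 * real N}"
proof (rule holomorphic_on_integral)
  fix x :: real
  show "(\<lambda>w. remainder_kernel N a w x) holomorphic_on {w. Re w > - 1 - 2 * real N}"
    unfolding remainder_kernel_def by (intro holomorphic_intros)
next
  fix w :: complex assume w: "w \<in> {w. Re w > - 1 - 2 * real N}"
  define r where "r = (Re w + 1 + 2 * real N) / 2"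
  define B where "B x = 2 * period_sum N * (x powr (Re w - r + 2 * real N) * exp (- (Re a * x))
                           + x powr (Re w + r + 2 * real N) * exp (- (Re a * x)))" for x
  have r: "r > 0" "Re w - r > - 1 - 2 * real N" using w by (auto simp: r_def field_simps)
  have Re: "Re u \<ge> Re w - r" "Re u \<le> Re w + r" if "u \<in> cball w r" for u
    using that abs_Re_le_cmod[of "w - u"] by (auto simp: dist_norm)
  show "\<exists>r>0. \<exists>B. cball w r \<subseteq> {w. Re w > - 1 - 2 * real N} \<and> integrable posline B \<and>
       (\<forall>u\<in>cball w r. \<forall>x\<in>space posline. norm (remainder_kernel N a u x) \<le> B x)"
  proof (intro exI[of _ r] exI[of _ B] conjI ballI)
    show "cball w r \<subseteq> {w. Re w > - 1 - 2 * real N}"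
      using less_le_trans[OF r(2) Re(1)] by blast
    show "integrable posline B" unfolding B_def
      using r a by (intro integrable_mult_right Bochner_Integration.integrable_add integrable_power_exp) auto
    fix u x assume u: "u \<in> cball w r" and "x \<in> space posline"
    hence x: "x > 0" by simp
    \<comment> \<open>The lower end of the strip dominates for small \<open>x\<close>, the upper end for large \<open>x\<close>.\<close>
    have "x powr (Re u + 2 * real N) \<le> x powr (Re w - r + 2 * real N) + x powr (Re w + r + 2 * real N)"
    proof (cases "x \<le> 1")
      case True
      hence "x powr (Re u + 2 * real N) \<le> x powr (Re w - r + 2 * real N)"
        using Re(1)[OF u] x by (intro powr_mono') auto
      thus ?thesis using powr_ge_zero[of x "Re w + r + 2 * real N"] by linarith
    next
      case False
      hence "x powr (Re u + 2 * real N) \<le> x powr (Re w + r + 2 * real N)"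
        using Re(2)[OF u] by (intro powr_mono) auto
      thus ?thesis using powr_ge_zero[of x "Re w - r + 2 * real N"] by linarith
    qed
    hence "2 * period_sum N * (x powr (Re u + 2 * real N) * exp (- (Re a * x))) \<le> B x"
      unfolding B_def distrib_right[symmetric]
      by (intro mult_left_mono mult_right_mono) (auto simp: period_sum_nonneg)
    thus "norm (remainder_kernel N a u x) \<le> B x"
      using norm_remainder_kernel_le[OF x, of N a u] by linarith
  qed (rule r)
qed (rule open_halfspace_Re_gt remainder_kernel_measurable)+

text \<open>
  The continuation of \<open>\<zeta>(w,a)\<close> to \<open>Re w > - 1 - 2N\<close>: the Mellin integral with the first Bernoulli
  terms integrated explicitly.  Letting \<open>N\<close> grow reaches the whole plane.
\<close>

definition hurwitz_branch :: "nat \<Rightarrow> complex \<Rightarrow> complex \<Rightarrow> complex" where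
  "hurwitz_branch N a w = a powr (1 - w) / (w - 1) + a powr (- w) / 2
     + (\<Sum>k<N. 2 * (-1) ^ k * of_real (period_sum k) * pochhammer w (2 * k + 1) * a powr (- w - of_nat (2 * k + 1)))
     + rGamma w * (\<integral>x. remainder_kernel N a w x \<partial>posline)"

lemma hurwitz_branch_holomorphic:
  assumes "Re a > 0"
  shows "hurwitz_branch N a holomorphic_on ({w. Re w > - 1 - 2 * real N} - {1})"
proof -
  have "a \<noteq> 0" using assms by auto
  have "(\<lambda>w. \<integral>x. remainder_kernel N a w x \<partial>posline) holomorphic_on ({w. Re w > - 1 - 2 * real N} - {1})"
    by (rule holomorphic_on_subset[OF holomorphic_remainder_integral[OF assms]]) auto
  thus ?thesis unfolding hurwitz_branch_def[abs_def] pochhammer_prod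
    using \<open>a \<noteq> 0\<close> by (auto intro!: holomorphic_intros)
qed

lemma complex_pos_not_nonpos_Ints: "Re w > 0 \<Longrightarrow> w \<notin> \<int>\<^sub>\<le>\<^sub>0"
  by (auto elim!: nonpos_Ints_cases)

lemma rGamma_power_integral:
  assumes w: "Re w > 0" and a: "Re a > 0"
  shows "rGamma w * (\<integral>x. of_real x powr (w - 1 + of_nat n) * exp (- (a * of_real x)) \<partial>posline)
       = pochhammer w n * a powr (- w - of_nat n)"
proof -
  have "(\<integral>x. of_real x powr (w + of_nat n - 1) * exp (- (a * of_real x)) \<partial>posline)
      = Gamma (w + of_nat n) * a powr (- (w + of_nat n))"
    using w a by (intro gamma_laplace_integral) auto
  moreover have "rGamma w * Gamma (w + of_nat n) = pochhammer w n"
    using complex_pos_not_nonpos_Ints[OF w] pochhammer_Gamma[of w n]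
    by (simp add: rGamma_inverse_Gamma field_simps)
  ultimately show ?thesis by (simp add: algebra_simps mult.assoc[symmetric])
qed

lemma hurwitz_summable:
  assumes "Re w > 1" "Re a > 0"
  shows "summable (\<lambda>n. (Re a + real n) powr (- Re w))"
proof (rule summable_comparison_test')
  show "summable (\<lambda>n. real n powr (- Re w))"
    using assms by (subst summable_real_powr_iff) auto
  show "norm ((Re a + real n) powr (- Re w)) \<le> real n powr (- Re w)" if "n \<ge> 1" for n
    using that assms by (auto intro!: powr_mono2')
qed

text \<open>
  Each term of the Hurwitz series is a Gamma integral, and the exponentials sum to a geometric
  series under the integral sign.
\<close>

lemma hurwitz_sums_integral:
  assumes w: "Re w > 1" and a: "Re a > 0"
  shows "(\<lambda>n. (of_nat n + a) powr (- w)) sums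
     (rGamma w * (\<integral>x. of_real x powr (w - 1) * exp (- (a * of_real x)) / (1 - exp (- of_real x)) \<partial>posline))"
proof -
  define f where "f n x = of_real x powr (w - 1) * exp (- ((of_nat n + a) * of_real x))" for n x
  have an: "Re (of_nat n + a) > 0" for n using a by simp
  have w0: "Re w > 0" using w by simp
  have norm_f: "norm (f n x) = x powr (Re w - 1) * exp (- ((real n + Re a) * x))" if "x > 0" for n x
    unfolding f_def norm_powr_exp[OF that] by simp
  have f_geo: "f n x = of_real x powr (w - 1) * exp (- (a * of_real x)) * exp (- of_real x) ^ n" for n x
    by (simp add: f_def algebra_simps exp_diff exp_minus power_inverse exp_add flip: exp_of_nat_mult)
       (simp add: field_simps)
  have small: "norm (exp (- complex_of_real x)) < 1" if "x > 0" for x using that by simp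
  have norm_int: "(\<integral>x. norm (f n x) \<partial>posline) = Gamma (Re w) * (Re a + real n) powr (- Re w)" for n
  proof -
    have pos: "Re a + real n > 0" using a by simp
    have "complex_of_real (\<integral>x. norm (f n x) \<partial>posline) = (\<integral>x. complex_of_real (norm (f n x)) \<partial>posline)"
      by simp
    also have "\<dots> = (\<integral>x. of_real x powr (of_real (Re w) - 1) * exp (- (of_real (Re a + real n) * of_real x)) \<partial>posline)"
    proof (intro Bochner_Integration.integral_cong refl)
      fix x assume "x \<in> space posline"
      hence x: "x > 0" by simp
      have "complex_of_real x powr (of_real (Re w) - 1) = of_real (x powr (Re w - 1))"
        using x by (simp flip: powr_of_real)
      thus "complex_of_real (norm (f n x)) = of_real x powr (of_real (Re w) - 1) * exp (- (of_real (Re a + real n) * of_real x))"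
        unfolding norm_f[OF x] by (simp add: add.commute flip: exp_of_real)
    qed
    also have "\<dots> = Gamma (of_real (Re w)) * of_real (Re a + real n) powr (- of_real (Re w))"
      using w0 pos by (intro gamma_laplace_integral) auto
    also have "\<dots> = of_real (Gamma (Re w) * (Re a + real n) powr (- Re w))"
      using pos w0 powr_of_real[of "Re a + real n" "- Re w"] by (simp add: Gamma_complex_of_real)
    finally show ?thesis by (simp only: of_real_eq_iff)
  qed
  have "(\<lambda>n. \<integral>x. f n x \<partial>posline) sums (\<integral>x. (\<Sum>n. f n x) \<partial>posline)"
  proof (rule sums_integral)
    show "integrable posline (f n)" for n
      unfolding f_def by (rule gamma_laplace_integrable[OF w0 an])
    show "AE x in posline. summable (\<lambda>n. norm (f n x))"
      using small unfolding f_geo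
      by (intro AE_I2) (auto simp: norm_mult norm_power intro!: summable_mult summable_geometric)
    show "summable (\<lambda>n. \<integral>x. norm (f n x) \<partial>posline)"
      unfolding norm_int by (intro summable_mult hurwitz_summable w a)
  qed
  hence "(\<lambda>n. rGamma w * (\<integral>x. f n x \<partial>posline)) sums (rGamma w * (\<integral>x. (\<Sum>n. f n x) \<partial>posline))"
    by (rule sums_mult)
  moreover have "rGamma w * (\<integral>x. f n x \<partial>posline) = (of_nat n + a) powr (- w)" for n
    using rGamma_power_integral[OF w0 an, of 0 n] by (simp add: f_def)
  moreover have "(\<integral>x. (\<Sum>n. f n x) \<partial>posline)
     = (\<integral>x. of_real x powr (w - 1) * exp (- (a * of_real x)) / (1 - exp (- of_real x)) \<partial>posline)"
  proof (intro Bochner_Integration.integral_cong refl)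
    fix x assume "x \<in> space posline"
    hence "norm (exp (- complex_of_real x)) < 1" by (intro small) simp
    from sums_mult[OF geometric_sums[OF this]]
    show "(\<Sum>n. f n x) = of_real x powr (w - 1) * exp (- (a * of_real x)) / (1 - exp (- of_real x))"
      unfolding f_geo by (simp add: sums_iff)
  qed
  ultimately show ?thesis by simp
qed

lemma powr_times_power: "x > 0 \<Longrightarrow> complex_of_real x powr w * of_real x ^ n = of_real x powr (w + of_nat n)"
  by (simp add: powr_add powr_nat)

text \<open>
  Inserting the Bernoulli expansion with remainder into the Mellin integral; for \<open>Re w > 1\<close> each
  term is integrable by itself, and the Gamma factors combine to Pochhammer symbols.
\<close>

lemma hurwitz_branch_eq_series:
  assumes w: "Re w > 1" and a: "Re a > 0"
  shows "(\<lambda>n. (of_nat n + a) powr (- w)) sums hurwitz_branch N a w"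
proof -
  define g where "g c x = complex_of_real x powr c * exp (- (a * of_real x))" for c x
  have int: "integrable posline (g (w - 2 + of_nat n))" for n
    using gamma_laplace_integrable[of "w - 1 + of_nat n" a] w a by (simp add: g_def[abs_def] algebra_simps)
  have kernel: "of_real x powr (w - 1) * exp (- (a * of_real x)) / (1 - exp (- of_real x))
      = g (w - 2 + of_nat 0) x + g (w - 2 + of_nat 1) x / 2
        + (\<Sum>k<N. 2 * (-1) ^ k * of_real (period_sum k) * g (w - 2 + of_nat (2 * k + 2)) x)
        + remainder_kernel N a w x" if "x \<in> space posline" for x
  proof -
    have x: "x > 0" using that by simp
    have e1: "exp (complex_of_real x) \<noteq> 1" by (rule exp_neq_1_real[OF x])
    have "1 / (1 - exp (- complex_of_real x)) = exp (of_real x) / (exp (of_real x) - 1)"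
      using e1 by (simp add: exp_minus divide_simps)
    also have "\<dots> = 1 + 1 / (exp (of_real x) - 1)"
      using e1 by (simp add: divide_simps)
    finally have "of_real x * (1 / (1 - exp (- complex_of_real x))) = of_real x + of_real x / (exp (of_real x) - 1)"
      by (simp add: distrib_left)
    also have "\<dots> = of_real x ^ 0 + of_real x ^ 1 / 2 + (\<Sum>k<N. 2 * (-1) ^ k * of_real (period_sum k) * of_real x ^ (2 * k + 2))
            + bernoulli_remainder N (of_real x)"
      unfolding bernoulli_remainder_eq[OF e1, of N] by (simp add: algebra_simps)
    finally have b: "of_real x * (1 / (1 - exp (- complex_of_real x))) = \<dots>" .
    have gn: "complex_of_real x powr (w - 2) * exp (- (a * of_real x)) * of_real x ^ n = g (w - 2 + of_nat n) x" for n
      unfolding g_def powr_times_power[OF x, symmetric] by (simp only: mult_ac)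
    have "of_real x powr (w - 1) = complex_of_real x powr (w - 2) * of_real x"
      using powr_times_power[OF x, of "w - 2" 1] by (simp add: algebra_simps)
    hence "of_real x powr (w - 1) * exp (- (a * of_real x)) / (1 - exp (- of_real x))
       = complex_of_real x powr (w - 2) * exp (- (a * of_real x)) * (of_real x * (1 / (1 - exp (- complex_of_real x))))"
      by simp
    also have "\<dots> = complex_of_real x powr (w - 2) * exp (- (a * of_real x)) * of_real x ^ 0
        + complex_of_real x powr (w - 2) * exp (- (a * of_real x)) * of_real x ^ 1 / 2
        + (\<Sum>k<N. 2 * (-1) ^ k * of_real (period_sum k) * (complex_of_real x powr (w - 2) * exp (- (a * of_real x)) * of_real x ^ (2 * k + 2)))
        + remainder_kernel N a w x"
      unfolding b remainder_kernel_def distrib_left sum_distrib_left by (simp only: mult_ac times_divide_eq_right times_divide_eq_left)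
    finally show ?thesis unfolding gn .
  qed
  have term0: "rGamma w * (\<integral>x. g (w - 2 + of_nat 0) x \<partial>posline) = a powr (1 - w) / (w - 1)"
  proof -
    have w1: "Re (w - 1) > 0" using w by simp
    have "rGamma (w - 1) * (\<integral>x. g (w - 2 + of_nat 0) x \<partial>posline) = a powr (1 - w)"
      using rGamma_power_integral[OF w1 a, of 0] by (simp add: g_def)
    moreover have "rGamma (w - 1) = (w - 1) * rGamma w"
      using rGamma_plus1[of "w - 1"] by simp
    moreover have "w - 1 \<noteq> 0" using w1 by auto
    ultimately show ?thesis by (simp add: field_simps)
  qed
  have termn: "rGamma w * (\<integral>x. g (w - 2 + of_nat (Suc n)) x \<partial>posline) = pochhammer w n * a powr (- w - of_nat n)" for n
    using rGamma_power_integral[of w a n] w a by (simp add: g_def algebra_simps)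
  have "(\<integral>x. of_real x powr (w - 1) * exp (- (a * of_real x)) / (1 - exp (- of_real x)) \<partial>posline)
     = (\<integral>x. g (w - 2 + of_nat 0) x + g (w - 2 + of_nat 1) x / 2
        + (\<Sum>k<N. 2 * (-1) ^ k * of_real (period_sum k) * g (w - 2 + of_nat (2 * k + 2)) x)
        + remainder_kernel N a w x \<partial>posline)"
    by (intro Bochner_Integration.integral_cong refl kernel)
  also have "\<dots> = (\<integral>x. g (w - 2 + of_nat 0) x \<partial>posline) + (\<integral>x. g (w - 2 + of_nat 1) x \<partial>posline) / 2
        + (\<Sum>k<N. 2 * (-1) ^ k * of_real (period_sum k) * (\<integral>x. g (w - 2 + of_nat (2 * k + 2)) x \<partial>posline))
        + (\<integral>x. remainder_kernel N a w x \<partial>posline)"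
  proof -
    have i0: "integrable posline (\<lambda>x. g (w - 2 + of_nat n) x)" for n using int by simp
    have i1: "integrable posline (\<lambda>x. g (w - 2 + of_nat 1) x / 2)" using i0 by (rule integrable_divide)
    have i2: "integrable posline (\<lambda>x. 2 * (-1) ^ k * of_real (period_sum k) * g (w - 2 + of_nat (2 * k + 2)) x)" for k
      using i0 by (rule integrable_mult_right)
    have i3: "integrable posline (\<lambda>x. \<Sum>k<N. 2 * (-1) ^ k * of_real (period_sum k) * g (w - 2 + of_nat (2 * k + 2)) x)"
      using i2 by (rule Bochner_Integration.integrable_sum)
    have i4: "integrable posline (remainder_kernel N a w)"
      using w by (intro integrable_remainder_kernel a) auto
    show ?thesis
      by (simp only: Bochner_Integration.integral_add Bochner_Integration.integrable_add i0 i1 i3 i4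
           Bochner_Integration.integral_sum[OF i2] integral_mult_right_zero integral_divide_zero)
  qed
  also have "rGamma w * \<dots> = hurwitz_branch N a w"
  proof -
    have "rGamma w * (\<integral>x. g (w - 2 + of_nat 1) x \<partial>posline) = a powr (- w)"
      using termn[of 0] by simp
    moreover have "rGamma w * (\<integral>x. g (w - 2 + of_nat (2 * k + 2)) x \<partial>posline)
        = pochhammer w (2 * k + 1) * a powr (- w - of_nat (2 * k + 1))" for k
      using termn[of "2 * k + 1"] by (simp only: Suc_eq_plus1 add.assoc one_add_one)
    ultimately show ?thesis
      unfolding hurwitz_branch_def distrib_left sum_distrib_left term0
      by (simp only: mult.left_commute[of "rGamma w"] times_divide_eq_right mult.assoc)
  qed
  finally show ?thesis using hurwitz_sums_integral[OF w a] by simp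
qed

lemma hurwitz_branches_agree:
  assumes a: "Re a > 0" and w: "Re w > - 1 - 2 * real M" "Re w > - 1 - 2 * real N" "w \<noteq> 1"
  shows "hurwitz_branch M a w = hurwitz_branch N a w"
proof -
  define K where "K = min M N"
  let ?S = "{w. Re w > - 1 - 2 * real K} - {1::complex}"
  have "open ?S" by (intro open_delete open_halfspace_Re_gt)
  have sub: "?S \<subseteq> {w. Re w > - 1 - 2 * real M} - {1}" "?S \<subseteq> {w. Re w > - 1 - 2 * real N} - {1}"
    by (auto simp: K_def)
  have conn: "connected ?S"
    by (intro connected_open_delete open_halfspace_Re_gt convex_connected convex_halfspace_Re_gt) simp
  have w': "w \<in> ?S" using w by (auto simp: K_def min_def)
  show ?thesis
  proof (rule analytic_continuation_open[where s = "{w. Re w > 1}" and s' = ?S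
        and f = "hurwitz_branch M a" and g = "hurwitz_branch N a"])
    show "open {w. Re w > 1}" by (rule open_halfspace_Re_gt)
    show "{w. Re w > 1} \<noteq> {}" by (auto intro: exI[of _ 2])
    show "{w. Re w > 1} \<subseteq> ?S" by auto
    show "hurwitz_branch M a holomorphic_on ?S" "hurwitz_branch N a holomorphic_on ?S"
      using hurwitz_branch_holomorphic[OF a] sub holomorphic_on_subset by blast+
    show "hurwitz_branch M a u = hurwitz_branch N a u" if "u \<in> {w. Re w > 1}" for u
      using that hurwitz_branch_eq_series[OF _ a, of u M] hurwitz_branch_eq_series[OF _ a, of u N] sums_unique2
      by blast
  qed fact+
qed

text \<open>
  The branches agree with each other by the identity theorem, hence glue to a function on the
  whole punctured plane.
\<close>

lemma hurwitz_continuation_exists: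
  assumes a: "Re a > 0"
  shows "\<exists>f. f holomorphic_on (- {1}) \<and>
           (\<forall>w. Re w > 1 \<longrightarrow> (\<lambda>k. (of_nat k + a) powr (- w)) sums f w) \<and>
           (\<forall>w. Re w > - 1 \<and> w \<noteq> 1 \<longrightarrow> f w = hurwitz_branch 0 a w)"
proof (intro exI conjI allI impI)
  define N where "N w = nat \<lceil>\<bar>Re w\<bar>\<rceil>" for w
  have N: "Re w > - 1 - 2 * real (N w)" for w unfolding N_def by linarith
  define f where "f w = hurwitz_branch (N w) a w" for w
  have f: "f w = hurwitz_branch K a w" if "Re w > - 1 - 2 * real K" "w \<noteq> 1" for w K
    unfolding f_def using a N that by (intro hurwitz_branches_agree)
  show "f w = hurwitz_branch 0 a w" if "Re w > - 1 \<and> w \<noteq> 1" for w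
    using that by (intro f) auto
  have "f holomorphic_on (\<Union>K. {w. Re w > - 1 - 2 * real K} - {1})"
  proof (rule holomorphic_on_UN_open)
    fix K
    show "f holomorphic_on ({w. Re w > - 1 - 2 * real K} - {1})"
      by (rule holomorphic_transform[OF hurwitz_branch_holomorphic[OF a, of K]]) (use f in auto)
    show "open ({w. Re w > - 1 - 2 * real K} - {1})"
      by (intro open_delete open_halfspace_Re_gt)
  qed
  also have "(\<Union>K. {w. Re w > - 1 - 2 * real K} - {1}) = - {1}" using N by blast
  finally show "f holomorphic_on (- {1})" .
  show "(\<lambda>k. (of_nat k + a) powr (- w)) sums f w" if "Re w > 1" for w
    using hurwitz_branch_eq_series[OF that a, of "N w"] by (simp add: f_def)
qed

lemma hurwitz_zeta_eqI:
  assumes hol: "f holomorphic_on (- {1})"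
    and ser: "\<And>w. Re w > 1 \<Longrightarrow> (\<lambda>k. (of_nat k + a) powr (- w)) sums f w" and s: "s \<noteq> 1"
  shows "hurwitz_zeta s a = f s"
  unfolding hurwitz_zeta_def
proof (rule the_equality)
  show "\<exists>g. g holomorphic_on - {1} \<and> (\<forall>w. 1 < Re w \<longrightarrow> (\<lambda>k. (of_nat k + a) powr - w) sums g w) \<and> f s = g s"
    using hol ser by blast
next
  fix z assume "\<exists>g. g holomorphic_on - {1} \<and> (\<forall>w. 1 < Re w \<longrightarrow> (\<lambda>k. (of_nat k + a) powr - w) sums g w) \<and> z = g s"
  then obtain g where g: "g holomorphic_on - {1}" "\<And>w. 1 < Re w \<Longrightarrow> (\<lambda>k. (of_nat k + a) powr - w) sums g w" "z = g s"
    by blast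
  have "g s = f s"
  proof (rule analytic_continuation_open[where s = "{w. Re w > 1}" and s' = "- {1}" and f = g and g = f])
    show "open {w. Re w > 1}" by (rule open_halfspace_Re_gt)
    show "{w. Re w > 1} \<noteq> {}" by (auto intro: exI[of _ 2])
    show "connected (- {1::complex})" by (rule connected_punctured_universe) simp
    show "g u = f u" if "u \<in> {w. Re w > 1}" for u
      using sums_unique2[OF g(2) ser] that by blast
  qed (use g hol s in auto)
  thus "z = f s" using g by simp
qed

text \<open>
  Removing finitely many terms of the series changes the continuation by an entire function.
\<close>

lemma hurwitz_zeta_shifted:
  assumes a: "Re a > 0" and s: "Re s > - 1" "s \<noteq> 1"
  shows "hurwitz_zeta s a = (\<Sum>k<n. (of_nat k + a) powr (- s)) + hurwitz_branch 0 (of_nat n + a) s"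
proof -
  have an: "Re (of_nat n + a) > 0" using a by simp
  obtain f where f: "f holomorphic_on (- {1})"
    "\<And>w. Re w > 1 \<Longrightarrow> (\<lambda>k. (of_nat k + (of_nat n + a)) powr (- w)) sums f w"
    "\<And>w. Re w > - 1 \<Longrightarrow> w \<noteq> 1 \<Longrightarrow> f w = hurwitz_branch 0 (of_nat n + a) w"
    using hurwitz_continuation_exists[OF an] by metis
  have nz: "of_nat k + a \<noteq> 0" for k
  proof
    assume "of_nat k + a = 0"
    hence "Re (of_nat k + a) = 0" by simp
    thus False using a by simp
  qed
  have "hurwitz_zeta s a = (\<Sum>k<n. (of_nat k + a) powr (- s)) + f s"
  proof (rule hurwitz_zeta_eqI[OF _ _ s(2)])
    show "(\<lambda>w. (\<Sum>k<n. (of_nat k + a) powr (- w)) + f w) holomorphic_on - {1}"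
      using nz f(1) by (intro holomorphic_intros)
    fix w :: complex assume "Re w > 1"
    hence "(\<lambda>k. (of_nat (k + n) + a) powr (- w)) sums f w"
      using f(2)[of w] by (simp add: add.assoc)
    thus "(\<lambda>k. (of_nat k + a) powr (- w)) sums ((\<Sum>k<n. (of_nat k + a) powr (- w)) + f w)"
      by (subst (asm) sums_iff_shift) (simp add: add.commute)
  qed
  thus ?thesis using f(3)[OF s] by simp
qed

section \<open>The representing measure\<close>

lemma period_nonzero [simp]: "period j \<noteq> 0"
  using period_ge(2)[of j] by simp

abbreviation base_measure :: "(nat \<times> real) measure" where
  "base_measure \<equiv> count_space UNIV \<Otimes>\<^sub>M posline"

text \<open>
  The variable \<open>y\<close> of the representing measure, carried by a product space: the index \<open>j\<close> belongs
  to the partial fraction and \<open>u\<close> to the Gamma integral, so that moments factor into a sum over \<open>j\<close>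
  and an integral over \<open>u\<close>.
\<close>

definition node :: "nat \<times> real \<Rightarrow> real" where
  "node = (\<lambda>(j, u). u / period j)"

text \<open>
  The factor \<open>(u / period j)\<^bsup>2J\<^esup>\<close> is \<open>y\<^bsup>2J\<^esup>\<close>: the measure for \<open>J\<close> has the moment sequence for
  \<open>J = 0\<close> shifted by \<open>J\<close>, and so represents the series after removal of \<open>J\<close> terms.
\<close>

definition stieltjes_density :: "real \<Rightarrow> nat \<Rightarrow> nat \<times> real \<Rightarrow> real" where
  "stieltjes_density s J = (\<lambda>(j, u). 2 / (period j)\<^sup>2 * (u / period j) ^ (2 * J) * (u powr s * exp (- u) / Gamma s))"

definition stieltjes_measure :: "real \<Rightarrow> nat \<Rightarrow> (nat \<times> real) measure" where
  "stieltjes_measure s J = density base_measure (\<lambda>p. ennreal (stieltjes_density s J p))"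

lemma pair_sigma_finite_base: "pair_sigma_finite (count_space (UNIV :: nat set)) posline"
  by (intro pair_sigma_finite.intro sigma_finite_measure_count_space_countable sigma_finite_posline) auto

lemma space_base [simp]: "space base_measure = UNIV \<times> {0<..}"
  by (simp add: space_pair_measure)

lemma base_snd_measurable [measurable]: "snd \<in> borel_measurable base_measure"
  by (rule measurable_compose[OF measurable_snd borel_measurable_posline[of "\<lambda>u. u"]]) simp

lemma base_fst_measurable [measurable]: "(\<lambda>p. f (fst p)) \<in> borel_measurable base_measure"
  for f :: "nat \<Rightarrow> real"
  by (rule measurable_compose[OF measurable_fst]) simp

lemma node_measurable [measurable]: "node \<in> borel_measurable base_measure"
  unfolding node_def case_prod_unfold by measurable

lemma stieltjes_density_measurable [measurable]: "stieltjes_density s J \<in> borel_measurable base_measure"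
  unfolding stieltjes_density_def case_prod_unfold by measurable

lemma node_nonneg: "p \<in> space base_measure \<Longrightarrow> node p \<ge> 0"
  by (auto simp: node_def period_ge less_imp_le)

lemma stieltjes_density_pos:
  "s > 0 \<Longrightarrow> p \<in> space base_measure \<Longrightarrow> stieltjes_density s J p > 0"
  using period_ge(2) by (auto simp: stieltjes_density_def intro!: mult_pos_pos divide_pos_pos)

lemma
  fixes f :: "nat \<times> real \<Rightarrow> 'b::{banach, second_countable_topology}"
  assumes "s > 0" "f \<in> borel_measurable base_measure"
  shows integral_stieltjes: "(\<integral>p. f p \<partial>stieltjes_measure s J) = (\<integral>p. stieltjes_density s J p *\<^sub>R f p \<partial>base_measure)"
    and integrable_stieltjes: "integrable (stieltjes_measure s J) f
           \<longleftrightarrow> integrable base_measure (\<lambda>p. stieltjes_density s J p *\<^sub>R f p)"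
proof -
  have nn: "AE p in base_measure. 0 \<le> stieltjes_density s J p"
    using stieltjes_density_pos[OF assms(1)] by (intro AE_I2 less_imp_le)
  show "(\<integral>p. f p \<partial>stieltjes_measure s J) = (\<integral>p. stieltjes_density s J p *\<^sub>R f p \<partial>base_measure)"
    unfolding stieltjes_measure_def by (rule integral_density[OF assms(2) _ nn]) measurable
  show "integrable (stieltjes_measure s J) f \<longleftrightarrow> integrable base_measure (\<lambda>p. stieltjes_density s J p *\<^sub>R f p)"
    unfolding stieltjes_measure_def by (rule integrable_density[OF assms(2) _ nn]) measurable
qed

lemma
  fixes a :: "nat \<Rightarrow> real" and b :: "real \<Rightarrow> real"
  assumes a: "summable (\<lambda>j. \<bar>a j\<bar>)" and b: "integrable posline b"
  shows integrable_base_product: "integrable base_measure (\<lambda>(j, u). a j * b u)"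
    and integral_base_product: "(\<integral>(j, u). a j * b u \<partial>base_measure) = (\<Sum>j. a j) * (\<integral>u. b u \<partial>posline)"
proof -
  interpret P: pair_sigma_finite "count_space (UNIV :: nat set)" posline by (rule pair_sigma_finite_base)
  have [measurable]: "b \<in> borel_measurable posline" using b by simp
  have [measurable]: "(\<lambda>p. b (snd p)) \<in> borel_measurable base_measure"
    by (rule measurable_compose[OF measurable_snd]) simp
  show int: "integrable base_measure (\<lambda>(j, u). a j * b u)"
  proof (rule P.Fubini_integrable)
    show "(\<lambda>(j, u). a j * b u) \<in> borel_measurable base_measure"
      unfolding case_prod_unfold by measurable
    show "integrable (count_space UNIV) (\<lambda>j. \<integral>u. norm (case (j, u) of (j, u) \<Rightarrow> a j * b u) \<partial>posline)"
      using a by (simp add: integrable_count_space_nat_iff abs_mult summable_mult2)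
    show "AE j in count_space UNIV. integrable posline (\<lambda>u. case (j, u) of (j, u) \<Rightarrow> a j * b u)"
      using b by simp
  qed
  have "(\<integral>(j, u). a j * b u \<partial>base_measure) = (\<integral>j. (\<integral>u. a j * b u \<partial>posline) \<partial>count_space UNIV)"
    using P.integral_fst[OF int] by simp
  also have "\<dots> = (\<Sum>j. a j * (\<integral>u. b u \<partial>posline))"
    using a by (subst integral_count_space_nat) (auto simp: integrable_count_space_nat_iff abs_mult summable_mult2)
  also have "\<dots> = (\<Sum>j. a j) * (\<integral>u. b u \<partial>posline)"
    by (rule suminf_mult2[symmetric]) (rule summable_rabs_cancel[OF a])
  finally show "(\<integral>(j, u). a j * b u \<partial>base_measure) = (\<Sum>j. a j) * (\<integral>u. b u \<partial>posline)" .
qed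

lemma gamma_integral_real:
  assumes "c > -1"
  shows "(\<integral>u. u powr c * exp (- u) \<partial>posline) = Gamma (c + 1)"
proof -
  have "complex_of_real (\<integral>u. u powr c * exp (- u) \<partial>posline) = (\<integral>u. complex_of_real (u powr c * exp (- u)) \<partial>posline)"
    by (rule integral_complex_of_real[symmetric])
  also have "\<dots> = (\<integral>u. of_real u powr (of_real (c + 1) - 1) * exp (- (1 * of_real u)) \<partial>posline)"
  proof (intro Bochner_Integration.integral_cong refl)
    fix u assume "u \<in> space posline"
    thus "complex_of_real (u powr c * exp (- u)) = of_real u powr (of_real (c + 1) - 1) * exp (- (1 * of_real u))"
      using powr_of_real[of u c] by (simp flip: exp_of_real)
  qed
  also have "\<dots> = Gamma (of_real (c + 1)) * 1 powr (- of_real (c + 1))"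
    using assms by (intro gamma_laplace_integral) auto
  also have "\<dots> = of_real (Gamma (c + 1))" by (subst Gamma_complex_of_real) simp
  finally show ?thesis by (simp only: of_real_eq_iff)
qed

lemma density_power:
  assumes "p \<in> space base_measure"
  shows "stieltjes_density s J p * node p ^ (2 * k)
       = (case p of (j, u) \<Rightarrow> (2 / period j ^ (2 * (J + k) + 2)) * (u powr (s + real (2 * (J + k))) * exp (- u) / Gamma s))"
proof -
  obtain j u where p: "p = (j, u)" and u: "u > 0" using assms by (cases p) auto
  have "u powr (s + real (2 * (J + k))) = u powr s * u ^ (2 * (J + k))"
    using u by (simp add: powr_add powr_realpow del: of_nat_add of_nat_mult)
  thus ?thesis using period_ge(2)[of j]
    by (simp add: p stieltjes_density_def node_def power_divide power_add power2_eq_square distrib_left mult_ac)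
qed

lemma summable_moment_weight: "summable (\<lambda>j. \<bar>2 / period j ^ (2 * m + 2)\<bar>)"
  using summable_mult[OF summable_period[of m], of 2] period_ge(2) by (simp add: abs_mult abs_of_pos)

lemma
  assumes s: "s > 0"
  shows integrable_stieltjes_moment: "integrable (stieltjes_measure s J) (\<lambda>p. node p ^ (2 * k))"
    and stieltjes_moment: "(\<integral>p. node p ^ (2 * k) \<partial>stieltjes_measure s J)
           = 2 * period_sum (J + k) * pochhammer s (2 * (J + k) + 1)"
proof -
  let ?m = "J + k"
  let ?a = "\<lambda>j. 2 / period j ^ (2 * ?m + 2)" and ?b = "\<lambda>u. u powr (s + real (2 * ?m)) * exp (- u) / Gamma s"
  have b: "integrable posline ?b"
    using integrable_power_exp[of "s + real (2 * ?m)" 1] s by simp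
  have eq: "stieltjes_density s J p *\<^sub>R node p ^ (2 * k) = (case p of (j, u) \<Rightarrow> ?a j * ?b u)"
    if "p \<in> space base_measure" for p
    using density_power[OF that, of s J k] by simp
  have m: "(\<lambda>p. node p ^ (2 * k)) \<in> borel_measurable base_measure" by measurable
  show "integrable (stieltjes_measure s J) (\<lambda>p. node p ^ (2 * k))"
    unfolding integrable_stieltjes[OF s m]
    by (rule iffD2[OF Bochner_Integration.integrable_cong[OF refl eq]
          integrable_base_product[OF summable_moment_weight b]])
  have "(\<integral>p. node p ^ (2 * k) \<partial>stieltjes_measure s J) = (\<integral>(j, u). ?a j * ?b u \<partial>base_measure)"
    unfolding integral_stieltjes[OF s m] by (rule Bochner_Integration.integral_cong[OF refl eq])
  also have "\<dots> = (\<Sum>j. ?a j) * (\<integral>u. ?b u \<partial>posline)"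
    by (rule integral_base_product[OF summable_moment_weight b])
  also have "(\<Sum>j. ?a j) = 2 * period_sum ?m"
    unfolding period_sum_def using suminf_mult[OF summable_period[of ?m], of 2] by simp
  also have "(\<integral>u. ?b u \<partial>posline) = Gamma (s + real (2 * ?m) + 1) / Gamma s"
    using s by (subst integral_divide_zero, subst gamma_integral_real) auto
  also have "\<dots> = pochhammer s (2 * ?m + 1)"
  proof -
    have "s \<notin> \<int>\<^sub>\<le>\<^sub>0" using s by (auto elim!: nonpos_Ints_cases)
    thus ?thesis using pochhammer_Gamma[of s "2 * ?m + 1"] by (simp add: add_ac)
  qed
  finally show "(\<integral>p. node p ^ (2 * k) \<partial>stieltjes_measure s J) = 2 * period_sum (J + k) * pochhammer s (2 * (J + k) + 1)" .
qed

text \<open>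
  Half of the exponential decay in \<open>u\<close> pays for \<open>exp y\<close>, because \<open>y = u / period j \<le> u / 2\<close>.
\<close>

lemma integrable_stieltjes_exp:
  assumes s: "s > 0"
  shows "integrable (stieltjes_measure s J) (\<lambda>p. exp (node p))"
proof (subst integrable_stieltjes[OF s])
  let ?a = "\<lambda>j. 2 / period j ^ (2 * J + 2)" and ?b = "\<lambda>u. u powr (s + real (2 * J)) * exp (- (1 / 2 * u)) / Gamma s"
  have b: "integrable posline ?b"
    using integrable_power_exp[of "s + real (2 * J)" "1 / 2"] s by simp
  show "integrable base_measure (\<lambda>p. stieltjes_density s J p *\<^sub>R exp (node p))"
  proof (rule Bochner_Integration.integrable_bound[OF integrable_base_product[OF summable_moment_weight b, of J]])
    show "AE p in base_measure. norm (stieltjes_density s J p *\<^sub>R exp (node p)) \<le> norm (case p of (j, u) \<Rightarrow> ?a j * ?b u)"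
    proof (rule AE_I2)
      fix p assume p: "p \<in> space base_measure"
      obtain j u where pj: "p = (j, u)" and u: "u > 0" using p by (cases p) auto
      have "u / period j \<le> u / 2" using u period_ge_2[of j] by (intro divide_left_mono) auto
      hence "node p \<le> u / 2" by (simp add: node_def pj)
      hence "exp (- u) * exp (node p) \<le> exp (- (1 / 2 * u))" by (simp flip: exp_add)
      moreover have "Gamma s > 0" using s by (rule Gamma_real_pos)
      ultimately have "(?a j * u powr (s + real (2 * J)) / Gamma s) * (exp (- u) * exp (node p))
          \<le> (?a j * u powr (s + real (2 * J)) / Gamma s) * exp (- (1 / 2 * u))"
        using period_ge(2)[of j] by (intro mult_left_mono) auto
      moreover have "stieltjes_density s J p = ?a j * (u powr (s + real (2 * J)) * exp (- u) / Gamma s)"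
        using density_power[OF p, of s J 0] by (simp add: pj)
      ultimately have "stieltjes_density s J p * exp (node p) \<le> ?a j * ?b u"
        by (simp add: mult_ac)
      moreover have "norm (stieltjes_density s J p *\<^sub>R exp (node p)) = stieltjes_density s J p * exp (node p)"
        using stieltjes_density_pos[OF s p, of J] by (simp add: abs_mult)
      moreover have "?a j * ?b u \<le> norm (?a j * ?b u)" by (simp only: real_norm_def abs_ge_self)
      ultimately show "norm (stieltjes_density s J p *\<^sub>R exp (node p)) \<le> norm (case p of (j, u) \<Rightarrow> ?a j * ?b u)"
        unfolding pj prod.case by linarith
    qed
  qed measurable
qed measurable

definition stieltjes_functional :: "real \<Rightarrow> nat \<Rightarrow> real poly \<Rightarrow> real" where
  "stieltjes_functional s J q = (\<integral>p. poly q ((node p)\<^sup>2) \<partial>stieltjes_measure s J)"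

lemma stieltjes_measurable_iff [simp]:
  "f \<in> borel_measurable (stieltjes_measure s J) \<longleftrightarrow> f \<in> borel_measurable base_measure"
  by (simp add: stieltjes_measure_def)

lemma space_stieltjes [simp]: "space (stieltjes_measure s J) = UNIV \<times> {0<..}"
  by (simp add: stieltjes_measure_def)

lemma integrable_stieltjes_poly:
  assumes s: "s > 0"
  shows "integrable (stieltjes_measure s J) (\<lambda>p. poly q ((node p)\<^sup>2))"
  unfolding poly_altdef power_mult[symmetric]
  using integrable_stieltjes_moment[OF s] by (intro Bochner_Integration.integrable_sum integrable_mult_right)

lemma posline_AE_finite:
  assumes "finite F" shows "\<not> (AE u in posline. u \<in> F)"
proof
  assume "AE u in posline. u \<in> F"
  hence "AE u in lborel. u \<in> {0<..} \<longrightarrow> u \<in> F"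
    unfolding posline_def by (subst (asm) AE_restrict_space_iff) auto
  moreover have "AE u in lborel. u \<notin> F"
    using assms by (intro AE_not_in finite_imp_null_set_lborel)
  ultimately have "AE u in lborel. u \<notin> {0<..1::real}" by eventually_elim auto
  hence "{0<..1::real} \<in> null_sets lborel"
    by (subst (asm) AE_iff_null_sets[symmetric]) auto
  thus False by (auto simp: null_sets_def)
qed

text \<open>
  A nonnegative polynomial with zero integral would vanish at almost every \<open>y = u / period 0\<close>, that
  is, at infinitely many points.
\<close>

lemma stieltjes_positive_functional:
  assumes s: "s > 0" shows "positive_functional (stieltjes_functional s J)"
proof
  fix p q :: "real poly" and c :: real
  show "stieltjes_functional s J (p + q) = stieltjes_functional s J p + stieltjes_functional s J q"
    unfolding stieltjes_functional_def by (simp add: integrable_stieltjes_poly[OF s])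
  show "stieltjes_functional s J (smult c p) = c * stieltjes_functional s J p"
    unfolding stieltjes_functional_def by simp
  assume q0: "q \<noteq> 0" and nonneg: "\<And>v. v \<ge> 0 \<Longrightarrow> poly q v \<ge> 0"
  have "stieltjes_functional s J q \<ge> 0"
    unfolding stieltjes_functional_def using nonneg by (intro integral_nonneg_AE AE_I2) auto
  moreover have "stieltjes_functional s J q \<noteq> 0"
  proof
    interpret P: pair_sigma_finite "count_space (UNIV :: nat set)" posline by (rule pair_sigma_finite_base)
    assume "stieltjes_functional s J q = 0"
    hence "AE p in stieltjes_measure s J. poly q ((node p)\<^sup>2) = 0"
      unfolding stieltjes_functional_def using nonneg
      by (subst (asm) integral_nonneg_eq_0_iff_AE) (auto simp: integrable_stieltjes_poly[OF s])
    hence "AE p in base_measure. stieltjes_density s J p > 0 \<longrightarrow> poly q ((node p)\<^sup>2) = 0"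
      unfolding stieltjes_measure_def by (subst (asm) AE_density) (auto simp: ennreal_less_zero_iff)
    hence "AE p in base_measure. poly q ((node p)\<^sup>2) = 0"
      using AE_space by eventually_elim (use stieltjes_density_pos[OF s] in blast)
    from P.AE_pair[OF this] have "AE u in posline. poly q ((node (0, u))\<^sup>2) = 0"
      by (simp add: AE_count_space)
    hence "AE u in posline. u \<in> (\<lambda>v. period 0 * sqrt v) ` {v. poly q v = 0}"
      using AE_space
    proof eventually_elim
      case (elim u)
      have "u = period 0 * sqrt ((node (0, u))\<^sup>2)"
        using elim(2) period_ge(2)[of 0] by (simp add: node_def)
      thus ?case using elim(1) by blast
    qed
    thus False using posline_AE_finite poly_roots_finite[OF q0] by blast
  qed
  ultimately show "stieltjes_functional s J q > 0" by simp
qed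

section \<open>The Hurwitz zeta function as a Stieltjes transform\<close>

definition stieltjes_transform :: "real \<Rightarrow> nat \<Rightarrow> complex \<Rightarrow> complex" where
  "stieltjes_transform s J z = (\<integral>p. 1 / (1 + of_real ((node p)\<^sup>2) / z\<^sup>2) \<partial>stieltjes_measure s J)"

lemma one_plus_square_ratio_nonzero:
  assumes "Re z > 0" shows "1 + of_real (y\<^sup>2) / z\<^sup>2 \<noteq> 0"
proof
  have "z \<noteq> 0" using assms by auto
  assume "1 + of_real (y\<^sup>2) / z\<^sup>2 = 0"
  hence "z\<^sup>2 * (1 + of_real (y\<^sup>2) / z\<^sup>2) = 0" by simp
  hence "z\<^sup>2 + (of_real y)\<^sup>2 = 0" using \<open>z \<noteq> 0\<close> by (simp add: distrib_left)
  thus False using square_plus_square_nonzero[OF assms] by blast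
qed

text \<open>
  Since \<open>z\<^sup>2 + y\<^sup>2 = (z - \<i> y) (z + \<i> y)\<close> and both factors have real part \<open>Re z\<close>, the kernel is bounded
  uniformly in \<open>y\<close>.
\<close>

lemma norm_square_ratio_le:
  assumes r: "r > 0" "Re z \<ge> r"
  shows "norm (1 / (1 + of_real (y\<^sup>2) / z\<^sup>2)) \<le> (norm z)\<^sup>2 / r\<^sup>2"
proof -
  have z: "Re z > 0" "z \<noteq> 0" using r by auto
  have "r * r \<le> norm (z - \<i> * of_real y) * norm (z + \<i> * of_real y)"
  proof (intro mult_mono)
    show "r \<le> norm (z - \<i> * of_real y)" using complex_Re_le_cmod[of "z - \<i> * of_real y"] r by simp
    show "r \<le> norm (z + \<i> * of_real y)" using complex_Re_le_cmod[of "z + \<i> * of_real y"] r by simp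
  qed (use r in auto)
  also have "\<dots> = norm (z\<^sup>2 + of_real (y\<^sup>2))"
    by (simp add: norm_mult[symmetric] power2_eq_square algebra_simps)
  finally have le: "r\<^sup>2 \<le> norm (z\<^sup>2 + of_real (y\<^sup>2))" by (simp add: power2_eq_square)
  have "1 + of_real (y\<^sup>2) / z\<^sup>2 = (z\<^sup>2 + of_real (y\<^sup>2)) / z\<^sup>2"
    using z by (simp add: add_divide_distrib)
  hence "norm (1 / (1 + of_real (y\<^sup>2) / z\<^sup>2)) = (norm z)\<^sup>2 / norm (z\<^sup>2 + of_real (y\<^sup>2))"
    by (simp add: norm_divide norm_power)
  also have "\<dots> \<le> (norm z)\<^sup>2 / r\<^sup>2"
  proof (rule divide_left_mono[OF le])
    have "0 < r\<^sup>2" using r by simp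
    thus "0 < norm (z\<^sup>2 + of_real (y\<^sup>2)) * r\<^sup>2" using le by (intro mult_pos_pos) linarith+
  qed simp
  finally show ?thesis .
qed

lemma stieltjes_kernel_measurable [measurable]:
  "(\<lambda>p. 1 / (1 + complex_of_real ((node p)\<^sup>2) / z\<^sup>2)) \<in> borel_measurable base_measure"
  by measurable

lemma integrable_stieltjes_kernel:
  assumes s: "s > 0" and z: "Re z > 0"
  shows "integrable (stieltjes_measure s J) (\<lambda>p. 1 / (1 + complex_of_real ((node p)\<^sup>2) / z\<^sup>2))"
proof (rule Bochner_Integration.integrable_bound)
  show "integrable (stieltjes_measure s J) (\<lambda>p. (norm z)\<^sup>2 / (Re z)\<^sup>2)"
    using integrable_mult_right[OF integrable_stieltjes_moment[OF s, of J 0], of "(norm z)\<^sup>2 / (Re z)\<^sup>2"] by simp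
  show "AE p in stieltjes_measure s J. norm (1 / (1 + complex_of_real ((node p)\<^sup>2) / z\<^sup>2)) \<le> norm ((norm z)\<^sup>2 / (Re z)\<^sup>2)"
    using norm_square_ratio_le[OF z order_refl] by (intro AE_I2) (simp add: order_trans[OF _ abs_ge_self])
qed simp

lemma stieltjes_transform_holomorphic:
  assumes s: "s > 0"
  shows "stieltjes_transform s J holomorphic_on {z. Re z > 0}"
  unfolding stieltjes_transform_def[abs_def]
proof (rule holomorphic_on_integral)
  fix p show "(\<lambda>z. 1 / (1 + complex_of_real ((node p)\<^sup>2) / z\<^sup>2)) holomorphic_on {z. Re z > 0}"
    using one_plus_square_ratio_nonzero[of _ "node p"] by (intro holomorphic_intros) auto
next
  fix z :: complex assume z: "z \<in> {z. Re z > 0}"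
  define r where "r = Re z / 2"
  have r: "r > 0" using z by (simp add: r_def)
  have Re: "Re u \<ge> r" if "u \<in> cball z r" for u
    using that abs_Re_le_cmod[of "z - u"] by (simp add: dist_norm r_def)
  have nm: "norm u \<le> norm z + r" if "u \<in> cball z r" for u
    using that norm_triangle_ineq2[of u z] by (simp add: dist_norm norm_minus_commute)
  show "\<exists>r>0. \<exists>B. cball z r \<subseteq> {z. Re z > 0} \<and> integrable (stieltjes_measure s J) B \<and>
     (\<forall>w\<in>cball z r. \<forall>p\<in>space (stieltjes_measure s J). norm (1 / (1 + complex_of_real ((node p)\<^sup>2) / w\<^sup>2)) \<le> B p)"
  proof (intro exI[of _ r] exI[of _ "\<lambda>_. (norm z + r)\<^sup>2 / r\<^sup>2"] conjI ballI)
    show "cball z r \<subseteq> {z. Re z > 0}" using less_le_trans[OF r Re] by blast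
    show "integrable (stieltjes_measure s J) (\<lambda>_. (norm z + r)\<^sup>2 / r\<^sup>2)"
      using integrable_mult_right[OF integrable_stieltjes_moment[OF s, of J 0], of "(norm z + r)\<^sup>2 / r\<^sup>2"] by simp
    fix u p assume u: "u \<in> cball z r"
    have "norm (1 / (1 + complex_of_real ((node p)\<^sup>2) / u\<^sup>2)) \<le> (norm u)\<^sup>2 / r\<^sup>2"
      by (rule norm_square_ratio_le[OF r Re[OF u]])
    also have "\<dots> \<le> (norm z + r)\<^sup>2 / r\<^sup>2"
      by (intro divide_right_mono power_mono nm[OF u]) auto
    finally show "norm (1 / (1 + complex_of_real ((node p)\<^sup>2) / u\<^sup>2)) \<le> (norm z + r)\<^sup>2 / r\<^sup>2" .
  qed (rule r)
qed (simp_all add: open_halfspace_Re_gt)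

lemma stieltjes_density_Suc: "stieltjes_density s (Suc J) p = (node p)\<^sup>2 * stieltjes_density s J p"
  by (cases p) (simp add: stieltjes_density_def node_def power2_eq_square mult_ac)

text \<open>
  Integration of \<open>1 / (1 + q) = 1 - q / (1 + q)\<close> with \<open>q = y\<^sup>2 / z\<^sup>2\<close>; the factor \<open>y\<^sup>2\<close> passes to the
  measure.
\<close>

lemma stieltjes_transform_step:
  assumes s: "s > 0" and z: "Re z > 0"
  shows "stieltjes_transform s J z
    = of_real (2 * period_sum J * pochhammer s (2 * J + 1)) - 1 / z\<^sup>2 * stieltjes_transform s (Suc J) z"
proof -
  let ?k = "\<lambda>p. 1 / (1 + complex_of_real ((node p)\<^sup>2) / z\<^sup>2)"
  have k: "?k p = 1 - 1 / z\<^sup>2 * (of_real ((node p)\<^sup>2) * ?k p)" for p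
  proof -
    have "1 / (1 + q) = 1 - q * (1 / (1 + q))" if "1 + q \<noteq> 0" for q :: complex
      using that by (simp add: field_simps)
    moreover have "1 / z\<^sup>2 * (b * x) = b / z\<^sup>2 * x" for b x by simp
    ultimately show ?thesis using one_plus_square_ratio_nonzero[OF z, of "node p"] by metis
  qed
  have one: "integrable (stieltjes_measure s J) (\<lambda>_. 1 :: complex)"
  proof -
    have "integrable (stieltjes_measure s J) (\<lambda>p. complex_of_real (node p ^ (2 * 0)))"
      by (rule integrable_of_real[OF integrable_stieltjes_moment[OF s]])
    thus ?thesis by simp
  qed
  have m: "(\<lambda>p. of_real ((node p)\<^sup>2) * ?k p) \<in> borel_measurable base_measure" by measurable
  have eq: "stieltjes_density s J p *\<^sub>R (of_real ((node p)\<^sup>2) * ?k p) = stieltjes_density s (Suc J) p *\<^sub>R ?k p" for p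
    unfolding stieltjes_density_Suc by (simp add: scaleR_conv_of_real)
  have int: "integrable (stieltjes_measure s J) (\<lambda>p. of_real ((node p)\<^sup>2) * ?k p)"
    using integrable_stieltjes_kernel[OF s z, of "Suc J"]
    unfolding integrable_stieltjes[OF s m] integrable_stieltjes[OF s stieltjes_kernel_measurable] eq .
  have "stieltjes_transform s J z = (\<integral>p. 1 - 1 / z\<^sup>2 * (of_real ((node p)\<^sup>2) * ?k p) \<partial>stieltjes_measure s J)"
    unfolding stieltjes_transform_def by (intro Bochner_Integration.integral_cong refl k)
  also have "\<dots> = (\<integral>p. 1 \<partial>stieltjes_measure s J) - 1 / z\<^sup>2 * (\<integral>p. of_real ((node p)\<^sup>2) * ?k p \<partial>stieltjes_measure s J)"
    by (simp only: Bochner_Integration.integral_diff[OF one integrable_mult_right[OF int]] integral_mult_right_zero)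
  also have "(\<integral>p. of_real ((node p)\<^sup>2) * ?k p \<partial>stieltjes_measure s J) = stieltjes_transform s (Suc J) z"
    unfolding stieltjes_transform_def integral_stieltjes[OF s m] integral_stieltjes[OF s stieltjes_kernel_measurable] eq ..
  also have "(\<integral>p. 1 \<partial>stieltjes_measure s J) = complex_of_real (\<integral>p. node p ^ (2 * 0) \<partial>stieltjes_measure s J)"
    by (simp only: integral_complex_of_real[symmetric]) simp
  also have "(\<integral>p. node p ^ (2 * 0) \<partial>stieltjes_measure s J) = 2 * period_sum J * pochhammer s (2 * J + 1)"
    using stieltjes_moment[OF s, of J 0] by simp
  finally show ?thesis .
qed

lemma stieltjes_transform_expansion:
  assumes s: "s > 0" and z: "Re z > 0"
  shows "1 / z\<^sup>2 * stieltjes_transform s 0 z =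
           (\<Sum>k<J. fps_nth (Psi_fps (of_real s)) (2 * k + 2) * (1 / z) ^ (2 * k + 2))
           + (-1) ^ J * (1 / z) ^ (2 * J + 2) * stieltjes_transform s J z"
proof (induction J)
  case 0
  show ?case by (simp add: power_divide power2_eq_square)
next
  case (Suc J)
  have c: "fps_nth (Psi_fps (of_real s)) (2 * J + 2)
      = (-1) ^ J * of_real (2 * period_sum J * pochhammer s (2 * J + 1))"
    unfolding Psi_fps_coeffs pochhammer_of_real by simp
  have zz: "(1 / z) ^ (2 * J + 2) * (1 / z\<^sup>2) = (1 / z) ^ (2 * Suc J + 2)"
    by (simp add: power_divide power2_eq_square power_add)
  show ?case
    unfolding Suc.IH stieltjes_transform_step[OF s z, of J] sum.lessThan_Suc c zz[symmetric]
    by (simp add: algebra_simps)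
qed

text \<open>
  Summing over \<open>j\<close> first gives the Bernoulli remainder at \<open>x = u / c\<close>, and the substitution
  \<open>u = c x\<close> produces the Mellin integrand.  The substitution needs \<open>c\<close> real; complex arguments
  are reached by analytic continuation.
\<close>

lemma stieltjes_transform_real:
  assumes s: "s > 0" and c: "c > 0"
  shows "stieltjes_transform s 0 (of_real c)
     = of_real c powr (of_real s + 1) * (rGamma (of_real s) * (\<integral>x. remainder_kernel 0 (of_real c) (of_real s) x \<partial>posline))"
proof -
  interpret P: pair_sigma_finite "count_space (UNIV :: nat set)" posline by (rule pair_sigma_finite_base)
  let ?k = "\<lambda>p. 1 / (1 + complex_of_real ((node p)\<^sup>2) / (of_real c)\<^sup>2)"
  have rc: "Re (of_real c) > 0" using c by simp
  have int: "integrable base_measure (\<lambda>(j, u). stieltjes_density s 0 (j, u) *\<^sub>R ?k (j, u))"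
    using integrable_stieltjes_kernel[OF s rc, of 0]
    unfolding integrable_stieltjes[OF s stieltjes_kernel_measurable] by (simp add: case_prod_unfold)
  define K where "K u = complex_of_real (u powr s * exp (- u) / Gamma s)" for u
  define G where "G u = K u / (of_real (u / c))\<^sup>2 * bernoulli_remainder 0 (of_real (u / c))" for u
  have inner: "(\<integral>j. stieltjes_density s 0 (j, u) *\<^sub>R ?k (j, u) \<partial>count_space UNIV) = G u"
    if "u \<in> space posline" for u
  proof -
    have u: "u > 0" using that by simp
    define x where "x = u / c"
    have x: "x > 0" using u c by (simp add: x_def)
    have summand: "stieltjes_density s 0 (j, u) *\<^sub>R ?k (j, u)
        = K u / (of_real x)\<^sup>2 * (2 * (of_real x)\<^sup>2 / ((of_real x)\<^sup>2 + (of_real (period j))\<^sup>2))" for j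
    proof -
      have "(u / period j)\<^sup>2 / c\<^sup>2 = x\<^sup>2 / (period j)\<^sup>2" by (simp add: x_def power_divide)
      moreover have "1 + x\<^sup>2 / (period j)\<^sup>2 = (x\<^sup>2 + (period j)\<^sup>2) / (period j)\<^sup>2"
        by (simp add: add_divide_distrib)
      ultimately have "1 / (1 + (u / period j)\<^sup>2 / c\<^sup>2) = (period j)\<^sup>2 / (x\<^sup>2 + (period j)\<^sup>2)"
        by simp
      hence "stieltjes_density s 0 (j, u) * (1 / (1 + (node (j, u))\<^sup>2 / c\<^sup>2))
          = u powr s * exp (- u) / Gamma s / x\<^sup>2 * (2 * x\<^sup>2 / (x\<^sup>2 + (period j)\<^sup>2))"
        using x by (simp add: stieltjes_density_def node_def)
      from arg_cong[OF this, of complex_of_real] show ?thesis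
        by (simp only: K_def scaleR_conv_of_real of_real_mult of_real_divide of_real_add of_real_power
             of_real_numeral of_real_1)
    qed
    have "(\<lambda>j. 2 * (of_real x)\<^sup>2 / ((of_real x)\<^sup>2 + (of_real (period j))\<^sup>2)) sums bernoulli_remainder 0 (of_real x)"
      using bernoulli_remainder_sums[OF exp_neq_1_real[OF x], of 0] bernoulli_remainder_eq[OF exp_neq_1_real[OF x], of 0]
      by (simp add: power2_eq_square)
    from sums_mult[OF this, of "K u / (of_real x)\<^sup>2"]
    have sums: "(\<lambda>j. stieltjes_density s 0 (j, u) *\<^sub>R ?k (j, u)) sums G u"
      unfolding summand G_def x_def .
    have "integrable (count_space UNIV) (\<lambda>j. stieltjes_density s 0 (j, u) *\<^sub>R ?k (j, u))"
      unfolding integrable_count_space_nat_iff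
    proof (rule summable_comparison_test')
      show "summable (\<lambda>j. \<bar>2 / period j ^ (2 * 0 + 2)\<bar> * norm (K u))"
        by (intro summable_mult2 summable_moment_weight)
      fix j :: nat
      have "norm (?k (j, u)) \<le> (norm (complex_of_real c))\<^sup>2 / c\<^sup>2"
        using c by (intro norm_square_ratio_le) auto
      hence k1: "norm (?k (j, u)) \<le> 1" using c by simp
      have "norm (stieltjes_density s 0 (j, u) *\<^sub>R ?k (j, u)) = (\<bar>2 / period j ^ (2 * 0 + 2)\<bar> * norm (K u)) * norm (?k (j, u))"
      proof -
        have "\<bar>stieltjes_density s 0 (j, u)\<bar> = \<bar>2 / period j ^ (2 * 0 + 2)\<bar> * norm (K u)"
          unfolding K_def norm_of_real by (simp add: stieltjes_density_def abs_mult power2_eq_square)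
        thus ?thesis unfolding norm_scaleR by (simp only:)
      qed
      also have "\<dots> \<le> (\<bar>2 / period j ^ (2 * 0 + 2)\<bar> * norm (K u)) * 1"
        by (intro mult_left_mono k1) auto
      finally show "norm (norm (stieltjes_density s 0 (j, u) *\<^sub>R ?k (j, u))) \<le> \<bar>2 / period j ^ (2 * 0 + 2)\<bar> * norm (K u)"
        by simp
    qed
    from sums_integral_count_space_nat[OF this] sums show ?thesis by (rule sums_unique2)
  qed
  have "stieltjes_transform s 0 (of_real c) = (\<integral>p. stieltjes_density s 0 p *\<^sub>R ?k p \<partial>base_measure)"
    unfolding stieltjes_transform_def integral_stieltjes[OF s stieltjes_kernel_measurable] ..
  also have "\<dots> = (\<integral>u. (\<integral>j. stieltjes_density s 0 (j, u) *\<^sub>R ?k (j, u) \<partial>count_space UNIV) \<partial>posline)"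
    using P.integral_snd[OF int] by (simp add: case_prod_unfold)
  also have "\<dots> = (\<integral>u. G u \<partial>posline)"
    by (intro Bochner_Integration.integral_cong refl inner)
  also have "\<dots> = c *\<^sub>R (\<integral>x. G (c * x) \<partial>posline)"
    by (rule integral_posline_scale[OF c])
  also have "(\<integral>x. G (c * x) \<partial>posline)
      = (\<integral>x. of_real c powr of_real s * rGamma (of_real s) * remainder_kernel 0 (of_real c) (of_real s) x \<partial>posline)"
  proof (intro Bochner_Integration.integral_cong refl)
    fix x assume "x \<in> space posline"
    hence x: "x > 0" by simp
    have "(c * x) powr s = c powr s * x powr s" using c x by (simp add: powr_mult)
    moreover have "complex_of_real x powr (of_real s - 2) = of_real (x powr s) / (of_real x)\<^sup>2"
    proof -
      have "complex_of_real x powr (of_real s - 2) = of_real (x powr (s - 2))"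
        using powr_of_real[of x "s - 2"] x by simp
      also have "x powr (s - 2) = x powr s / x\<^sup>2" using x by (simp add: powr_diff)
      finally show ?thesis by simp
    qed
    moreover have "complex_of_real c powr of_real s = of_real (c powr s)" using c by (intro powr_of_real) simp
    moreover have "rGamma (complex_of_real s) = of_real (1 / Gamma s)"
      by (simp add: rGamma_inverse_Gamma Gamma_complex_of_real inverse_eq_divide)
    ultimately show "G (c * x) = of_real c powr of_real s * rGamma (of_real s) * remainder_kernel 0 (of_real c) (of_real s) x"
      using c by (simp add: G_def K_def remainder_kernel_def exp_of_real[symmetric])
  qed
  also have "c *\<^sub>R \<dots> = of_real c powr (of_real s + 1) * (rGamma (of_real s) * (\<integral>x. remainder_kernel 0 (of_real c) (of_real s) x \<partial>posline))"
    unfolding integral_mult_right_zero using c by (simp add: scaleR_conv_of_real powr_add)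
  finally show ?thesis .
qed

lemma holomorphic_remainder_integral_shift:
  assumes s: "s > 0"
  shows "(\<lambda>z. \<integral>x. remainder_kernel 0 z (of_real s) x \<partial>posline) holomorphic_on {z. Re z > 0}"
proof (rule holomorphic_on_integral)
  fix x show "(\<lambda>z. remainder_kernel 0 z (of_real s) x) holomorphic_on {z. Re z > 0}"
    unfolding remainder_kernel_def by (intro holomorphic_intros)
next
  fix z :: complex assume z: "z \<in> {z. Re z > 0}"
  define r where "r = Re z / 2"
  have r: "r > 0" using z by (simp add: r_def)
  have Re: "Re u \<ge> r" if "u \<in> cball z r" for u
    using that abs_Re_le_cmod[of "z - u"] by (simp add: dist_norm r_def)
  show "\<exists>r>0. \<exists>B. cball z r \<subseteq> {z. Re z > 0} \<and> integrable posline B \<and>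
     (\<forall>u\<in>cball z r. \<forall>x\<in>space posline. norm (remainder_kernel 0 u (of_real s) x) \<le> B x)"
  proof (intro exI[of _ r] exI[of _ "\<lambda>x. 2 * period_sum 0 * (x powr s * exp (- (r * x)))"] conjI ballI)
    show "cball z r \<subseteq> {z. Re z > 0}" using less_le_trans[OF r Re] by blast
    show "integrable posline (\<lambda>x. 2 * period_sum 0 * (x powr s * exp (- (r * x))))"
      using s r by (intro integrable_mult_right integrable_power_exp) auto
    fix u x assume u: "u \<in> cball z r" and "x \<in> space posline"
    hence x: "x > 0" and rx: "r * x \<le> Re u * x" using Re[OF u] by (auto intro: mult_right_mono)
    have "norm (remainder_kernel 0 u (of_real s) x) \<le> 2 * period_sum 0 * (x powr s * exp (- (Re u * x)))"
      using norm_remainder_kernel_le[OF x, of 0 u "of_real s"] by simp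
    also have "\<dots> \<le> 2 * period_sum 0 * (x powr s * exp (- (r * x)))"
      using rx by (intro mult_left_mono) (auto simp: period_sum_nonneg)
    finally show "norm (remainder_kernel 0 u (of_real s) x) \<le> 2 * period_sum 0 * (x powr s * exp (- (r * x)))" .
  qed (rule r)
qed (rule open_halfspace_Re_gt remainder_kernel_measurable)+

lemma stieltjes_transform_eq:
  assumes s: "s > 0" and z: "Re z > 0"
  shows "stieltjes_transform s 0 z
     = z powr (of_real s + 1) * (rGamma (of_real s) * (\<integral>x. remainder_kernel 0 z (of_real s) x \<partial>posline))"
proof (rule right_half_plane_identity[OF _ _ _ z])
  show "stieltjes_transform s 0 holomorphic_on {z. Re z > 0}"
    by (rule stieltjes_transform_holomorphic[OF s])
  show "(\<lambda>z. z powr (of_real s + 1) * (rGamma (of_real s) * (\<integral>x. remainder_kernel 0 z (of_real s) x \<partial>posline)))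
          holomorphic_on {z. Re z > 0}"
    by (intro holomorphic_intros holomorphic_remainder_integral_shift[OF s]) (auto elim!: nonpos_Reals_cases)
qed (rule stieltjes_transform_real[OF s])

lemma hurwitz_branch_stieltjes:
  assumes s: "s > 0" and z: "Re z > 0"
  shows "hurwitz_branch 0 z (of_real s) =
     z powr (1 - of_real s) * (1 / (of_real s - 1) + 1 / 2 * (1 / z) + 1 / z\<^sup>2 * stieltjes_transform s 0 z)"
proof -
  have z0: "z \<noteq> 0" using z by auto
  have "z powr (1 - of_real s) * (1 / z) = z powr (- of_real s)"
    using z0 by (simp add: powr_diff powr_minus field_simps)
  moreover have "z powr (1 - of_real s) * (1 / z\<^sup>2 * (z powr (of_real s + 1))) = 1"
    using z0 by (simp add: powr_diff powr_add power2_eq_square)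
  ultimately show ?thesis
    unfolding hurwitz_branch_def stieltjes_transform_eq[OF s z]
    by (simp add: distrib_left mult.assoc[symmetric])
qed

section \<open>Quadrature sums as Pade approximants\<close>

text \<open>
  Numerator and denominator of \<open>\<Sum>\<^sub>v w(v) / (1 + v t\<^sup>2)\<close> as polynomials in \<open>t\<close>.
\<close>

definition quadrature_denominator :: "real set \<Rightarrow> complex poly" where
  "quadrature_denominator A = (\<Prod>v\<in>A. [:1, 0, of_real v:])"

definition quadrature_numerator :: "real set \<Rightarrow> (real \<Rightarrow> real) \<Rightarrow> complex poly" where
  "quadrature_numerator A w = (\<Sum>v\<in>A. smult (of_real (w v)) (\<Prod>u\<in>A - {v}. [:1, 0, of_real u:]))"

lemma degree_quadrature_denominator: "degree (quadrature_denominator A) \<le> 2 * card A"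
proof (cases "finite A")
  case True
  have "degree (quadrature_denominator A) \<le> (\<Sum>v\<in>A. degree [:1, 0, complex_of_real v:])"
    unfolding quadrature_denominator_def using degree_prod_sum_le[OF True, of "\<lambda>v. [:1, 0, complex_of_real v:]"] unfolding o_def .
  also have "\<dots> \<le> (\<Sum>v\<in>A. 2)" by (intro sum_mono) simp
  finally show ?thesis by simp
qed (simp add: quadrature_denominator_def)

lemma degree_quadrature_numerator:
  assumes "finite A" shows "degree (quadrature_numerator A w) \<le> 2 * card A - 2"
  unfolding quadrature_numerator_def
proof (rule degree_sum_le[OF assms])
  fix v assume v: "v \<in> A"
  have "degree (smult (of_real (w v)) (\<Prod>u\<in>A - {v}. [:1, 0, complex_of_real u:]))
          \<le> degree (quadrature_denominator (A - {v}))"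
    unfolding quadrature_denominator_def by (rule degree_smult_le)
  also have "\<dots> \<le> 2 * card (A - {v})" by (rule degree_quadrature_denominator)
  finally show "degree (smult (of_real (w v)) (\<Prod>u\<in>A - {v}. [:1, 0, complex_of_real u:])) \<le> 2 * card A - 2"
    using v assms by simp
qed

lemma poly_quadrature:
  assumes "finite A" and nz: "\<And>v. v \<in> A \<Longrightarrow> 1 + of_real v * t\<^sup>2 \<noteq> 0"
  shows "poly (quadrature_denominator A) t \<noteq> 0"
    and "poly (quadrature_numerator A w) t
           = poly (quadrature_denominator A) t * (\<Sum>v\<in>A. of_real (w v) / (1 + of_real v * t\<^sup>2))"
proof -
  have factor: "poly [:1, 0, complex_of_real v:] t = 1 + of_real v * t\<^sup>2" for v
    by (simp add: power2_eq_square mult_ac)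
  show "poly (quadrature_denominator A) t \<noteq> 0"
    unfolding quadrature_denominator_def poly_prod factor using assms by simp
  have "of_real (w v) * (\<Prod>u\<in>A - {v}. 1 + of_real u * t\<^sup>2)
      = (\<Prod>u\<in>A. 1 + of_real u * t\<^sup>2) * (of_real (w v) / (1 + of_real v * t\<^sup>2))" if "v \<in> A" for v
    using nz[OF that] by (simp add: prod.remove[OF assms(1) that])
  thus "poly (quadrature_numerator A w) t
           = poly (quadrature_denominator A) t * (\<Sum>v\<in>A. of_real (w v) / (1 + of_real v * t\<^sup>2))"
    unfolding quadrature_numerator_def quadrature_denominator_def poly_sum poly_smult poly_prod factor sum_distrib_left
    by (intro sum.cong) auto
qed

text \<open>
  The power series of \<open>1 / (1 + v t\<^sup>2)\<close>.
\<close>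

definition even_geometric_fps :: "complex \<Rightarrow> complex fps" where
  "even_geometric_fps v = Abs_fps (\<lambda>i. if even i then (- v) ^ (i div 2) else 0)"

lemma even_geometric_fps_inverse: "fps_of_poly [:1, 0, v:] * even_geometric_fps v = 1"
proof (rule fps_ext)
  fix i
  have eq: "fps_of_poly [:1, 0, v:] = 1 + fps_const v * fps_X ^ 2"
    by (simp add: fps_of_poly_pCons power2_eq_square algebra_simps)
  have "fps_nth (fps_of_poly [:1, 0, v:] * even_geometric_fps v) i
      = fps_nth (even_geometric_fps v) i + v * (if i < 2 then 0 else fps_nth (even_geometric_fps v) (i - 2))"
    unfolding eq distrib_right mult_1_left mult.assoc fps_add_nth fps_mult_left_const_nth fps_X_power_mult_nth ..
  also have "\<dots> = fps_nth 1 i"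
  proof (cases "i < 2")
    case True
    thus ?thesis by (cases "i = 0") (auto simp: even_geometric_fps_def less_2_cases_iff)
  next
    case False
    then obtain k where "i = k + 2" by (metis add.commute le_Suc_ex not_less)
    thus ?thesis by (simp add: even_geometric_fps_def)
  qed
  finally show "fps_nth (fps_of_poly [:1, 0, v:] * even_geometric_fps v) i = fps_nth 1 i" .
qed

lemma fps_quadrature_numerator:
  assumes "finite A"
  shows "fps_of_poly (quadrature_numerator A w)
      = fps_of_poly (quadrature_denominator A) * (\<Sum>v\<in>A. fps_const (of_real (w v)) * even_geometric_fps (of_real v))"
proof -
  have "fps_of_poly (smult (of_real (w v)) (\<Prod>u\<in>A - {v}. [:1, 0, of_real u:]))
     = fps_of_poly (quadrature_denominator A) * (fps_const (of_real (w v)) * even_geometric_fps (of_real v))"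
    if "v \<in> A" for v
  proof -
    have "quadrature_denominator A = [:1, 0, of_real v:] * (\<Prod>u\<in>A - {v}. [:1, 0, of_real u:])"
      unfolding quadrature_denominator_def by (rule prod.remove[OF assms that])
    hence "fps_of_poly (quadrature_denominator A) * (fps_const (of_real (w v)) * even_geometric_fps (of_real v))
        = fps_const (of_real (w v)) * fps_of_poly (\<Prod>u\<in>A - {v}. [:1, 0, of_real u:])
            * (fps_of_poly [:1, 0, of_real v:] * even_geometric_fps (of_real v))"
      by (simp only: fps_of_poly_mult mult_ac)
    thus ?thesis by (simp only: even_geometric_fps_inverse fps_of_poly_smult mult_1_right)
  qed
  thus ?thesis
    unfolding quadrature_numerator_def fps_of_poly_sum sum_distrib_left by (intro sum.cong) auto
qed

definition psi_head :: "complex \<Rightarrow> nat \<Rightarrow> complex poly" where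
  "psi_head s J = Poly (map (fps_nth (Psi_fps s)) [0..<2 * J + 2])"

lemma coeff_psi_head: "coeff (psi_head s J) i = (if i < 2 * J + 2 then fps_nth (Psi_fps s) i else 0)"
  by (simp add: psi_head_def nth_default_def coeff_Poly_eq del: upt_Suc)

lemma degree_psi_head: "degree (psi_head s J) \<le> max 1 (2 * J)"
proof (rule degree_le, intro allI impI)
  fix i assume i: "i > max 1 (2 * J)"
  show "coeff (psi_head s J) i = 0"
  proof (cases "i < 2 * J + 2")
    case True
    hence "i = 2 * (J - 1) + 3" using i by auto
    thus ?thesis using Psi_fps_coeffs(4)[of s "J - 1"] by (simp add: coeff_psi_head)
  qed (simp add: coeff_psi_head)
qed

lemma poly_psi_head:
  "poly (psi_head s J) t = 1 / (s - 1) + 1 / 2 * t + (\<Sum>k<J. fps_nth (Psi_fps s) (2 * k + 2) * t ^ (2 * k + 2))"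
proof -
  have "poly (psi_head s J) t = (\<Sum>i<2 * J + 2. fps_nth (Psi_fps s) i * t ^ i)"
  proof -
    have "degree (psi_head s J) < 2 * J + 2" using degree_psi_head[of s J] by linarith
    hence "poly (psi_head s J) t = (\<Sum>i<2 * J + 2. coeff (psi_head s J) i * t ^ i)"
      unfolding poly_altdef by (intro sum.mono_neutral_left) (auto simp: coeff_eq_0)
    thus ?thesis by (simp add: coeff_psi_head)
  qed
  also have "\<dots> = 1 / (s - 1) + 1 / 2 * t + (\<Sum>k<J. fps_nth (Psi_fps s) (2 * k + 2) * t ^ (2 * k + 2))"
  proof (induction J)
    case 0
    show ?case using Psi_fps_coeffs(1,2)[of s] by (simp add: numeral_2_eq_2)
  next
    case (Suc J)
    have "2 * Suc J + 2 = Suc (Suc (2 * J + 2))" by simp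
    moreover have "fps_nth (Psi_fps s) (Suc (2 * J + 2)) = 0"
      using Psi_fps_coeffs(4)[of s J] by (simp add: eval_nat_numeral)
    ultimately show ?case using Suc.IH by (simp only: sum.lessThan_Suc) simp
  qed
  finally show ?thesis .
qed

definition pade_value :: "complex \<Rightarrow> nat \<Rightarrow> real set \<Rightarrow> (real \<Rightarrow> real) \<Rightarrow> complex \<Rightarrow> complex" where
  "pade_value s J A w t = poly (psi_head s J) t
      + (-1) ^ J * t ^ (2 * J + 2) * (\<Sum>v\<in>A. of_real (w v) / (1 + of_real v * t\<^sup>2))"

text \<open>
  The quadrature with \<open>l\<close> nodes matches \<open>2l\<close> moments, so \<open>pade_value\<close> agrees with \<open>\<Psi>\<close> up to order
  \<open>2J + 2 + 4l\<close> in \<open>t\<close>.  The extra power \<open>t\<^sup>e\<close> on numerator and denominator cancels in the rational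
  function, but raises the order of contact of the pair; it is needed when the
  approximant is degenerate, that is, when numerator and denominator do not use the available degrees.
\<close>

lemma pade_approximant_quadrature:
  assumes fin: "finite A" and card: "card A = l"
    and mom: "\<And>k. k < 2 * l \<Longrightarrow> of_real (\<Sum>v\<in>A. w v * v ^ k) = (-1) ^ (J + k) * fps_nth (Psi_fps s) (2 * (J + k) + 2)"
    and deg: "e + 2 * l \<le> m2" "e + 2 * l + max 1 (2 * J) \<le> m1" "m1 + m2 < e + 2 * J + 2 + 4 * l"
    and nz: "\<And>v. v \<in> A \<Longrightarrow> 1 + of_real v * t\<^sup>2 \<noteq> 0" and t: "t \<noteq> 0"
  shows "\<not> ratfun_pole (pade_approximant (Psi_fps s) m1 m2) t"
    and "ratfun_eval (pade_approximant (Psi_fps s) m1 m2) t = pade_value s J A w t"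
proof -
  define P where "P = quadrature_denominator A"
  define R where "R = quadrature_numerator A w"
  define T where "T = psi_head s J"
  define Q where "Q = T * P + monom ((-1) ^ J) (2 * J + 2) * R"
  define G where "G = (\<Sum>v\<in>A. fps_const (of_real (w v)) * even_geometric_fps (of_real v))"
  define E where "E = Psi_fps s - fps_of_poly T - fps_const ((-1) ^ J) * (fps_X ^ (2 * J + 2) * G)"
  have G_nth: "fps_nth G i = (if even i then (\<Sum>v\<in>A. of_real (w v) * (- of_real v) ^ (i div 2)) else 0)" for i
    by (simp add: G_def fps_sum_nth even_geometric_fps_def)
  have E0: "fps_nth E i = 0" if i: "i < 2 * J + 2 + 4 * l" for i
  proof (cases "i < 2 * J + 2")
    case True
    thus ?thesis
      unfolding E_def T_def fps_sub_nth fps_mult_left_const_nth fps_of_poly_nth coeff_psi_head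
        fps_X_power_mult_nth by simp
  next
    case False
    then obtain m where m: "i = 2 * J + 2 + m" by (metis le_Suc_ex not_less)
    have E_nth: "fps_nth E i = fps_nth (Psi_fps s) i - (-1) ^ J * fps_nth G m"
    proof -
      have "fps_nth (fps_X ^ (2 * J + 2) * G) i = fps_nth G m"
        unfolding fps_X_power_mult_nth using m by simp
      thus ?thesis
        unfolding E_def T_def fps_sub_nth fps_mult_left_const_nth fps_of_poly_nth coeff_psi_head
        using False by simp
    qed
    show ?thesis
    proof (cases "even m")
      case True
      then obtain k where k: "m = 2 * k" by (rule evenE)
      have "fps_nth G m = (-1) ^ k * of_real (\<Sum>v\<in>A. w v * v ^ k)"
        unfolding G_nth k by (simp add: sum_distrib_left power_minus[of "of_real _"] mult_ac)
      also have "of_real (\<Sum>v\<in>A. w v * v ^ k) = (-1) ^ (J + k) * fps_nth (Psi_fps s) i"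
        using mom[of k] i by (simp add: m k algebra_simps)
      also have "(-1) ^ J * ((-1) ^ k * ((-1) ^ (J + k) * fps_nth (Psi_fps s) i)) = fps_nth (Psi_fps s) i"
      proof -
        have "(-1) ^ J * ((-1) ^ k * (-1) ^ (J + k)) = (1 :: complex)"
          by (simp add: power_add mult_ac flip: power_mult_distrib)
        thus ?thesis by (metis mult.assoc mult_1)
      qed
      finally show ?thesis unfolding E_nth by simp
    next
      case False
      then obtain k where k: "m = 2 * k + 1" by (rule oddE)
      have "i = 2 * (J + k) + 3" by (simp add: m k)
      thus ?thesis unfolding E_nth using Psi_fps_coeffs(4)[of s "J + k"] False by (simp add: G_nth)
    qed
  qed
  have PE: "fps_of_poly P * Psi_fps s - fps_of_poly Q = fps_of_poly P * E"
    unfolding Q_def E_def R_def P_def G_def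
    by (simp add: fps_of_poly_add fps_of_poly_mult fps_quadrature_numerator[OF fin] fps_of_poly_monom algebra_simps)
  have Pt: "poly P t \<noteq> 0" unfolding P_def by (rule poly_quadrature(1)[OF fin nz])
  define Pe where "Pe = monom 1 e * P"
  define Qe where "Qe = monom 1 e * Q"
  have degP: "degree P \<le> 2 * l" using degree_quadrature_denominator[of A] card by (simp add: P_def)
  have degQ: "degree Q \<le> 2 * l + max 1 (2 * J)"
    unfolding Q_def
  proof (rule degree_add_le)
    show "degree (T * P) \<le> 2 * l + max 1 (2 * J)"
      using degree_mult_le[of T P] degP degree_psi_head[of s J] by (simp add: T_def)
    show "degree (monom ((-1) ^ J) (2 * J + 2) * R) \<le> 2 * l + max 1 (2 * J)"
    proof (cases "l = 0")
      case True
      hence "A = {}" using fin card by simp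
      thus ?thesis by (simp add: R_def quadrature_numerator_def)
    next
      case False
      have "degree (monom ((-1 :: complex) ^ J) (2 * J + 2)) \<le> 2 * J + 2" by (rule degree_monom_le)
      moreover have "degree R \<le> 2 * l - 2"
        using degree_quadrature_numerator[OF fin, of w] card by (simp add: R_def)
      ultimately show ?thesis
        using degree_mult_le[of "monom ((-1) ^ J) (2 * J + 2)" R] False by linarith
    qed
  qed
  have "is_pade_pair (Psi_fps s) m1 m2 Qe Pe"
    unfolding is_pade_pair_def
  proof (intro conjI allI impI)
    have m: "degree (monom (1 :: complex) e) \<le> e" by (rule degree_monom_le)
    show "degree Qe \<le> m1" unfolding Qe_def
      using degree_mult_le[of "monom 1 e" Q] m degQ deg(2) by linarith
    show "degree Pe \<le> m2" unfolding Pe_def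
      using degree_mult_le[of "monom 1 e" P] m degP deg(1) by linarith
    show "Pe \<noteq> 0" unfolding Pe_def using Pt by auto
    fix i assume "i < m1 + m2 + 1"
    hence i: "i < e + (2 * J + 2 + 4 * l)" using deg(3) by linarith
    have "fps_of_poly Pe * Psi_fps s - fps_of_poly Qe = fps_X ^ e * (fps_of_poly P * E)"
      unfolding Pe_def Qe_def PE[symmetric]
      by (simp add: fps_of_poly_mult fps_of_poly_monom algebra_simps)
    moreover have "fps_nth (fps_of_poly P * E) (i - e) = 0" if "i \<ge> e"
      using i that by (intro fps_nth_mult_eq_0[OF E0]) auto
    ultimately show "fps_nth (fps_of_poly Pe * Psi_fps s - fps_of_poly Qe) i = 0"
      by (simp add: fps_X_power_mult_nth)
  qed
  hence eq: "pade_approximant (Psi_fps s) m1 m2 = Fract Qe Pe" by (rule pade_approximant_eqI)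
  have Pet: "poly Pe t \<noteq> 0" using Pt t by (simp add: Pe_def poly_monom)
  show "\<not> ratfun_pole (pade_approximant (Psi_fps s) m1 m2) t"
    unfolding eq by (rule ratfun_Fract(1)[OF Pet])
  have "ratfun_eval (pade_approximant (Psi_fps s) m1 m2) t = poly Qe t / poly Pe t"
    unfolding eq by (rule ratfun_Fract(2)[OF Pet])
  also have "\<dots> = poly Q t / poly P t" using t by (simp add: Qe_def Pe_def poly_monom)
  also have "poly Q t = poly P t * pade_value s J A w t"
  proof -
    have "poly R t = poly P t * (\<Sum>v\<in>A. of_real (w v) / (1 + of_real v * t\<^sup>2))"
      unfolding R_def P_def by (rule poly_quadrature(2)[OF fin]) (rule nz)
    thus ?thesis
      unfolding Q_def poly_add poly_mult pade_value_def T_def poly_monom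
      by (simp only: distrib_left mult_ac)
  qed
  finally show "ratfun_eval (pade_approximant (Psi_fps s) m1 m2) t = pade_value s J A w t"
    using Pt by simp
qed

lemma gauss_nodes_exist:
  assumes s: "s > 0"
  obtains A w where
    "\<And>l. finite (A l)" "\<And>l. card (A l) = l" "\<And>l v. v \<in> A l \<Longrightarrow> v \<ge> 0 \<and> w l v \<ge> 0"
    "\<And>l k. k < 2 * l \<Longrightarrow> (\<Sum>v\<in>A l. w l v * v ^ k) = (\<integral>p. node p ^ (2 * k) \<partial>stieltjes_measure s J)"
proof -
  interpret positive_functional "stieltjes_functional s J" by (rule stieltjes_positive_functional[OF s])
  have "\<forall>l. \<exists>A w. finite A \<and> card A = l \<and> (\<forall>v\<in>A. v \<ge> 0 \<and> w v \<ge> 0) \<and>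
         (\<forall>q. degree q < 2 * l \<longrightarrow> stieltjes_functional s J q = (\<Sum>v\<in>A. w v * poly q v))"
    using gauss_quadrature by blast
  then obtain A w where *: "\<And>l. finite (A l) \<and> card (A l) = l \<and> (\<forall>v\<in>A l. v \<ge> 0 \<and> w l v \<ge> 0) \<and>
         (\<forall>q. degree q < 2 * l \<longrightarrow> stieltjes_functional s J q = (\<Sum>v\<in>A l. w l v * poly q v))"
    by metis
  have "(\<Sum>v\<in>A l. w l v * v ^ k) = (\<integral>p. node p ^ (2 * k) \<partial>stieltjes_measure s J)" if "k < 2 * l" for l k
  proof -
    have "degree (monom (1 :: real) k) < 2 * l" using that degree_monom_le[of "1 :: real" k] by linarith
    hence "stieltjes_functional s J (monom 1 k) = (\<Sum>v\<in>A l. w l v * poly (monom 1 k) v)" using * by blast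
    thus ?thesis by (simp add: stieltjes_functional_def poly_monom power_mult)
  qed
  thus ?thesis using * by (intro that[of A w]) auto
qed

text \<open>
  For fixed \<open>J\<close>, all approximants that arise from the measure \<open>y\<^bsup>2J\<^esup> d\<nu>\<close> are the members of one
  convergent sequence, and its limit does not depend on \<open>J\<close>.
\<close>

lemma pade_rows:
  assumes s: "s > 0" and z: "Re z > 0"
  obtains V where "V \<longlonglongrightarrow> 1 / (of_real s - 1) + 1 / 2 * (1 / z) + 1 / z\<^sup>2 * stieltjes_transform s 0 z"
    and "\<And>l e m1 m2. e + 2 * l \<le> m2 \<Longrightarrow> e + 2 * l + max 1 (2 * J) \<le> m1 \<Longrightarrow> m1 + m2 < e + 2 * J + 2 + 4 * l \<Longrightarrow>
          \<not> ratfun_pole (pade_approximant (Psi_fps (of_real s)) m1 m2) (1 / z) \<and>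
          ratfun_eval (pade_approximant (Psi_fps (of_real s)) m1 m2) (1 / z) = V l"
proof -
  obtain A w where A: "\<And>l. finite (A l)" "\<And>l. card (A l) = l" "\<And>l v. v \<in> A l \<Longrightarrow> v \<ge> 0 \<and> w l v \<ge> 0"
    and moments: "\<And>l k. k < 2 * l \<Longrightarrow> (\<Sum>v\<in>A l. w l v * v ^ k) = (\<integral>p. node p ^ (2 * k) \<partial>stieltjes_measure s J)"
    by (rule gauss_nodes_exist[OF s, where J = J]) blast
  define V where "V l = pade_value (of_real s) J (A l) (w l) (1 / z)" for l
  have z0: "z \<noteq> 0" using z by auto
  have nz: "1 + of_real v * (1 / z)\<^sup>2 \<noteq> 0" if "v \<in> A l" for v l
    using one_plus_square_ratio_nonzero[OF z, of "sqrt v"] A(3)[OF that] by (simp add: power_divide)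
  interpret moment_convergence "stieltjes_measure s J" node A w
  proof
    show "node \<in> borel_measurable (stieltjes_measure s J)" by (simp add: node_measurable)
    show "node x \<ge> 0" if "x \<in> space (stieltjes_measure s J)" for x
      using that by (intro node_nonneg) simp
    show "integrable (stieltjes_measure s J) (\<lambda>p. exp (node p))" by (rule integrable_stieltjes_exp[OF s])
    show "\<forall>\<^sub>F l in sequentially. (\<Sum>v\<in>A l. w l v * v ^ k) = (\<integral>p. node p ^ (2 * k) \<partial>stieltjes_measure s J)" for k
      using eventually_gt_at_top[of k] by eventually_elim (intro moments, simp)
  qed (use A in auto)
  have "(\<lambda>l. \<Sum>v\<in>A l. of_real (w l v) / (1 + of_real v / z\<^sup>2)) \<longlonglongrightarrow> stieltjes_transform s J z"
    unfolding stieltjes_transform_def by (rule stieltjes_quadrature_convergence[OF z])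
  hence "(\<lambda>l. poly (psi_head (of_real s) J) (1 / z)
              + (-1) ^ J * (1 / z) ^ (2 * J + 2) * (\<Sum>v\<in>A l. of_real (w l v) / (1 + of_real v / z\<^sup>2)))
      \<longlonglongrightarrow> poly (psi_head (of_real s) J) (1 / z) + (-1) ^ J * (1 / z) ^ (2 * J + 2) * stieltjes_transform s J z"
    by (intro tendsto_add tendsto_mult tendsto_const)
  hence "V \<longlonglongrightarrow> poly (psi_head (of_real s) J) (1 / z) + (-1) ^ J * (1 / z) ^ (2 * J + 2) * stieltjes_transform s J z"
    unfolding V_def[abs_def] pade_value_def by (simp add: power_divide)
  also have "poly (psi_head (of_real s) J) (1 / z) + (-1) ^ J * (1 / z) ^ (2 * J + 2) * stieltjes_transform s J z
      = 1 / (of_real s - 1) + 1 / 2 * (1 / z) + 1 / z\<^sup>2 * stieltjes_transform s 0 z"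
    unfolding poly_psi_head stieltjes_transform_expansion[OF s z, of J] by (simp only: add.assoc)
  finally have lim: "V \<longlonglongrightarrow> 1 / (of_real s - 1) + 1 / 2 * (1 / z) + 1 / z\<^sup>2 * stieltjes_transform s 0 z" .
  have coeffs: "of_real (\<Sum>v\<in>A l. w l v * v ^ k) = (-1) ^ (J + k) * fps_nth (Psi_fps (of_real s)) (2 * (J + k) + 2)"
    if "k < 2 * l" for l k
  proof -
    have "(-1) ^ (J + k) * ((-1) ^ (J + k) * c) = c" for c :: complex
      by (metis left_right_inverse_power mult.assoc mult_1 mult_minus1 mult_minus1_right minus_minus)
    thus ?thesis
      unfolding moments[OF that] stieltjes_moment[OF s] Psi_fps_coeffs pochhammer_of_real
      by (simp add: mult_ac)
  qed
  have t: "1 / z \<noteq> 0" using z0 by simp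
  show ?thesis
  proof (rule that[OF lim])
    fix l e m1 m2 :: nat
    assume d: "e + 2 * l \<le> m2" "e + 2 * l + max 1 (2 * J) \<le> m1" "m1 + m2 < e + 2 * J + 2 + 4 * l"
    show "\<not> ratfun_pole (pade_approximant (Psi_fps (of_real s)) m1 m2) (1 / z) \<and>
          ratfun_eval (pade_approximant (Psi_fps (of_real s)) m1 m2) (1 / z) = V l"
      unfolding V_def
      by (intro conjI pade_approximant_quadrature[OF A(1) A(2) coeffs d nz t]) assumption+
  qed
qed

text \<open>
  Beyond \<open>t/2\<close> only even powers of \<open>t\<close> occur in \<open>\<Psi>\<close>, and a denominator of degree \<open>m\<close> has room for
  \<open>m div 2\<close> factors \<open>1 + v t\<^sup>2\<close>.  The number \<open>J\<close> of separated moments and the exponent \<open>e\<close> are then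
  forced by the order of contact and the degree bounds.  For odd \<open>p\<close> the value of \<open>J\<close> alternates with
  the parity of \<open>m\<close>, so the sequence is interlaced from two sequences with the same limit.  The
  hypothesis \<open>p \<ge> 1\<close> makes room for \<open>t/2\<close> in the numerator.
\<close>

lemma pade_psi_convergence:
  assumes s: "s > 0" and z: "Re z > 0" and p: "p \<ge> 1"
  shows "\<not> ratfun_pole (pade_approximant (Psi_fps (of_real s)) (m + p) m) (1 / z)"
    and "(\<lambda>m. ratfun_eval (pade_approximant (Psi_fps (of_real s)) (m + p) m) (1 / z))
           \<longlonglongrightarrow> 1 / (of_real s - 1) + 1 / 2 * (1 / z) + 1 / z\<^sup>2 * stieltjes_transform s 0 z"
proof -
  let ?\<Psi> = "1 / (of_real s - 1) + 1 / 2 * (1 / z) + 1 / z\<^sup>2 * stieltjes_transform s 0 z"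
  let ?pade = "\<lambda>m. pade_approximant (Psi_fps (of_real s)) (m + p) m"
  define J where "J m = (p + m mod 2) div 2" for m
  define e where "e m = (if odd (m :: nat) \<and> even p then 1 else 0 :: nat)" for m
  obtain V where V: "\<And>J. V J \<longlonglongrightarrow> ?\<Psi>"
    and val: "\<And>J l e m1 m2. e + 2 * l \<le> m2 \<Longrightarrow> e + 2 * l + max 1 (2 * J) \<le> m1 \<Longrightarrow> m1 + m2 < e + 2 * J + 2 + 4 * l \<Longrightarrow>
          \<not> ratfun_pole (pade_approximant (Psi_fps (of_real s)) m1 m2) (1 / z) \<and>
          ratfun_eval (pade_approximant (Psi_fps (of_real s)) m1 m2) (1 / z) = V J l"
  proof -
    have "\<forall>J. \<exists>V. V \<longlonglongrightarrow> ?\<Psi> \<and> (\<forall>l e m1 m2. e + 2 * l \<le> m2 \<longrightarrow> e + 2 * l + max 1 (2 * J) \<le> m1 \<longrightarrow>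
          m1 + m2 < e + 2 * J + 2 + 4 * l \<longrightarrow>
          \<not> ratfun_pole (pade_approximant (Psi_fps (of_real s)) m1 m2) (1 / z) \<and>
          ratfun_eval (pade_approximant (Psi_fps (of_real s)) m1 m2) (1 / z) = V l)"
      by (intro allI, rule pade_rows[OF s z]) blast
    thus ?thesis using that by metis
  qed
  have arith: "e m + 2 * (m div 2) \<le> m" "e m + 2 * (m div 2) + max 1 (2 * J m) \<le> m + p"
      "(m + p) + m < e m + 2 * J m + 2 + 4 * (m div 2)" for m
    using p unfolding e_def J_def by (auto simp: max_def elim!: evenE oddE) presburger+
  have *: "\<not> ratfun_pole (?pade m) (1 / z) \<and> ratfun_eval (?pade m) (1 / z) = V (J m) (m div 2)" for m
    by (rule val[OF arith])
  thus "\<not> ratfun_pole (?pade m) (1 / z)" by blast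
  have half: "filterlim (\<lambda>m::nat. m div 2) sequentially sequentially"
    unfolding filterlim_at_top
  proof
    fix Z :: nat
    show "\<forall>\<^sub>F m in sequentially. Z \<le> m div 2"
      using eventually_ge_at_top[of "2 * Z"] by eventually_elim simp
  qed
  have "(\<lambda>m. V (J m) (m div 2)) \<longlonglongrightarrow> ?\<Psi>"
  proof (rule tendstoI)
    fix \<epsilon> :: real assume "\<epsilon> > 0"
    hence "\<forall>\<^sub>F m in sequentially. dist (V j (m div 2)) ?\<Psi> < \<epsilon>" for j
      using tendstoD[OF filterlim_compose[OF V half]] by blast
    hence "\<forall>\<^sub>F m in sequentially. \<forall>j\<in>{p div 2, (p + 1) div 2}. dist (V j (m div 2)) ?\<Psi> < \<epsilon>"
      by (simp add: eventually_conj_iff)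
    thus "\<forall>\<^sub>F m in sequentially. dist (V (J m) (m div 2)) ?\<Psi> < \<epsilon>"
    proof eventually_elim
      case (elim m)
      have "J m \<in> {p div 2, (p + 1) div 2}"
        unfolding J_def by (cases "even m") (auto simp: odd_iff_mod_2_eq_one even_iff_mod_2_eq_zero)
      thus ?case using elim by blast
    qed
  qed
  thus "(\<lambda>m. ratfun_eval (?pade m) (1 / z)) \<longlonglongrightarrow> ?\<Psi>" using * by simp
qed

theorem theorem3:
  fixes s :: real and a :: complex and n p :: nat
  assumes "s > 0" and "s \<noteq> 1" and "Re a > 0" and "p \<ge> 1"
  shows "(\<forall>m. \<not> ratfun_pole (pade_approximant (Psi_fps (of_real s)) (m + p) m) (1 / (of_nat n + a))) \<and>
         (\<lambda>m. RPA (of_real s) a n (m + p) m) \<longlonglongrightarrow> hurwitz_zeta (of_real s) a"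
proof
  define z where "z = of_nat n + a"
  have z: "Re z > 0" using assms by (simp add: z_def)
  show "\<forall>m. \<not> ratfun_pole (pade_approximant (Psi_fps (of_real s)) (m + p) m) (1 / (of_nat n + a))"
    using pade_psi_convergence(1)[OF assms(1) z assms(4)] by (simp add: z_def)
  have "(\<lambda>m. (\<Sum>k<n. 1 / (of_nat k + a) powr of_real s) + z powr (1 - of_real s) *
           ratfun_eval (pade_approximant (Psi_fps (of_real s)) (m + p) m) (1 / z))
      \<longlonglongrightarrow> (\<Sum>k<n. 1 / (of_nat k + a) powr of_real s) + z powr (1 - of_real s) *
           (1 / (of_real s - 1) + 1 / 2 * (1 / z) + 1 / z\<^sup>2 * stieltjes_transform s 0 z)"
    by (intro tendsto_add tendsto_mult tendsto_const pade_psi_convergence(2) assms z)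
  also have "(\<Sum>k<n. 1 / (of_nat k + a) powr of_real s) + z powr (1 - of_real s) *
           (1 / (of_real s - 1) + 1 / 2 * (1 / z) + 1 / z\<^sup>2 * stieltjes_transform s 0 z) = hurwitz_zeta (of_real s) a"
    unfolding hurwitz_branch_stieltjes[OF assms(1) z, symmetric] unfolding z_def
    using hurwitz_zeta_shifted[of a "of_real s" n] assms
    by (simp add: powr_minus inverse_eq_divide)
  finally show "(\<lambda>m. RPA (of_real s) a n (m + p) m) \<longlonglongrightarrow> hurwitz_zeta (of_real s) a"
    by (simp add: RPA_def z_def)
qed

end
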